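(* Let $\mu$ be a probability measure on $\mathbb{R}^d$ and let $W:\mathbb{R}^d\to\mathcal{S}_+^d$ be a symmetric positive-semidefinite matrix field such that the injection of $H^1(\mu,W)$ in $L^2(\mu)$ is compact and $H^1(\mu,W)$ is dense in $L^2(\mu)$. If $C(\mu,W)<\infty$, then there exists an orthonormal basis $\{u_i^W\}_{i=1}^\infty$ of $L^2(\mu)$ that forms an eigenbasis for $-\mathcal{L}_\mu^W$, that is, $-\mathcal{L}_\mu^Wu_i^W=\lambda_i^Wu_i^W$, where $\lambda_i^W\ge 0$ is the $i$-th smallest eigenvalue of $-\mathcal{L}_\mu^W$. In addition, the following properties hold. 1. $\lambda_i^W\to+\infty$ as $i\to+\infty$. 2. The first eigenvalue is trivial, $\lambda_1^W=0$, and the associated eigenfunction is the constant function $u_1^W=\mathbf{1}$. 3. The second eigenvalue is positive, $\lambda_2^W>0$, and satisfies $\lambda_2^W=\frac{1}{C(\mu,W)}$. 4. The set of minimizers of $\frac{\int\nabla f^\top W\nabla f\,\mathrm{d}\mu}{\int f^2\,\mathrm{d}\mu}$ over $f\in H^1(\mu,W)$ with $\int f\,\mathrm{d}\mu=0$ is the eigenspace $\mathrm{span}\{u_2^W,\ldots,u_{m+1}^W\}$ associated with the eigenvalue $\lambda_2^W$, and its dimension $m$ is necessarily finite. Moreover, the super-differential of the concave function $W\mapsto\lambda_2^W$ is given by $$\partial_W\lambda_2^W=\overline{\mathrm{conv}}\left\{\frac{\nabla u\,\nabla u^\top}{\int u^2\,\mathrm{d}\mu}\;:\;u\in\mathrm{span}\{u_2^W,\ldots,u_{m+1}^W\}\right\},$$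 where the closure of the convex hull is with respect to the topology induced by the norm $\|A\|_{L^2(\mu;\mathbb{R}^{d\times d})}=(\int\|A\|_F^2\,\mathrm{d}\mu)^{1/2}$ on matrix fields. In particular, if $m=1$, then $\lambda_2^W$ is differentiable and $$\nabla\lambda_2^W=\frac{(\nabla u_2^W)(\nabla u_2^W)^\top}{\int(u_2^W)^2\,\mathrm{d}\mu}.$$
   Context: $\mathcal{S}_+^d\subset\mathbb{R}^{d\times d}$ is the convex cone of symmetric positive-semidefinite matrices; $\|\cdot\|_F$ is the Frobenius norm. $L^2(\mu)=\{f:\int f^2\,\mathrm{d}\mu<\infty\}$ and $$H^1(\mu,W)=\Big\{f:\mathbb{R}^d\to\mathbb{R}:\ \|f\|_{H^1(\mu,W)}^2=\int f^2\,\mathrm{d}\mu+\int\nabla f^\top W\nabla f\,\mathrm{d}\mu<\infty\Big\},$$ a Sobolev (Hilbert) space, with $\nabla f$ the weak gradient. The operator $\mathcal{L}_\mu^W$ from $H^1(\mu,W)$ to its dual is defined by $$\int f\,\mathcal{L}_\mu^Wg\,\mathrm{d}\mu=-\int\nabla f^\top W\nabla g\,\mathrm{d}\mu\qquad\text{for all } f,g\in H^1(\mu,W),$$ so the eigenvalue equation is understood in this weak sense, eigenvalues being counted with multiplicity. The Poincaré constant $C(\mu,W)$ is the smallest constant in $\mathrm{Var}_\mu(f)\le C(\mu,W)\int\nabla f^\top W\nabla f\,\mathrm{d}\mu$, $f\in H^1(\mu,W)$, i.e. $$\frac{1}{C(\mu,W)}=\inf_{\substack{f\in H^1(\mu,W)\\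 \int f\,\mathrm{d}\mu=0}}\frac{\int\nabla f^\top W\nabla f\,\mathrm{d}\mu}{\int f^2\,\mathrm{d}\mu}.$$ In quotients of the form above, $f$ and $u$ are nonzero. The function $W\mapsto\lambda_2^W$ is the concave function $W\mapsto C(\mu,W)^{-1}$ on the cone of symmetric positive-semidefinite matrix fields. Super-differentials and gradients are taken with respect to the scalar product $\langle W,G\rangle=\int\mathrm{tr}(WG)\,\mathrm{d}\mu$: the super-differential $\partial_W\lambda_2^W$ at $W$ is the set of all matrix fields $G$ such that $$\frac{1}{C(\mu,W')}\le\frac{1}{C(\mu,W)}+\int\mathrm{tr}\big((W'-W)G\big)\,\mathrm{d}\mu$$ for any symmetric positive-semidefinite matrix field $W'$ (with $W'\preceq\Omega W$ pointwise in the Loewner order for some constant $\Omega$).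
   Formalization: The super-differential is taken among symmetric G and, for singular W, equals the closed hull only up to fields with equal WGW a.e.; equality is literal if W is positive definite a.e. Point masses are excluded, H¹ is assumed a well-defined Hilbert space, and differentiability is directional. *)

theory Defs
  imports "HOL-Probability.Probability_Measure"
begin

definition psd :: "real^'n^'n \<Rightarrow> bool" where
  "psd A \<longleftrightarrow> transpose A = A \<and> (\<forall>v. 0 \<le> v \<bullet> (A *v v))"

definition loewner_le :: "real^'n^'n \<Rightarrow> real^'n^'n \<Rightarrow> bool" where
  "loewner_le A B \<longleftrightarrow> psd (B - A)"

definition sym_field :: "(real^'n \<Rightarrow> real^'n^'n) \<Rightarrow> bool" where
  "sym_field G \<longleftrightarrow> G \<in> borel_measurable borel \<and> (\<forall>x. transpose (G x) = G x)"

definition psd_field :: "(real^'n \<Rightarrow> real^'n^'n) \<Rightarrow> bool" where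
  "psd_field W \<longleftrightarrow> W \<in> borel_measurable borel \<and> (\<forall>x. psd (W x))"

definition outer :: "real^'n \<Rightarrow> real^'n^'n" where
  "outer v = (\<chi> i j. v $ i * v $ j)"

text \<open>\<open>D \<alpha>\<close> is the iterated partial derivative of \<open>\<phi>\<close> along the list of coordinates \<open>\<alpha>\<close>;
  all of them exist and are Frechet differentiable.\<close>

definition smooth :: "(real^'n \<Rightarrow> real) \<Rightarrow> bool" where
  "smooth \<phi> \<longleftrightarrow> (\<exists>D :: 'n list \<Rightarrow> real^'n \<Rightarrow> real. D [] = \<phi> \<and>
     (\<forall>\<alpha> x. (D \<alpha> has_derivative (\<lambda>h. \<Sum>i\<in>UNIV. h $ i * D (i # \<alpha>) x)) (at x)))"

definition test_function :: "(real^'n \<Rightarrow> real) \<Rightarrow> bool" where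
  "test_function \<phi> \<longleftrightarrow> smooth \<phi> \<and> compact (closure {x. \<phi> x \<noteq> 0})"

definition has_weak_gradient :: "(real^'n \<Rightarrow> real) \<Rightarrow> (real^'n \<Rightarrow> real^'n) \<Rightarrow> bool" where
  "has_weak_gradient f g \<longleftrightarrow>
     f \<in> borel_measurable borel \<and> g \<in> borel_measurable borel \<and>
     (\<forall>K. compact K \<longrightarrow> set_integrable lborel K f \<and> set_integrable lborel K g) \<and>
     (\<forall>\<phi> i. test_function \<phi> \<longrightarrow>
        (\<integral>x. f x * frechet_derivative \<phi> (at x) (axis i 1) \<partial>lborel) = - (\<integral>x. g x $ i * \<phi> x \<partial>lborel))"

text \<open>Elements of \<open>L\<^sup>2(\<mu>)\<close> are functions modulo \<open>\<mu>\<close>-null sets, so a weak gradient of \<open>f\<close> is that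
  of any representative of \<open>f\<close>.\<close>

definition weak_gradient_of ::
  "(real^'n) measure \<Rightarrow> (real^'n \<Rightarrow> real) \<Rightarrow> (real^'n \<Rightarrow> real^'n) \<Rightarrow> bool" where
  "weak_gradient_of \<mu> f g \<longleftrightarrow>
     f \<in> borel_measurable borel \<and> g \<in> borel_measurable borel \<and>
     (\<exists>f' g'. has_weak_gradient f' g' \<and> (AE x in \<mu>. f x = f' x \<and> g x = g' x))"

definition weakly_differentiable :: "(real^'n) measure \<Rightarrow> (real^'n \<Rightarrow> real) \<Rightarrow> bool" where
  "weakly_differentiable \<mu> f \<longleftrightarrow> (\<exists>g. weak_gradient_of \<mu> f g)"

definition wgrad :: "(real^'n) measure \<Rightarrow> (real^'n \<Rightarrow> real) \<Rightarrow> (real^'n \<Rightarrow> real^'n)" where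
  "wgrad \<mu> f = (SOME g. weak_gradient_of \<mu> f g)"

definition L2 :: "(real^'n) measure \<Rightarrow> (real^'n \<Rightarrow> real) set" where
  "L2 \<mu> = {f. f \<in> borel_measurable borel \<and> integrable \<mu> (\<lambda>x. (f x)\<^sup>2)}"

definition L2_inner :: "(real^'n) measure \<Rightarrow> (real^'n \<Rightarrow> real) \<Rightarrow> (real^'n \<Rightarrow> real) \<Rightarrow> real" where
  "L2_inner \<mu> f g = (\<integral>x. f x * g x \<partial>\<mu>)"

definition L2_norm :: "(real^'n) measure \<Rightarrow> (real^'n \<Rightarrow> real) \<Rightarrow> real" where
  "L2_norm \<mu> f = sqrt (\<integral>x. (f x)\<^sup>2 \<partial>\<mu>)"

definition null_fun :: "(real^'n) measure \<Rightarrow> (real^'n \<Rightarrow> real) \<Rightarrow> bool" where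
  "null_fun \<mu> f \<longleftrightarrow> (AE x in \<mu>. f x = 0)"

definition dirichlet :: "(real^'n) measure \<Rightarrow> (real^'n \<Rightarrow> real^'n^'n) \<Rightarrow>
    (real^'n \<Rightarrow> real) \<Rightarrow> (real^'n \<Rightarrow> real) \<Rightarrow> real" where
  "dirichlet \<mu> W f g = (\<integral>x. wgrad \<mu> f x \<bullet> (W x *v wgrad \<mu> g x) \<partial>\<mu>)"

definition H1 :: "(real^'n) measure \<Rightarrow> (real^'n \<Rightarrow> real^'n^'n) \<Rightarrow> (real^'n \<Rightarrow> real) set" where
  "H1 \<mu> W = {f \<in> L2 \<mu>. weakly_differentiable \<mu> f \<and>
     integrable \<mu> (\<lambda>x. wgrad \<mu> f x \<bullet> (W x *v wgrad \<mu> f x))}"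

definition H1_norm :: "(real^'n) measure \<Rightarrow> (real^'n \<Rightarrow> real^'n^'n) \<Rightarrow> (real^'n \<Rightarrow> real) \<Rightarrow> real" where
  "H1_norm \<mu> W f = sqrt ((\<integral>x. (f x)\<^sup>2 \<partial>\<mu>) + dirichlet \<mu> W f f)"

text \<open>\<open>H\<^sup>1(\<mu>, W)\<close> is a Hilbert space: its energy is well defined on classes modulo \<open>\<mu>\<close>-null sets
  (two weak gradients of the same class differ by a field of zero energy, which is automatic when
  \<open>\<mu>\<close> is absolutely continuous), and it is complete.\<close>

definition H1_hilbert :: "(real^'n) measure \<Rightarrow> (real^'n \<Rightarrow> real^'n^'n) \<Rightarrow> bool" where
  "H1_hilbert \<mu> W \<longleftrightarrow>
     (\<forall>f g h. weak_gradient_of \<mu> f g \<and> weak_gradient_of \<mu> f h \<longrightarrow>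
        (AE x in \<mu>. (g x - h x) \<bullet> (W x *v (g x - h x)) = 0)) \<and>
     (\<forall>F. (\<forall>n::nat. F n \<in> H1 \<mu> W) \<and>
        (\<forall>\<epsilon>>0. \<exists>N. \<forall>m\<ge>N. \<forall>n\<ge>N. H1_norm \<mu> W (\<lambda>x. F m x - F n x) < \<epsilon>) \<longrightarrow>
        (\<exists>f\<in>H1 \<mu> W. (\<lambda>n. H1_norm \<mu> W (\<lambda>x. F n x - f x)) \<longlonglongrightarrow> 0))"

definition H1_compact_in_L2 :: "(real^'n) measure \<Rightarrow> (real^'n \<Rightarrow> real^'n^'n) \<Rightarrow> bool" where
  "H1_compact_in_L2 \<mu> W \<longleftrightarrow>
     (\<forall>F B. (\<forall>n::nat. F n \<in> H1 \<mu> W \<and> H1_norm \<mu> W (F n) \<le> B) \<longrightarrow>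
        (\<exists>f\<in>L2 \<mu>. \<exists>r::nat \<Rightarrow> nat. strict_mono r \<and>
           (\<lambda>n. L2_norm \<mu> (\<lambda>x. F (r n) x - f x)) \<longlonglongrightarrow> 0))"

definition H1_dense_in_L2 :: "(real^'n) measure \<Rightarrow> (real^'n \<Rightarrow> real^'n^'n) \<Rightarrow> bool" where
  "H1_dense_in_L2 \<mu> W \<longleftrightarrow>
     (\<forall>f\<in>L2 \<mu>. \<forall>\<epsilon>>0. \<exists>h\<in>H1 \<mu> W. L2_norm \<mu> (\<lambda>x. f x - h x) < \<epsilon>)"

text \<open>The value is \<open>\<infinity>\<close> when no finite constant is admissible.\<close>

definition poincare_const :: "(real^'n) measure \<Rightarrow> (real^'n \<Rightarrow> real^'n^'n) \<Rightarrow> ennreal" where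
  "poincare_const \<mu> W = Inf {C. \<forall>f\<in>H1 \<mu> W.
     ennreal (prob_space.variance \<mu> f) \<le> C * ennreal (dirichlet \<mu> W f f)}"

text \<open>\<open>Lop \<mu> W g\<close> is the element \<open>f \<mapsto> \<integral> f \<L>g d\<mu>\<close> of the dual of \<open>H\<^sup>1(\<mu>, W)\<close>.\<close>

definition Lop :: "(real^'n) measure \<Rightarrow> (real^'n \<Rightarrow> real^'n^'n) \<Rightarrow>
    (real^'n \<Rightarrow> real) \<Rightarrow> (real^'n \<Rightarrow> real) \<Rightarrow> real" where
  "Lop \<mu> W g = (\<lambda>f. - dirichlet \<mu> W f g)"

definition eigenspace :: "(real^'n) measure \<Rightarrow> (real^'n \<Rightarrow> real^'n^'n) \<Rightarrow>
    real \<Rightarrow> (real^'n \<Rightarrow> real) set" where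
  "eigenspace \<mu> W l = {u \<in> H1 \<mu> W. \<forall>f\<in>H1 \<mu> W. - Lop \<mu> W u f = l * L2_inner \<mu> f u}"

definition span_ae :: "(real^'n) measure \<Rightarrow> (nat \<Rightarrow> real^'n \<Rightarrow> real) \<Rightarrow> nat set \<Rightarrow>
    (real^'n \<Rightarrow> real) set" where
  "span_ae \<mu> u I = {f \<in> borel_measurable borel. \<exists>c. AE x in \<mu>. f x = (\<Sum>i\<in>I. c i * u i x)}"

text \<open>Sequences of eigenfunctions and eigenvalues are indexed from 1.\<close>

definition orthonormal_basis :: "(real^'n) measure \<Rightarrow> (nat \<Rightarrow> real^'n \<Rightarrow> real) \<Rightarrow> bool" where
  "orthonormal_basis \<mu> u \<longleftrightarrow>
     (\<forall>i\<ge>1. u i \<in> L2 \<mu>) \<and>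
     (\<forall>i\<ge>1. \<forall>j\<ge>1. L2_inner \<mu> (u i) (u j) = (if i = j then 1 else 0)) \<and>
     (\<forall>f\<in>L2 \<mu>. (\<lambda>N. L2_norm \<mu> (\<lambda>x. f x - (\<Sum>i=1..N. L2_inner \<mu> f (u i) * u i x))) \<longlonglongrightarrow> 0)"

text \<open>The sequence \<open>lam\<close> lists all eigenvalues in nondecreasing order, and each number \<open>l\<close> occurs
  as often as the dimension of its eigenspace (\<open>u\<close> being orthonormal).\<close>

definition ordered_spectrum :: "(real^'n) measure \<Rightarrow> (real^'n \<Rightarrow> real^'n^'n) \<Rightarrow>
    (nat \<Rightarrow> real^'n \<Rightarrow> real) \<Rightarrow> (nat \<Rightarrow> real) \<Rightarrow> bool" where
  "ordered_spectrum \<mu> W u lam \<longleftrightarrow>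
     (\<forall>i\<ge>1. \<forall>j\<ge>i. lam i \<le> lam j) \<and>
     (\<forall>l. finite {i. 1 \<le> i \<and> lam i = l} \<and> eigenspace \<mu> W l = span_ae \<mu> u {i. 1 \<le> i \<and> lam i = l})"

definition rayleigh :: "(real^'n) measure \<Rightarrow> (real^'n \<Rightarrow> real^'n^'n) \<Rightarrow> (real^'n \<Rightarrow> real) \<Rightarrow> real" where
  "rayleigh \<mu> W f = dirichlet \<mu> W f f / (\<integral>x. (f x)\<^sup>2 \<partial>\<mu>)"

definition rayleigh_minimizers :: "(real^'n) measure \<Rightarrow> (real^'n \<Rightarrow> real^'n^'n) \<Rightarrow>
    (real^'n \<Rightarrow> real) set" where
  "rayleigh_minimizers \<mu> W =
     (let T = {f \<in> H1 \<mu> W. (\<integral>x. f x \<partial>\<mu>) = 0 \<and> \<not> null_fun \<mu> f}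
      in {f \<in> T. \<forall>h\<in>T. rayleigh \<mu> W f \<le> rayleigh \<mu> W h})"

definition admissible :: "(real^'n \<Rightarrow> real^'n^'n) \<Rightarrow> (real^'n \<Rightarrow> real^'n^'n) \<Rightarrow> bool" where
  "admissible W W' \<longleftrightarrow> psd_field W' \<and> (\<exists>\<Omega>::real. \<forall>x. loewner_le (W' x) (\<Omega> *\<^sub>R W x))"

definition pairing :: "(real^'n) measure \<Rightarrow> (real^'n \<Rightarrow> real^'n^'n) \<Rightarrow> (real^'n \<Rightarrow> real^'n^'n) \<Rightarrow> real" where
  "pairing \<mu> D G = (\<integral>x. trace (D x ** G x) \<partial>\<mu>)"

definition pairable :: "(real^'n) measure \<Rightarrow> (real^'n \<Rightarrow> real^'n^'n) \<Rightarrow> (real^'n \<Rightarrow> real^'n^'n) \<Rightarrow> bool" where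
  "pairable \<mu> D G \<longleftrightarrow> integrable \<mu> (\<lambda>x. trace (D x ** G x))"

text \<open>Only symmetric \<open>G\<close> are considered: \<open>\<langle>W, G\<rangle>\<close> is a scalar product on symmetric fields and does
  not see the antisymmetric part of \<open>G\<close>.\<close>

definition superdiff :: "(real^'n) measure \<Rightarrow> (real^'n \<Rightarrow> real^'n^'n) \<Rightarrow>
    (real^'n \<Rightarrow> real^'n^'n) set" where
  "superdiff \<mu> W = {G. sym_field G \<and>
     (\<forall>W'. admissible W W' \<longrightarrow> pairable \<mu> (\<lambda>x. W' x - W x) G \<and>
        enn2ereal (1 / poincare_const \<mu> W')
          \<le> enn2ereal (1 / poincare_const \<mu> W) + ereal (pairing \<mu> (\<lambda>x. W' x - W x) G))}"

text \<open>Differentiability of \<open>W \<mapsto> 1 / C(\<mu>, W)\<close> at \<open>W\<close> with gradient \<open>G\<close>: for every admissible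
  \<open>W'\<close>, the field \<open>W + t (W' - W)\<close> is positive semidefinite for small \<open>t\<close> of either sign, and the
  two-sided directional derivative is represented by \<open>G\<close>.\<close>

definition has_gradient :: "(real^'n) measure \<Rightarrow> (real^'n \<Rightarrow> real^'n^'n) \<Rightarrow>
    (real^'n \<Rightarrow> real^'n^'n) \<Rightarrow> bool" where
  "has_gradient \<mu> W G \<longleftrightarrow> sym_field G \<and>
     (\<forall>W'. admissible W W' \<longrightarrow> pairable \<mu> (\<lambda>x. W' x - W x) G \<and>
        ((\<lambda>t. enn2real (1 / poincare_const \<mu> (\<lambda>x. W x + t *\<^sub>R (W' x - W x))))
           has_real_derivative pairing \<mu> (\<lambda>x. W' x - W x) G) (at 0))"

definition normalized_grad_outer :: "(real^'n) measure \<Rightarrow> (real^'n \<Rightarrow> real) \<Rightarrow> (real^'n \<Rightarrow> real^'n^'n)" where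
  "normalized_grad_outer \<mu> u = (\<lambda>x. (1 / (\<integral>y. (u y)\<^sup>2 \<partial>\<mu>)) *\<^sub>R outer (wgrad \<mu> u x))"

definition field_conv :: "(real^'n \<Rightarrow> real^'n^'n) set \<Rightarrow> (real^'n \<Rightarrow> real^'n^'n) set" where
  "field_conv S = {G. \<exists>(N::nat) t A. (\<forall>k<N. 0 \<le> t k \<and> A k \<in> S) \<and> (\<Sum>k<N. t k) = 1 \<and>
     G = (\<lambda>x. \<Sum>k<N. t k *\<^sub>R A k x)}"

text \<open>\<open>norm\<close> on \<open>real^'n^'n\<close> is the Frobenius norm. The distance may be infinite, since the
  fields need not be square integrable.\<close>

definition L2_field_closure :: "(real^'n) measure \<Rightarrow> (real^'n \<Rightarrow> real^'n^'n) set \<Rightarrow>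
    (real^'n \<Rightarrow> real^'n^'n) set" where
  "L2_field_closure \<mu> S = {G. sym_field G \<and>
     (\<forall>\<epsilon>>0. \<exists>H\<in>S. (\<integral>\<^sup>+x. ennreal ((norm (G x - H x))\<^sup>2) \<partial>\<mu>) < ennreal (\<epsilon>\<^sup>2))}"

text \<open>Every admissible direction \<open>W' - W\<close> lives on the range of \<open>W\<close>, so the pairing determines a
  field \<open>G\<close> only through \<open>W G W\<close>. Where \<open>W\<close> is positive definite this is equality a.e.\<close>

definition agree_on_range :: "(real^'n) measure \<Rightarrow> (real^'n \<Rightarrow> real^'n^'n) \<Rightarrow>
    (real^'n \<Rightarrow> real^'n^'n) \<Rightarrow> (real^'n \<Rightarrow> real^'n^'n) \<Rightarrow> bool" where
  "agree_on_range \<mu> W G H \<longleftrightarrow> (AE x in \<mu>. W x ** G x ** W x = W x ** H x ** W x)"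

end

theory Submission
  imports Defs "HOL-Library.Function_Algebras"
begin

text \<open>The eigenfunctions are obtained by minimising the Rayleigh quotient successively on orthogonal
  complements; compactness gives \<open>L\<^sup>2\<close>-limits of minimising sequences, and the parallelogram
  identity turns them into limits in energy. The Poincare inequality excludes singular parts of
  \<open>\<mu>\<close>, so \<open>L\<^sup>2(\<mu>)\<close> is infinite-dimensional and the eigenvalues tend to infinity.

  For a field \<open>D\<close> dominated by \<open>W\<close>, the spectral gap above \<open>\<lambda>\<^sub>2\<close> yields
  \<open>\<lambda>\<^sub>2(W + t D) \<ge> \<lambda>\<^sub>2(W) + t min \<integral> tr (D H) + O(t\<^sup>2)\<close> for \<open>t \<ge> 0\<close>, where \<open>H\<close> ranges over the convex hull \<open>K\<close>
  of the normalised fields \<open>\<nabla>u \<nabla>u\<^sup>T\<close>. Since the eigenspace is finite-dimensional, \<open>K\<close> is compact, and a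
  supergradient \<open>G\<close> has a nearest point \<open>H\<close> in \<open>K\<close> for a weighted \<open>L\<^sup>2\<close>-distance between \<open>W G W\<close> and
  \<open>W H W\<close>. Testing \<open>G\<close> with \<open>D = - r W R W\<close>, where \<open>R\<close> is the weighted residual and \<open>r\<close> the weight, gives \<open>R = 0\<close>.\<close>

section \<open>Bilinear forms on subspaces\<close>

text \<open>Functions are not divided by null sets: \<open>L2\<close> and \<open>H1\<close> are
  subspaces of a pointwise function space with semidefinite forms, so abstract statements hold up to
  null vectors. Likewise \<open>wgrad\<close> is an arbitrary choice, visible only after
  \<open>W\<close>, or a symmetric field dominated by \<open>W\<close>, has been applied. This
  shapes the last claim. A direction \<open>W' - W\<close> factors as W X W, so a supergradient G is
  visible only through W G W, and it need not be square integrable; hence the weighted distance. If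
  R is the residual of the nearest point H, optimality says that H maximises the pairing with R over
  K. Thus the direction D built from -R has values at least -<R, H> on normalised eigenfunctions,
  and the perturbation estimate bounds the second eigenvalue from below with that slope, up to order
  t^2. The supergradient inequality bounds it from above with slope -<R, G>. Hence <R, G - H> is at
  most 0, but it is the squared norm of R. This is a separation argument in which the separating
  functional is itself an admissible perturbation.\<close>

instantiation "fun" :: (type, real_vector) real_vector
begin

definition scaleR_fun_def: "c *\<^sub>R f = (\<lambda>x. c *\<^sub>R f x)"

instance
  by standard (simp_all add: scaleR_fun_def fun_eq_iff scaleR_add_right scaleR_add_left)

end

lemma scaleR_fun_apply [simp]: "(c *\<^sub>R f) x = c *\<^sub>R f x"
  by (simp add: scaleR_fun_def)

lemma sum_fun_apply: "(\<Sum>i\<in>I. f i) x = (\<Sum>i\<in>I. f i x)"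
  by (induction I rule: infinite_finite_induct) auto

text \<open>The discriminant bound for a nonnegative quadratic. With \<open>c = 0\<close> the
  expression is affine in \<open>s\<close>, so its slope must vanish.\<close>

lemma quadratic_nonneg_imp:
  fixes a b c :: real
  assumes q: "\<And>s. 0 \<le> a + 2 * s * b + s\<^sup>2 * c" and c: "0 \<le> c"
  shows "b\<^sup>2 \<le> a * c"
proof (cases "c = 0")
  case True
  have "b = 0"
  proof (rule ccontr)
    assume "b \<noteq> 0"
    then have "a + 2 * (- (a + 1) / (2 * b)) * b = -1" by (simp add: field_simps)
    then show False using q[of "- (a + 1) / (2 * b)"] True by simp
  qed
  then show ?thesis using True by simp
next
  case False
  then have pos: "c > 0" using c by simp
  \<comment> \<open>The quadratic is tested at its minimiser \<open>- b / c\<close>.\<close>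
  then have "a + 2 * (- b / c) * b + (- b / c)\<^sup>2 * c = a - b\<^sup>2 / c"
    by (simp add: power2_eq_square)
  then have "b\<^sup>2 / c \<le> a" using q[of "- b / c"] by simp
  then show ?thesis using pos by (simp add: pos_divide_le_eq)
qed

text \<open>The laws are assumed only on a carrier \<open>S\<close>, because integral forms are
  additive only where the integrals converge. The carrier is a set, so that a form can be restricted
  to smaller subspaces, as in \<open>euler_lagrange\<close>.\<close>

locale sym_form =
  fixes S :: "'v::real_vector set" and b :: "'v \<Rightarrow> 'v \<Rightarrow> real"
  assumes subsp: "subspace S"
    and sym: "f \<in> S \<Longrightarrow> g \<in> S \<Longrightarrow> b f g = b g f"
    and add_left: "f \<in> S \<Longrightarrow> g \<in> S \<Longrightarrow> h \<in> S \<Longrightarrow> b (f + g) h = b f h + b g h"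
    and scale_left: "f \<in> S \<Longrightarrow> h \<in> S \<Longrightarrow> b (c *\<^sub>R f) h = c * b f h"
begin

lemma mem:
  "0 \<in> S" "f \<in> S \<Longrightarrow> g \<in> S \<Longrightarrow> f + g \<in> S" "f \<in> S \<Longrightarrow> g \<in> S \<Longrightarrow> f - g \<in> S"
  "f \<in> S \<Longrightarrow> c *\<^sub>R f \<in> S" "(\<And>i. i \<in> I \<Longrightarrow> F i \<in> S) \<Longrightarrow> (\<Sum>i\<in>I. F i) \<in> S"
  using subsp by (auto intro: subspace_0 subspace_add subspace_diff subspace_scale subspace_sum)

lemma add_right: "f \<in> S \<Longrightarrow> g \<in> S \<Longrightarrow> h \<in> S \<Longrightarrow> b h (f + g) = b h f + b h g"
  using add_left[of f g h] sym[of "f + g" h] sym[of f h] sym[of g h] mem(2)[of f g] by simp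

lemma scale_right: "f \<in> S \<Longrightarrow> h \<in> S \<Longrightarrow> b h (c *\<^sub>R f) = c * b h f"
  using scale_left[of f h c] sym[of "c *\<^sub>R f" h] sym[of f h] mem(4)[of f c] by simp

lemma zero_left: "h \<in> S \<Longrightarrow> b 0 h = 0"
  using scale_left[of 0 h 0] mem(1) by simp

lemma diff_left: "f \<in> S \<Longrightarrow> g \<in> S \<Longrightarrow> h \<in> S \<Longrightarrow> b (f - g) h = b f h - b g h"
  using add_left[of f "(-1) *\<^sub>R g" h] scale_left[of g h "-1"] mem(4)[of g "-1"] by simp

lemma diff_right: "f \<in> S \<Longrightarrow> g \<in> S \<Longrightarrow> h \<in> S \<Longrightarrow> b h (f - g) = b h f - b h g"
  using diff_left[of f g h] sym[of "f - g" h] sym[of f h] sym[of g h] mem(3)[of f g] by simp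

lemma sum_left:
  assumes "\<And>i. i \<in> I \<Longrightarrow> F i \<in> S" "h \<in> S"
  shows "b (\<Sum>i\<in>I. F i) h = (\<Sum>i\<in>I. b (F i) h)"
  using assms
  by (induction I rule: infinite_finite_induct) (auto simp: zero_left add_left mem)

lemma sum_right:
  assumes "\<And>i. i \<in> I \<Longrightarrow> F i \<in> S" "h \<in> S"
  shows "b h (\<Sum>i\<in>I. F i) = (\<Sum>i\<in>I. b h (F i))"
proof -
  have "b h (\<Sum>i\<in>I. F i) = (\<Sum>i\<in>I. b (F i) h)"
    using sum_left[of I F h] sym[of "sum F I" h] mem(5)[of I F] assms by simp
  also have "\<dots> = (\<Sum>i\<in>I. b h (F i))"
    using sym assms by (intro sum.cong) auto
  finally show ?thesis .
qed

lemmas bilinear = add_left add_right diff_left diff_right scale_left scale_right mem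

lemma quad_add: "f \<in> S \<Longrightarrow> g \<in> S \<Longrightarrow> b (f + g) (f + g) = b f f + 2 * b f g + b g g"
  using sym[of f g] by (simp add: bilinear)

lemma quad_diff: "f \<in> S \<Longrightarrow> g \<in> S \<Longrightarrow> b (f - g) (f - g) = b f f - 2 * b f g + b g g"
  using sym[of f g] by (simp add: bilinear)

lemma quad_sum:
  assumes "\<And>i. i \<in> I \<Longrightarrow> u i \<in> S"
  shows "b (\<Sum>i\<in>I. c i *\<^sub>R u i) (\<Sum>i\<in>I. c i *\<^sub>R u i) = (\<Sum>i\<in>I. \<Sum>j\<in>I. c i * c j * b (u i) (u j))"
proof -
  have cu: "c i *\<^sub>R u i \<in> S" if "i \<in> I" for i using assms that by (simp add: mem(4))
  have "b (\<Sum>i\<in>I. c i *\<^sub>R u i) (\<Sum>i\<in>I. c i *\<^sub>R u i)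
      = (\<Sum>i\<in>I. b (c i *\<^sub>R u i) (\<Sum>j\<in>I. c j *\<^sub>R u j))"
    by (intro sum_left mem(5) cu)
  also have "\<dots> = (\<Sum>i\<in>I. \<Sum>j\<in>I. b (c i *\<^sub>R u i) (c j *\<^sub>R u j))"
    by (intro sum.cong[OF refl] sum_right cu)
  also have "\<dots> = (\<Sum>i\<in>I. \<Sum>j\<in>I. c i * c j * b (u i) (u j))"
    using assms by (intro sum.cong refl) (simp add: scale_left scale_right mem(4))
  finally show ?thesis .
qed

end

locale psd_form = sym_form S b for S :: "'v::real_vector set" and b +
  assumes nonneg: "f \<in> S \<Longrightarrow> 0 \<le> b f f"
begin

lemma cauchy_schwarz:
  assumes f: "f \<in> S" and g: "g \<in> S"
  shows "(b f g)\<^sup>2 \<le> b f f * b g g"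
proof -
  have "0 \<le> b f f + 2 * s * b f g + s\<^sup>2 * b g g" for s
    using nonneg[of "f + s *\<^sub>R g"] f g sym[of f g]
    by (simp add: quad_add scale_left scale_right mem power2_eq_square)
  then show ?thesis using nonneg[OF g] by (rule quadratic_nonneg_imp)
qed

lemma null_left: "f \<in> S \<Longrightarrow> g \<in> S \<Longrightarrow> b f f = 0 \<Longrightarrow> b f g = 0"
  using cauchy_schwarz[of f g] by simp

lemma null_right: "f \<in> S \<Longrightarrow> g \<in> S \<Longrightarrow> b f f = 0 \<Longrightarrow> b g f = 0"
  using null_left sym by metis

text \<open>Cauchy-Schwarz turns convergence in the seminorm into convergence of pairings; limits of
  orthogonal vectors stay orthogonal in this way.\<close>

lemma tendsto_left:
  assumes F: "\<And>n::nat. F n \<in> S" and f: "f \<in> S" and h: "h \<in> S"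
    and lim: "(\<lambda>n. b (F n - f) (F n - f)) \<longlonglongrightarrow> 0"
  shows "(\<lambda>n. b (F n) h) \<longlonglongrightarrow> b f h"
proof -
  have "(\<lambda>n. sqrt (b (F n - f) (F n - f) * b h h)) \<longlonglongrightarrow> sqrt (0 * b h h)"
    by (intro tendsto_intros lim)
  then have l: "(\<lambda>n. sqrt (b (F n - f) (F n - f) * b h h)) \<longlonglongrightarrow> 0" by simp
  have "norm (b (F n - f) h) \<le> sqrt (b (F n - f) (F n - f) * b h h)" for n
    using cauchy_schwarz[of "F n - f" h] F[of n] f h by (auto intro!: real_le_rsqrt simp: mem)
  then have "(\<lambda>n. b (F n - f) h) \<longlonglongrightarrow> 0"
    by (intro Lim_null_comparison[OF _ l] always_eventually) blast
  then have "(\<lambda>n. b (F n - f) h + b f h) \<longlonglongrightarrow> 0 + b f h" by (intro tendsto_intros)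
  then show ?thesis using F f h by (simp add: bilinear)
qed

lemma tendsto_quad:
  assumes F: "\<And>n::nat. F n \<in> S" and f: "f \<in> S"
    and lim: "(\<lambda>n. b (F n - f) (F n - f)) \<longlonglongrightarrow> 0"
  shows "(\<lambda>n. b (F n) (F n)) \<longlonglongrightarrow> b f f"
proof -
  have "(\<lambda>n. b (F n - f) (F n - f) + 2 * b (F n) f - b f f) \<longlonglongrightarrow> 0 + 2 * b f f - b f f"
    by (intro tendsto_intros lim tendsto_left F f)
  moreover have "b (F n - f) (F n - f) + 2 * b (F n) f - b f f = b (F n) (F n)" for n
    using F[of n] f by (simp add: quad_diff)
  ultimately show ?thesis by simp
qed

section \<open>Orthonormal families, projections and Bessel's inequality\<close>

definition orthonormal :: "'i set \<Rightarrow> ('i \<Rightarrow> 'v) \<Rightarrow> bool" where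
  "orthonormal I u \<longleftrightarrow> (\<forall>i\<in>I. u i \<in> S) \<and> (\<forall>i\<in>I. \<forall>j\<in>I. b (u i) (u j) = (if i = j then 1 else 0))"

definition proj :: "'i set \<Rightarrow> ('i \<Rightarrow> 'v) \<Rightarrow> 'v \<Rightarrow> 'v" where
  "proj I u f = (\<Sum>i\<in>I. b f (u i) *\<^sub>R u i)"

lemma orthonormal_subset: "orthonormal I u \<Longrightarrow> J \<subseteq> I \<Longrightarrow> orthonormal J u"
  unfolding orthonormal_def by blast

context
  fixes I :: "'i set" and u
  assumes fin: "finite I" and on: "orthonormal I u"
begin

lemma comb_mem: "(\<Sum>i\<in>I. c i *\<^sub>R u i) \<in> S"
  using on unfolding orthonormal_def by (intro mem(4,5)) simp

lemma proj_mem: "proj I u f \<in> S"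
  unfolding proj_def by (rule comb_mem)

lemma comb_right: "f \<in> S \<Longrightarrow> b f (\<Sum>i\<in>I. c i *\<^sub>R u i) = (\<Sum>i\<in>I. c i * b f (u i))"
  using on sum_right[of I "\<lambda>i. c i *\<^sub>R u i" f] unfolding orthonormal_def
  by (simp add: scale_right mem(4))

lemma comb_basis:
  assumes "j \<in> I"
  shows "b (\<Sum>i\<in>I. c i *\<^sub>R u i) (u j) = c j"
proof -
  have "b (\<Sum>i\<in>I. c i *\<^sub>R u i) (u j) = (\<Sum>i\<in>I. c i * b (u i) (u j))"
    using on assms sum_left[of I "\<lambda>i. c i *\<^sub>R u i" "u j"] unfolding orthonormal_def
    by (simp add: scale_left mem(4))
  also have "\<dots> = (\<Sum>i\<in>I. if i = j then c i else 0)"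
    using on assms unfolding orthonormal_def by (intro sum.cong refl) simp
  also have "\<dots> = c j" using assms fin by simp
  finally show ?thesis .
qed

lemma comb_quad: "b (\<Sum>i\<in>I. c i *\<^sub>R u i) (\<Sum>i\<in>I. c i *\<^sub>R u i) = (\<Sum>i\<in>I. (c i)\<^sup>2)"
  using comb_right[OF comb_mem, of c c] by (simp add: comb_basis power2_eq_square)

lemma proj_basis: "j \<in> I \<Longrightarrow> b (proj I u f) (u j) = b f (u j)"
  unfolding proj_def by (rule comb_basis)

lemma residual_basis: "f \<in> S \<Longrightarrow> j \<in> I \<Longrightarrow> b (f - proj I u f) (u j) = 0"
  using on diff_left[OF _ proj_mem, of f "u j" f] proj_basis[of j f] unfolding orthonormal_def by auto

lemma residual_comb: "f \<in> S \<Longrightarrow> b (f - proj I u f) (\<Sum>i\<in>I. c i *\<^sub>R u i) = 0"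
  using comb_right[OF mem(3)[OF _ proj_mem], of f f c] by (simp add: residual_basis)

lemma residual_quad: "f \<in> S \<Longrightarrow> b (f - proj I u f) (f - proj I u f) = b f f - (\<Sum>i\<in>I. (b f (u i))\<^sup>2)"
proof -
  assume f: "f \<in> S"
  have 1: "b f (proj I u f) = (\<Sum>i\<in>I. (b f (u i))\<^sup>2)"
    unfolding proj_def by (simp add: comb_right f power2_eq_square)
  have 2: "b (proj I u f) (proj I u f) = (\<Sum>i\<in>I. (b f (u i))\<^sup>2)"
    unfolding proj_def by (rule comb_quad)
  show ?thesis using quad_diff[OF f proj_mem, of f] 1 2 by linarith
qed

lemma bessel: "f \<in> S \<Longrightarrow> (\<Sum>i\<in>I. (b f (u i))\<^sup>2) \<le> b f f"
  using residual_quad[of f] nonneg[OF mem(3)[OF _ proj_mem], of f f] by linarith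

text \<open>Pythagoras: the difference of two combinations of the \<open>u i\<close> is orthogonal
  to the residual of the projection, so replacing the projection can only add a nonnegative
  term.\<close>

lemma best_approximation:
  assumes f: "f \<in> S"
  shows "b (f - proj I u f) (f - proj I u f)
    \<le> b (f - (\<Sum>i\<in>I. c i *\<^sub>R u i)) (f - (\<Sum>i\<in>I. c i *\<^sub>R u i))"
proof -
  define d where "d = (\<Sum>i\<in>I. (b f (u i) - c i) *\<^sub>R u i)"
  have d: "d \<in> S" unfolding d_def by (rule comb_mem)
  have eq: "f - (\<Sum>i\<in>I. c i *\<^sub>R u i) = (f - proj I u f) + d"
    unfolding d_def proj_def by (simp add: scaleR_diff_left sum_subtractf)
  have "b (f - proj I u f) d = 0" unfolding d_def by (rule residual_comb[OF f])
  then show ?thesis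
    unfolding eq using quad_add[OF mem(3)[OF f proj_mem] d, of f] nonneg[OF d] by linarith
qed

end

end

section \<open>Eigenvectors of a compactly embedded form\<close>

context sym_form
begin

lemma quad_scale: "f \<in> S \<Longrightarrow> b (c *\<^sub>R f) (c *\<^sub>R f) = c\<^sup>2 * b f f"
  using scale_left[of f "c *\<^sub>R f" c] scale_right[of f f c] mem(4)[of f c]
  by (simp add: power2_eq_square)

end

context psd_form
begin

lemma quad_normalize: "f \<in> S \<Longrightarrow> b f f > 0 \<Longrightarrow> b ((1 / sqrt (b f f)) *\<^sub>R f) ((1 / sqrt (b f f)) *\<^sub>R f) = 1"
  by (simp add: quad_scale power_divide)

end

text \<open>An abstract model of the pair \<open>L2\<close>, \<open>H1\<close>. The compactness
  axiom only asks for a Cauchy subsequence, since the limit is produced by completeness of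
  \<open>H\<close> in the full norm. \<open>null_energy\<close> makes the energy well defined up to
  null vectors, and \<open>infinite_dim\<close> prevents the successive minimisation from
  stopping.\<close>

locale form_space = ip: psd_form L ip + en: psd_form H E
  for L H :: "'v::real_vector set" and ip E +
  fixes one :: 'v
  assumes HL: "H \<subseteq> L"
    and null_energy: "f \<in> H \<Longrightarrow> ip f f = 0 \<Longrightarrow> E f f = 0"
    and compact: "(\<And>n. F n \<in> H) \<Longrightarrow> (\<And>n::nat. ip (F n) (F n) + E (F n) (F n) \<le> B) \<Longrightarrow>
      \<exists>r::nat \<Rightarrow> nat. strict_mono r \<and>
        (\<forall>e>0. \<exists>N. \<forall>m\<ge>N. \<forall>n\<ge>N. ip (F (r m) - F (r n)) (F (r m) - F (r n)) < e)"
    and complete: "(\<And>n::nat. F n \<in> H) \<Longrightarrow>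
      (\<And>e. e > 0 \<Longrightarrow> \<exists>N. \<forall>m\<ge>N. \<forall>n\<ge>N. ip (F m - F n) (F m - F n) + E (F m - F n) (F m - F n) < e) \<Longrightarrow>
      \<exists>f\<in>H. (\<lambda>n. ip (F n - f) (F n - f) + E (F n - f) (F n - f)) \<longlonglongrightarrow> 0"
    and dense: "f \<in> L \<Longrightarrow> e > 0 \<Longrightarrow> \<exists>h\<in>H. ip (f - h) (f - h) < e"
    and infinite_dim: "\<exists>e::nat \<Rightarrow> 'v. ip.orthonormal UNIV e"
    and one_H: "one \<in> H"
    and one_norm: "ip one one = 1"
    and one_energy: "E one one = 0"
begin

lemma HL': "f \<in> H \<Longrightarrow> f \<in> L"
  using HL by blast

definition perp :: "'v set \<Rightarrow> 'v set" where
  "perp B = {f \<in> H. \<forall>v\<in>B. ip f v = 0}"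

lemma perp_subspace: "B \<subseteq> L \<Longrightarrow> subspace (perp B)"
  unfolding subspace_def perp_def
  by (auto simp: en.mem ip.zero_left ip.add_left ip.scale_left HL' subset_iff)

text \<open>The form \<open>E - l * ip\<close> is positive semidefinite on \<open>T\<close> and
  \<open>u\<close> is a null vector of it, so Cauchy-Schwarz makes \<open>u\<close> orthogonal to
  all of \<open>T\<close> in this form. No derivative of the quotient is taken.\<close>

lemma euler_lagrange:
  assumes T: "subspace T" "T \<subseteq> H" and min: "\<And>f. f \<in> T \<Longrightarrow> l * ip f f \<le> E f f"
    and u: "u \<in> T" "E u u = l * ip u u" and g: "g \<in> T"
  shows "E u g = l * ip u g"
proof -
  have H: "f \<in> H" "f \<in> L" if "f \<in> T" for f using that T(2) HL by auto
  interpret q: psd_form T "\<lambda>f g. E f g - l * ip f g"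
  proof
    show "subspace T" by fact
    show "E f g - l * ip f g = E g f - l * ip g f" if "f \<in> T" "g \<in> T" for f g
      using that H en.sym[of f g] ip.sym[of f g] by simp
    show "E (f + g) h - l * ip (f + g) h = (E f h - l * ip f h) + (E g h - l * ip g h)"
      if "f \<in> T" "g \<in> T" "h \<in> T" for f g h
      using that H by (simp add: en.add_left ip.add_left algebra_simps)
    show "E (c *\<^sub>R f) h - l * ip (c *\<^sub>R f) h = c * (E f h - l * ip f h)"
      if "f \<in> T" "h \<in> T" for f h c
      using that H by (simp add: en.scale_left ip.scale_left algebra_simps)
    show "0 \<le> E f f - l * ip f f" if "f \<in> T" for f
      using min[OF that] by simp
  qed
  show ?thesis using q.null_left[of u g] u g by simp
qed

text \<open>Along a minimising sequence, \<open>L\<^sup>2\<close>-convergence upgrades to convergence in energy by the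
  parallelogram identity, because the midpoints cannot beat the infimum.\<close>

lemma rayleigh_minimizer_exists:
  assumes B: "B \<subseteq> L" and f0: "f0 \<in> perp B" "ip f0 f0 > 0"
  obtains u where "u \<in> perp B" "ip u u = 1" "\<And>f. f \<in> perp B \<Longrightarrow> E u u * ip f f \<le> E f f"
proof -
  have sub: "subspace (perp B)" by (rule perp_subspace[OF B])
  have PH: "f \<in> H" "f \<in> L" if "f \<in> perp B" for f
    using that HL unfolding perp_def by auto
  define X where "X = {E f f | f. f \<in> perp B \<and> ip f f = 1}"
  define l where "l = Inf X"
  have bdd: "bdd_below X" unfolding X_def by (rule bdd_belowI[of _ 0]) (auto simp: PH en.nonneg)
  have normed: "E f f / ip f f \<in> X" if f: "f \<in> perp B" "ip f f > 0" for f
  proof -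
    let ?g = "(1 / sqrt (ip f f)) *\<^sub>R f"
    have "?g \<in> perp B" using sub f(1) by (rule subspace_scale)
    moreover have "ip ?g ?g = 1" using f PH by (intro ip.quad_normalize) auto
    moreover have "E ?g ?g = E f f / ip f f"
      using f PH by (simp add: en.quad_scale power_divide)
    ultimately show ?thesis unfolding X_def by (intro CollectI exI[of _ ?g]) simp
  qed
  have ne: "X \<noteq> {}" using normed[OF f0] by auto
  have l0: "l \<ge> 0" unfolding l_def
    by (rule cInf_greatest[OF ne]) (auto simp: X_def PH en.nonneg)
  have low: "l * ip f f \<le> E f f" if f: "f \<in> perp B" for f
  proof (cases "ip f f > 0")
    case True
    then have "l \<le> E f f / ip f f" unfolding l_def by (intro cInf_lower normed f bdd)
    then show ?thesis using True by (simp add: pos_le_divide_eq)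
  next
    case False
    then have "ip f f = 0" using ip.nonneg[of f] PH f by force
    then show ?thesis using en.nonneg[of f] PH f by simp
  qed
  have "\<exists>f. f \<in> perp B \<and> ip f f = 1 \<and> E f f < l + 1 / (real n + 1)" for n :: nat
  proof -
    have "Inf X < l + 1 / (real n + 1)" unfolding l_def by simp
    then obtain x where "x \<in> X" "x < l + 1 / (real n + 1)" using cInf_lessD[OF ne] by blast
    then show ?thesis unfolding X_def by blast
  qed
  then obtain F where F: "\<And>n. F n \<in> perp B" "\<And>n. ip (F n) (F n) = 1"
    "\<And>n::nat. E (F n) (F n) < l + 1 / (real n + 1)" by metis
  have "ip (F n) (F n) + E (F n) (F n) \<le> l + 2" for n
  proof -
    have "1 / (real n + 1) \<le> 1" by simp
    then show ?thesis using F(2,3)[of n] by linarith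
  qed
  then obtain r :: "nat \<Rightarrow> nat" where r: "strict_mono r"
    and cau: "\<And>e. e > 0 \<Longrightarrow> \<exists>N. \<forall>m\<ge>N. \<forall>n\<ge>N. ip (F (r m) - F (r n)) (F (r m) - F (r n)) < e"
    using compact[of F "l + 2"] PH F(1) by blast
  define G where "G n = F (r n)" for n
  have G: "G n \<in> perp B" "ip (G n) (G n) = 1" for n
    unfolding G_def using F by auto
  have GE: "E (G n) (G n) \<le> l + 1 / (real n + 1)" for n
  proof -
    have "1 / (real (r n) + 1) \<le> 1 / (real n + 1)"
      using seq_suble[OF r, of n] by (intro divide_left_mono) auto
    then show ?thesis unfolding G_def using F(3)[of "r n"] by linarith
  qed
  have GH: "G n \<in> H" "G n \<in> L" for n using G PH by auto
  have para: "E (G m - G n) (G m - G n)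
      \<le> 2 / (real m + 1) + 2 / (real n + 1) + l * ip (G m - G n) (G m - G n)" for m n
  proof -
    have "l * ip (G m + G n) (G m + G n) \<le> E (G m + G n) (G m + G n)"
      by (intro low subspace_add sub G)
    moreover have "ip (G m + G n) (G m + G n) = 4 - ip (G m - G n) (G m - G n)"
      by (simp add: ip.quad_add ip.quad_diff GH G)
    moreover have "E (G m + G n) (G m + G n) = 2 * E (G m) (G m) + 2 * E (G n) (G n) - E (G m - G n) (G m - G n)"
      by (simp add: en.quad_add en.quad_diff GH)
    ultimately show ?thesis using GE[of m] GE[of n] by (simp add: algebra_simps)
  qed
  have "\<exists>N. \<forall>m\<ge>N. \<forall>n\<ge>N. ip (G m - G n) (G m - G n) + E (G m - G n) (G m - G n) < e" if e: "e > 0" for e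
  proof -
    \<comment> \<open>The threshold turns \<open>1 + l\<close> times the squared distance into at
      most e / 2; each of the two tails \<open>2 / (real m + 1)\<close> adds less than e /
      4.\<close>
    obtain N1 where N1: "\<And>m n. m \<ge> N1 \<Longrightarrow> n \<ge> N1 \<Longrightarrow> ip (G m - G n) (G m - G n) < e / (2 * (1 + l))"
      using cau[of "e / (2 * (1 + l))"] e l0 unfolding G_def by auto
    obtain N2 :: nat where N2: "8 / e < real N2" using reals_Archimedean2 by blast
    have small: "2 / (real m + 1) < e / 4" if "m \<ge> N2" for m
    proof -
      have "8 / e < real m + 1" using N2 that by linarith
      then show ?thesis using e by (simp add: field_simps)
    qed
    have "ip (G m - G n) (G m - G n) + E (G m - G n) (G m - G n) < e"
      if mn: "m \<ge> max N1 N2" "n \<ge> max N1 N2" for m n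
    proof -
      have "(1 + l) * ip (G m - G n) (G m - G n) \<le> (1 + l) * (e / (2 * (1 + l)))"
        using N1[of m n] mn l0 by (intro mult_left_mono) auto
      also have "\<dots> = e / 2" using l0 by (simp add: field_simps)
      finally have "(1 + l) * ip (G m - G n) (G m - G n) \<le> e / 2" .
      then show ?thesis using para[of m n] small[of m] small[of n] mn by (simp add: algebra_simps)
    qed
    then show ?thesis by blast
  qed
  then obtain f where f: "f \<in> H" and lim: "(\<lambda>n. ip (G n - f) (G n - f) + E (G n - f) (G n - f)) \<longlonglongrightarrow> 0"
    using complete[of G] GH by blast
  have fL: "f \<in> L" using f HL by blast
  have nn: "0 \<le> ip (G n - f) (G n - f)" "0 \<le> E (G n - f) (G n - f)" for n
    using ip.nonneg[of "G n - f"] en.nonneg[of "G n - f"] GH f fL by (auto simp: ip.mem en.mem)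
  have lim1: "(\<lambda>n. ip (G n - f) (G n - f)) \<longlonglongrightarrow> 0"
    by (rule tendsto_sandwich[OF _ _ tendsto_const lim]) (auto simp: nn)
  have lim2: "(\<lambda>n. E (G n - f) (G n - f)) \<longlonglongrightarrow> 0"
    by (rule tendsto_sandwich[OF _ _ tendsto_const lim]) (auto simp: nn)
  have perp: "f \<in> perp B"
  proof -
    have "ip f v = 0" if v: "v \<in> B" for v
    proof -
      have "(\<lambda>n. ip (G n) v) \<longlonglongrightarrow> ip f v" using v B GH fL lim1 by (intro ip.tendsto_left) auto
      moreover have "(\<lambda>n. ip (G n) v) = (\<lambda>n. 0)" using G v unfolding perp_def by auto
      ultimately show ?thesis by (simp add: LIMSEQ_const_iff)
    qed
    then show ?thesis unfolding perp_def using f by auto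
  qed
  have "(\<lambda>n. ip (G n) (G n)) \<longlonglongrightarrow> ip f f" using GH fL lim1 by (intro ip.tendsto_quad) auto
  then have one: "ip f f = 1" using G by (simp add: LIMSEQ_const_iff)
  have "(\<lambda>n. E (G n) (G n)) \<longlonglongrightarrow> E f f" using GH f lim2 by (intro en.tendsto_quad) auto
  moreover have "(\<lambda>n. l + 1 / (real n + 1)) \<longlonglongrightarrow> l"
    using LIMSEQ_inverse_real_of_nat_add[of l] by (simp add: inverse_eq_divide add.commute)
  ultimately have "E f f \<le> l" using GE by (intro LIMSEQ_le) auto
  then have "E f f = l" using low[OF perp] one by simp
  then show ?thesis using that[OF perp one] low by simp
qed

text \<open>If every vector orthogonal to \<open>B\<close> were null, \<open>H\<close> would lie in
  the span of \<open>B\<close> up to null vectors, and density would give Parseval's identity on all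
  of \<open>L\<close>. Summing it over \<open>card B + 1\<close> members of an infinite orthonormal
  family and applying Bessel with the roles exchanged bounds \<open>card B + 1\<close> by
  \<open>card B\<close>.\<close>

lemma perp_nontrivial:
  assumes fin: "finite B" and BH: "B \<subseteq> H" and on: "ip.orthonormal B id"
  shows "\<exists>f\<in>perp B. ip f f > 0"
proof (rule ccontr)
  assume "\<not> ?thesis"
  then have triv: "ip f f = 0" if "f \<in> perp B" for f
    using ip.nonneg[of f] that HL unfolding perp_def by force
  let ?P = "ip.proj B id"
  have PH: "?P f \<in> H" for f
    unfolding ip.proj_def using BH by (intro en.mem(4,5)) auto
  have h0: "ip (h - ?P h) (h - ?P h) = 0" if h: "h \<in> H" for h
  proof (rule triv)
    have "ip (h - ?P h) v = 0" if "v \<in> B" for v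
      using ip.residual_basis[OF fin on, of h v] that h HL by auto
    then show "h - ?P h \<in> perp B" unfolding perp_def using h PH en.mem(3) by auto
  qed
  have full: "ip f f = (\<Sum>v\<in>B. (ip f v)\<^sup>2)" if f: "f \<in> L" for f
  proof -
    have "ip (f - ?P f) (f - ?P f) \<le> e" if e: "e > 0" for e
    proof -
      obtain h where h: "h \<in> H" "ip (f - h) (f - h) < e" using dense[OF f e] by blast
      have m: "f - h \<in> L" "h - ?P h \<in> L"
        using f h HL PH by (auto intro!: ip.mem(3))
      \<comment> \<open>Since \<open>h - ?P h\<close> is null, \<open>?P h\<close> is as close to
        \<open>f\<close> as \<open>h\<close> is.\<close>
      have eq: "f - ?P h = (f - h) + (h - ?P h)" by simp
      have "ip (f - ?P f) (f - ?P f) \<le> ip (f - ?P h) (f - ?P h)"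
        using ip.best_approximation[OF fin on f, of "\<lambda>v. ip h v"] unfolding ip.proj_def by simp
      also have "\<dots> = ip (f - h) (f - h)"
        unfolding eq using m h0[OF h(1)] ip.null_right[of "h - ?P h" "f - h"] by (simp only: ip.quad_add)
      finally show ?thesis using h by simp
    qed
    then have "ip (f - ?P f) (f - ?P f) \<le> 0" using field_le_epsilon[of "ip (f - ?P f) (f - ?P f)" 0] by simp
    moreover have "0 \<le> ip (f - ?P f) (f - ?P f)"
      using f PH HL by (intro ip.nonneg ip.mem(3)) auto
    ultimately show ?thesis using ip.residual_quad[OF fin on f] by simp
  qed
  obtain e :: "nat \<Rightarrow> 'v" where e: "ip.orthonormal UNIV e" using infinite_dim by blast
  then have e': "ip.orthonormal {..card B} e" by (rule ip.orthonormal_subset) simp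
  have eL: "e i \<in> L" "ip (e i) (e i) = 1" for i using e unfolding ip.orthonormal_def by auto
  have "real (card B + 1) = (\<Sum>i\<le>card B. ip (e i) (e i))" by (simp add: eL)
  also have "\<dots> = (\<Sum>i\<le>card B. \<Sum>v\<in>B. (ip (e i) v)\<^sup>2)" using full eL by simp
  also have "\<dots> = (\<Sum>v\<in>B. \<Sum>i\<le>card B. (ip (e i) v)\<^sup>2)" by (rule sum.swap)
  also have "\<dots> = (\<Sum>v\<in>B. \<Sum>i\<le>card B. (ip v (e i))\<^sup>2)"
    using eL BH HL by (intro sum.cong refl) (metis ip.sym subsetD)
  also have "\<dots> \<le> (\<Sum>v\<in>B. ip v v)"
    using BH HL by (intro sum_mono ip.bessel e') auto
  also have "\<dots> = (\<Sum>v\<in>B. 1)" using on unfolding ip.orthonormal_def by (intro sum.cong) auto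
  finally show False by simp
qed

end

section \<open>Successive choice of eigenvectors\<close>

context form_space
begin

definition next_vector :: "'v set \<Rightarrow> 'v" where
  "next_vector B = (SOME u. u \<in> perp B \<and> ip u u = 1 \<and> (\<forall>f\<in>perp B. E u u * ip f f \<le> E f f))"

primrec chosen :: "nat \<Rightarrow> 'v set" where
  "chosen 0 = {one}"
| "chosen (Suc n) = insert (next_vector (chosen n)) (chosen n)"

text \<open>Numbering starts at 1, so the index is shifted by a truncated subtraction; the value at
  0 merely repeats \<open>one\<close>, and all statements start at 1.\<close>

definition eigvec :: "nat \<Rightarrow> 'v" where
  "eigvec i = (case i - 1 of 0 \<Rightarrow> one | Suc k \<Rightarrow> next_vector (chosen k))"

lemma next_vector:
  assumes "finite B" "B \<subseteq> H" "ip.orthonormal B id"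
  shows "next_vector B \<in> perp B" "ip (next_vector B) (next_vector B) = 1"
    "f \<in> perp B \<Longrightarrow> E (next_vector B) (next_vector B) * ip f f \<le> E f f"
proof -
  obtain f0 where f0: "f0 \<in> perp B" "ip f0 f0 > 0" using perp_nontrivial[OF assms] by auto
  have "B \<subseteq> L" using assms(2) HL by auto
  then obtain u where "u \<in> perp B" "ip u u = 1" "\<And>f. f \<in> perp B \<Longrightarrow> E u u * ip f f \<le> E f f"
    using rayleigh_minimizer_exists[OF _ f0] by blast
  then have "\<exists>u. u \<in> perp B \<and> ip u u = 1 \<and> (\<forall>f\<in>perp B. E u u * ip f f \<le> E f f)" by auto
  from someI_ex[OF this, folded next_vector_def]
  show "next_vector B \<in> perp B" "ip (next_vector B) (next_vector B) = 1"
    "f \<in> perp B \<Longrightarrow> E (next_vector B) (next_vector B) * ip f f \<le> E f f" by auto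
qed

lemma chosen_orthonormal: "finite (chosen n) \<and> chosen n \<subseteq> H \<and> ip.orthonormal (chosen n) id"
proof (induction n)
  case 0
  show ?case by (simp add: one_H HL' one_norm ip.orthonormal_def)
next
  case (Suc n)
  let ?u = "next_vector (chosen n)"
  have IH: "finite (chosen n)" "chosen n \<subseteq> H" "ip.orthonormal (chosen n) id" using Suc.IH by blast+
  note u = next_vector(1,2)[OF IH]
  have uH: "?u \<in> H" and up: "\<And>v. v \<in> chosen n \<Longrightarrow> ip ?u v = 0"
    using u(1) unfolding perp_def by auto
  have up': "ip v ?u = 0" if "v \<in> chosen n" for v
    using up[OF that] ip.sym[of v ?u] HL' IH(2) uH that by auto
  show ?case
    using IH uH u(2) up up' HL' unfolding ip.orthonormal_def by auto
qed

lemma chosen_eq: "chosen n = eigvec ` {1..Suc n}"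
proof (induction n)
  case 0
  show ?case by (simp add: eigvec_def)
next
  case (Suc n)
  have "eigvec (Suc (Suc n)) = next_vector (chosen n)" by (simp add: eigvec_def)
  moreover have "{1..Suc (Suc n)} = insert (Suc (Suc n)) {1..Suc n}" by auto
  ultimately show ?case using Suc by simp
qed

text \<open>Rewrites the choice relative to the set \<open>chosen\<close> in terms of indices. For
  \<open>k = 1\<close> there are no constraints, and minimality is the nonnegativity of the energy
  together with \<open>E one one = 0\<close>.\<close>

lemma eigvec_perp:
  assumes "k \<ge> 1"
  shows "eigvec k \<in> H" "ip (eigvec k) (eigvec k) = 1"
    "1 \<le> i \<Longrightarrow> i < k \<Longrightarrow> ip (eigvec k) (eigvec i) = 0"
    "f \<in> H \<Longrightarrow> (\<And>i. 1 \<le> i \<Longrightarrow> i < k \<Longrightarrow> ip f (eigvec i) = 0) \<Longrightarrow>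
      E (eigvec k) (eigvec k) * ip f f \<le> E f f"
proof -
  have "eigvec k \<in> H \<and> ip (eigvec k) (eigvec k) = 1 \<and>
    (\<forall>i. 1 \<le> i \<and> i < k \<longrightarrow> ip (eigvec k) (eigvec i) = 0) \<and>
    (\<forall>f\<in>H. (\<forall>i. 1 \<le> i \<and> i < k \<longrightarrow> ip f (eigvec i) = 0) \<longrightarrow> E (eigvec k) (eigvec k) * ip f f \<le> E f f)"
  proof (cases "k = 1")
    case True
    then show ?thesis using one_H one_norm one_energy en.nonneg by (auto simp: eigvec_def)
  next
    case False
    then have "k = Suc (Suc (k - 2))" using assms by simp
    then obtain n where k: "k = Suc (Suc n)" by blast
    have u: "eigvec k = next_vector (chosen n)" by (simp add: eigvec_def k)
    have c: "finite (chosen n)" "chosen n \<subseteq> H" "ip.orthonormal (chosen n) id"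
      using chosen_orthonormal by blast+
    have mem: "f \<in> perp (chosen n) \<longleftrightarrow> f \<in> H \<and> (\<forall>i. 1 \<le> i \<and> i < k \<longrightarrow> ip f (eigvec i) = 0)" for f
      unfolding perp_def chosen_eq k by (auto simp: less_Suc_eq_le)
    show ?thesis using next_vector[OF c] unfolding u[symmetric] mem by auto
  qed
  then show "eigvec k \<in> H" "ip (eigvec k) (eigvec k) = 1"
    "1 \<le> i \<Longrightarrow> i < k \<Longrightarrow> ip (eigvec k) (eigvec i) = 0"
    "f \<in> H \<Longrightarrow> (\<And>i. 1 \<le> i \<Longrightarrow> i < k \<Longrightarrow> ip f (eigvec i) = 0) \<Longrightarrow>
      E (eigvec k) (eigvec k) * ip f f \<le> E f f" by auto
qed

lemma eigvec_orthonormal: "ip.orthonormal {1..} eigvec"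
proof -
  have "ip (eigvec i) (eigvec j) = (if i = j then 1 else 0)" if "i \<ge> 1" "j \<ge> 1" for i j
  proof (cases i j rule: linorder_cases)
    case less
    then show ?thesis
      using eigvec_perp(3)[of j i] ip.sym[of "eigvec i" "eigvec j"] eigvec_perp(1) that HL' by simp
  next
    case equal
    then show ?thesis using eigvec_perp(2) that by simp
  next
    case greater
    then show ?thesis using eigvec_perp(3)[of i j] that by simp
  qed
  then show ?thesis unfolding ip.orthonormal_def using eigvec_perp(1) HL' by auto
qed

text \<open>The Euler-Lagrange equation is available only for test vectors orthogonal to the earlier
  eigenvectors. A general \<open>f\<close> is split by projection onto these; on the projection both
  sides vanish, the energy by induction and the inner product by orthogonality.\<close>

lemma eigvec_eigen:
  assumes "k \<ge> 1" "f \<in> H"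
  shows "E f (eigvec k) = E (eigvec k) (eigvec k) * ip f (eigvec k)"
  using assms
proof (induction k arbitrary: f rule: less_induct)
  case (less k)
  let ?u = "eigvec k" and ?I = "{1..<k}"
  define T where "T = perp (eigvec ` ?I)"
  have on: "ip.orthonormal ?I eigvec" by (rule ip.orthonormal_subset[OF eigvec_orthonormal]) auto
  have mem: "f \<in> T \<longleftrightarrow> f \<in> H \<and> (\<forall>i\<in>?I. ip f (eigvec i) = 0)" for f
    unfolding T_def perp_def by auto
  have sub: "subspace T" unfolding T_def using eigvec_perp(1) HL' by (intro perp_subspace) auto
  have TH: "T \<subseteq> H" using mem by auto
  have uT: "?u \<in> T" unfolding mem using eigvec_perp(1,3)[OF less.prems(1)] by auto
  have uH: "?u \<in> H" using uT mem by auto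
  have min: "E ?u ?u * ip g g \<le> E g g" if "g \<in> T" for g
    using eigvec_perp(4)[OF less.prems(1), of g] that mem by auto
  have uu: "E ?u ?u = E ?u ?u * ip ?u ?u" unfolding eigvec_perp(2)[OF less.prems(1)] by simp
  have EL: "E ?u g = E ?u ?u * ip ?u g" if "g \<in> T" for g
    using euler_lagrange[OF sub TH min uT uu that] .
  let ?P = "ip.proj ?I eigvec f"
  have fL: "f \<in> L" using less.prems HL' by auto
  have vH: "eigvec i \<in> H" if "i \<in> ?I" for i using that eigvec_perp(1) by auto
  have PH: "?P \<in> H" unfolding ip.proj_def using vH by (intro en.mem(4,5)) auto
  have gH: "f - ?P \<in> H" using less.prems PH by (intro en.mem(3))
  have "f - ?P \<in> T" unfolding mem using gH ip.residual_basis[OF _ on fL] by auto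
  then have 1: "E (f - ?P) ?u = E ?u ?u * ip (f - ?P) ?u"
    using EL en.sym[OF uH gH] ip.sym[OF HL'[OF uH] HL'[OF gH]] by simp
  have z: "ip (eigvec i) ?u = 0" if "i \<in> ?I" for i
    using eigvec_perp(3)[OF less.prems(1), of i] that ip.sym[OF HL'[OF uH] HL'[OF vH[OF that]]] by simp
  \<comment> \<open>The equation for the earlier vector \<open>eigvec i\<close>, tested against
    \<open>?u\<close>, gives a multiple of an inner product that is zero.\<close>
  have "E (eigvec i) ?u = 0" if i: "i \<in> ?I" for i
    using less.IH[of i ?u] i uH en.sym[OF uH vH[OF i]] eigvec_perp(3)[OF less.prems(1), of i] by simp
  then have "E ?P ?u = 0" "ip ?P ?u = 0"
    unfolding ip.proj_def using z vH uH HL'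
    by (subst en.sum_left ip.sum_left, auto intro!: sum.neutral en.mem(4) ip.mem(4) simp: en.scale_left ip.scale_left)+
  then show ?case
    using 1 less.prems(2) PH uH fL HL' by (simp add: en.diff_left ip.diff_left)
qed

end

section \<open>The eigenbasis: growth of the eigenvalues, completeness, eigenspaces\<close>

locale eigen_basis = form_space L H ip E one for L H :: "'v::real_vector set" and ip E one +
  fixes u :: "nat \<Rightarrow> 'v" and lam :: "nat \<Rightarrow> real"
  assumes u_H: "i \<ge> 1 \<Longrightarrow> u i \<in> H"
    and u_on: "ip.orthonormal {1..} u"
    and u_eig: "i \<ge> 1 \<Longrightarrow> f \<in> H \<Longrightarrow> E f (u i) = lam i * ip f (u i)"
    and lam_min: "k \<ge> 1 \<Longrightarrow> f \<in> H \<Longrightarrow> (\<And>i. 1 \<le> i \<Longrightarrow> i < k \<Longrightarrow> ip f (u i) = 0) \<Longrightarrow>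
      lam k * ip f f \<le> E f f"
    and u_1: "u 1 = one"

lemma (in form_space) eigen_basis_exists:
  "eigen_basis L H ip E one eigvec (\<lambda>i. E (eigvec i) (eigvec i))"
proof
  show "eigvec i \<in> H" if "i \<ge> 1" for i by (rule eigvec_perp(1)[OF that])
  show "ip.orthonormal {1..} eigvec" by (rule eigvec_orthonormal)
  show "E f (eigvec i) = E (eigvec i) (eigvec i) * ip f (eigvec i)" if "i \<ge> 1" "f \<in> H" for i f
    by (rule eigvec_eigen[OF that])
  show "E (eigvec k) (eigvec k) * ip f f \<le> E f f"
    if "k \<ge> 1" "f \<in> H" "\<And>i. 1 \<le> i \<Longrightarrow> i < k \<Longrightarrow> ip f (eigvec i) = 0" for k f
    by (rule eigvec_perp(4)[OF that(1,2)]) (rule that(3))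
  show "eigvec 1 = one" by (simp add: eigvec_def)
qed

context eigen_basis
begin

lemma u_L: "i \<ge> 1 \<Longrightarrow> u i \<in> L"
  using u_H HL' by auto

lemma u_ip: "i \<ge> 1 \<Longrightarrow> j \<ge> 1 \<Longrightarrow> ip (u i) (u j) = (if i = j then 1 else 0)"
  using u_on unfolding ip.orthonormal_def by auto

lemma u_on_sub: "I \<subseteq> {1..} \<Longrightarrow> ip.orthonormal I u"
  using ip.orthonormal_subset[OF u_on] .

lemma u_energy: "i \<ge> 1 \<Longrightarrow> j \<ge> 1 \<Longrightarrow> E (u i) (u j) = (if i = j then lam i else 0)"
  using u_eig[of j "u i"] u_H u_ip by auto

lemma lam_mono: "1 \<le> i \<Longrightarrow> i \<le> j \<Longrightarrow> lam i \<le> lam j"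
  using lam_min[of i "u j"] u_H[of j] u_ip u_energy[of j j] by auto

lemma lam_1: "lam 1 = 0"
  using u_energy[of 1 1] one_energy u_1 by simp

lemma lam_nonneg: "i \<ge> 1 \<Longrightarrow> 0 \<le> lam i"
  using lam_mono[of 1 i] lam_1 by simp

text \<open>A bounded sequence of eigenvalues would make \<open>u\<close> bounded in the full norm.
  Compactness would give a Cauchy subsequence, but distinct orthonormal vectors have squared
  distance 2.\<close>

lemma lam_at_top: "filterlim lam at_top sequentially"
proof (rule ccontr)
  assume "\<not> ?thesis"
  then obtain B where B: "\<not> (\<forall>\<^sub>F n in sequentially. B \<le> lam n)" unfolding filterlim_at_top by auto
  have bd: "lam i \<le> B" if i: "i \<ge> 1" for i
  proof (rule ccontr)
    assume "\<not> lam i \<le> B"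
    then have "B \<le> lam n" if "n \<ge> i" for n using lam_mono[OF i that] by linarith
    then show False using B unfolding eventually_sequentially by blast
  qed
  obtain r :: "nat \<Rightarrow> nat" where r: "strict_mono r"
    and cau: "\<And>e. e > 0 \<Longrightarrow> \<exists>N. \<forall>m\<ge>N. \<forall>n\<ge>N.
      ip (u (Suc (r m)) - u (Suc (r n))) (u (Suc (r m)) - u (Suc (r n))) < e"
  proof -
    have "u (Suc n) \<in> H" for n using u_H by simp
    moreover have "ip (u (Suc n)) (u (Suc n)) + E (u (Suc n)) (u (Suc n)) \<le> 1 + B" for n
      using u_ip[of "Suc n" "Suc n"] u_energy[of "Suc n" "Suc n"] bd[of "Suc n"] by simp
    ultimately show thesis using compact[of "\<lambda>n. u (Suc n)" "1 + B"] that by auto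
  qed
  obtain N where N: "\<And>m n. m \<ge> N \<Longrightarrow> n \<ge> N \<Longrightarrow>
      ip (u (Suc (r m)) - u (Suc (r n))) (u (Suc (r m)) - u (Suc (r n))) < 1"
    using cau[of 1] by auto
  have ne: "Suc (r N) \<noteq> Suc (r (Suc N))" using r by (simp add: strict_mono_eq)
  have "ip (u (Suc (r N)) - u (Suc (r (Suc N)))) (u (Suc (r N)) - u (Suc (r (Suc N)))) = 2"
    using ne by (simp add: ip.quad_diff u_L u_ip)
  then show False using N[of N "Suc N"] by simp
qed

text \<open>By the eigenvalue equation the \<open>u i\<close> are orthogonal for \<open>E\<close> as
  well, so the projection taken in \<open>ip\<close> also splits the energy orthogonally.\<close>

lemma residual_energy:
  assumes I: "finite I" "I \<subseteq> {1..}" and h: "h \<in> H"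
  shows "ip.proj I u h \<in> H"
    "E (h - ip.proj I u h) (h - ip.proj I u h) = E h h - (\<Sum>i\<in>I. lam i * (ip h (u i))\<^sup>2)"
    "E (ip.proj I u h) (ip.proj I u h) = (\<Sum>i\<in>I. lam i * (ip h (u i))\<^sup>2)"
    "E (ip.proj I u h) (h - ip.proj I u h) = 0"
proof -
  let ?P = "ip.proj I u h"
  have on: "ip.orthonormal I u" by (rule u_on_sub[OF I(2)])
  have uI: "u i \<in> H" if "i \<in> I" for i using that I u_H by auto
  show PH: "?P \<in> H" unfolding ip.proj_def using uI by (intro en.mem(4,5)) auto
  have EP: "E f ?P = (\<Sum>i\<in>I. lam i * ip h (u i) * ip f (u i))" if f: "f \<in> H" for f
  proof -
    have "E f ?P = (\<Sum>i\<in>I. E f (ip h (u i) *\<^sub>R u i))"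
      unfolding ip.proj_def using uI f by (intro en.sum_right en.mem(4)) auto
    also have "\<dots> = (\<Sum>i\<in>I. lam i * ip h (u i) * ip f (u i))"
      using uI f I by (intro sum.cong refl) (auto simp: en.scale_right u_eig)
    finally show ?thesis .
  qed
  show 3: "E ?P ?P = (\<Sum>i\<in>I. lam i * (ip h (u i))\<^sup>2)"
    unfolding EP[OF PH] using ip.proj_basis[OF I(1) on]
    by (intro sum.cong) (auto simp: power2_eq_square)
  have hP: "E h ?P = (\<Sum>i\<in>I. lam i * (ip h (u i))\<^sup>2)"
    unfolding EP[OF h] by (simp add: power2_eq_square mult.assoc)
  show "E (h - ?P) (h - ?P) = E h h - (\<Sum>i\<in>I. lam i * (ip h (u i))\<^sup>2)"
    using h PH hP 3 by (simp add: en.quad_diff)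
  show "E ?P (h - ?P) = 0"
    using h PH hP 3 en.sym[OF h PH] by (simp add: en.diff_right)
qed

text \<open>The residual is orthogonal to the first \<open>N\<close> eigenvectors, so the minimality
  of \<open>lam (Suc N)\<close> applies to it, and its energy is at most that of
  \<open>h\<close>.\<close>

lemma residual_decay:
  assumes h: "h \<in> H" and N: "lam (Suc N) > 0"
  shows "ip (h - ip.proj {1..N} u h) (h - ip.proj {1..N} u h) \<le> E h h / lam (Suc N)"
proof -
  let ?r = "h - ip.proj {1..N} u h"
  have on: "ip.orthonormal {1..N} u" by (rule u_on_sub) auto
  have rH: "?r \<in> H" using h residual_energy(1)[of "{1..N}" h] by (intro en.mem(3)) auto
  have "lam (Suc N) * ip ?r ?r \<le> E ?r ?r"
    using ip.residual_basis[OF _ on HL'[OF h]] by (intro lam_min rH) auto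
  also have "\<dots> \<le> E h h"
    using residual_energy(2)[of "{1..N}" h] h lam_nonneg by (auto intro!: sum_nonneg)
  finally show ?thesis using N by (simp add: pos_le_divide_eq mult.commute)
qed

lemma lam_eventually_gt:
  obtains N where "\<And>n. n \<ge> N \<Longrightarrow> lam n > c" "N \<ge> 1"
proof -
  have "\<forall>\<^sub>F n in sequentially. c < lam n" using lam_at_top unfolding filterlim_at_top_dense by blast
  then obtain N where "\<And>n. n \<ge> N \<Longrightarrow> lam n > c" unfolding eventually_sequentially by auto
  then show ?thesis using that[of "max N 1"] by auto
qed

text \<open>For vectors of \<open>H\<close> the error is at most the energy divided by an
  eigenvalue, which tends to infinity. Density carries this over to \<open>L\<close>, because the
  projection of \<open>f\<close> approximates \<open>f\<close> at least as well as the projection of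
  a nearby \<open>h\<close>.\<close>

lemma basis_complete:
  assumes f: "f \<in> L"
  shows "(\<lambda>N. ip (f - ip.proj {1..N} u f) (f - ip.proj {1..N} u f)) \<longlonglongrightarrow> 0"
proof (rule LIMSEQ_I)
  fix e :: real assume e: "e > 0"
  obtain h where h: "h \<in> H" "ip (f - h) (f - h) < e / 4" using dense[OF f, of "e / 4"] e by auto
  \<comment> \<open>Both errors are kept below e / 4 because the square of a sum costs a factor 2;
    the \<open>+ 1\<close> keeps the threshold positive when \<open>h\<close> has zero
    energy.\<close>
  obtain N where N: "\<And>n. n \<ge> N \<Longrightarrow> lam n > 4 * (E h h + 1) / e" "N \<ge> 1"
    using lam_eventually_gt[of "4 * (E h h + 1) / e"] by blast
  have Eh: "E h h \<ge> 0" using h en.nonneg by auto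
  have "ip (f - ip.proj {1..n} u f) (f - ip.proj {1..n} u f) < e"
    if n: "n \<ge> N" for n
  proof -
    let ?P = "ip.proj {1..n} u h"
    have on: "ip.orthonormal {1..n} u" by (rule u_on_sub) auto
    have l: "lam (Suc n) > 4 * (E h h + 1) / e" using N n by simp
    have l0: "lam (Suc n) > 0" by (rule less_trans[OF _ l]) (use e Eh in simp)
    have "4 * (E h h + 1) < lam (Suc n) * e" using l e by (simp add: pos_divide_less_eq)
    then have "4 * E h h < e * lam (Suc n)" by (simp add: mult.commute)
    then have "E h h / lam (Suc n) < e / 4" using l0 by (simp add: field_simps)
    then have r: "ip (h - ?P) (h - ?P) < e / 4" using residual_decay[OF h(1) l0] by linarith
    have PL: "?P \<in> L" using residual_energy(1)[of "{1..n}" h] h HL' by auto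
    have m: "f - h \<in> L" "h - ?P \<in> L" using f h PL HL' by (auto intro!: ip.mem(3))
    have eq: "f - ?P = (f - h) + (h - ?P)" by simp
    have "ip (f - ip.proj {1..n} u f) (f - ip.proj {1..n} u f) \<le> ip (f - ?P) (f - ?P)"
      using ip.best_approximation[OF _ on f, of "\<lambda>i. ip h (u i)"] unfolding ip.proj_def by simp
    also have "\<dots> \<le> 2 * ip (f - h) (f - h) + 2 * ip (h - ?P) (h - ?P)"
    proof -
      have "0 \<le> ip ((f - h) - (h - ?P)) ((f - h) - (h - ?P))" by (rule ip.nonneg[OF ip.mem(3)[OF m]])
      then show ?thesis unfolding eq using ip.quad_add[OF m] ip.quad_diff[OF m] by linarith
    qed
    finally show ?thesis using h(2) r by linarith
  qed
  moreover have "0 \<le> ip (f - ip.proj {1..n} u f) (f - ip.proj {1..n} u f)" for n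
    using f by (intro ip.nonneg ip.mem(3) ip.proj_mem u_on_sub) auto
  ultimately show "\<exists>no. \<forall>n\<ge>no. norm (ip (f - ip.proj {1..n} u f) (f - ip.proj {1..n} u f) - 0) < e"
    by (auto simp: abs_of_nonneg)
qed

definition level :: "real \<Rightarrow> nat set" where
  "level l = {i. 1 \<le> i \<and> lam i = l}"

lemma level_finite: "finite (level l)"
proof -
  obtain N where N: "\<And>n. n \<ge> N \<Longrightarrow> lam n > l" using lam_eventually_gt[of l] by blast
  have "i < N" if "i \<in> level l" for i
    using N[of i] that unfolding level_def by (cases "i < N") auto
  then have "level l \<subseteq> {..<N}" by auto
  then show ?thesis using finite_subset by auto
qed

text \<open>Eigenfunctions are combinations of the \<open>u i\<close> only up to vectors of zero norm.\<close>

lemma eigenvector_iff: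
  assumes f: "f \<in> H"
  shows "(\<forall>g\<in>H. E g f = l * ip g f) \<longleftrightarrow> (\<exists>c. ip (f - (\<Sum>i\<in>level l. c i *\<^sub>R u i)) (f - (\<Sum>i\<in>level l. c i *\<^sub>R u i)) = 0)"
proof
  assume eig: "\<forall>g\<in>H. E g f = l * ip g f"
  have z: "ip f (u i) = 0" if i: "i \<ge> 1" "lam i \<noteq> l" for i
  proof -
    have "lam i * ip f (u i) = l * ip (u i) f"
      using u_eig[OF i(1) f] eig u_H[OF i(1)] en.sym[OF f u_H[OF i(1)]] by simp
    then show ?thesis using i(2) ip.sym[OF HL'[OF f] u_L[OF i(1)]] by simp
  qed
  obtain N where N: "\<And>n. n \<ge> N \<Longrightarrow> lam n > l" using lam_eventually_gt[of l] by blast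
  \<comment> \<open>All coefficients off the level vanish and the level lies below \<open>N\<close>,
    so the sequence of residuals is eventually constant; completeness then makes the constant
    zero.\<close>
  have "ip.proj {1..n} u f = ip.proj (level l) u f" if "n \<ge> N" for n
  proof -
    have "i \<in> {1..n}" if "i \<in> level l" for i
      using N[of i] that \<open>n \<ge> N\<close> unfolding level_def by (cases "i \<le> n") auto
    then have "level l \<subseteq> {1..n}" by auto
    then show ?thesis unfolding ip.proj_def
      using z by (intro sum.mono_neutral_right) (auto simp: level_def)
  qed
  then have "(\<lambda>n. ip (f - ip.proj {1..n} u f) (f - ip.proj {1..n} u f)) \<longlonglongrightarrow>
      ip (f - ip.proj (level l) u f) (f - ip.proj (level l) u f)"
    by (intro tendsto_eventually eventually_sequentiallyI[of N]) simp
  then have "ip (f - ip.proj (level l) u f) (f - ip.proj (level l) u f) = 0"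
    using basis_complete[OF HL'[OF f]] LIMSEQ_unique by auto
  then show "\<exists>c. ip (f - (\<Sum>i\<in>level l. c i *\<^sub>R u i)) (f - (\<Sum>i\<in>level l. c i *\<^sub>R u i)) = 0"
    unfolding ip.proj_def by auto
next
  assume "\<exists>c. ip (f - (\<Sum>i\<in>level l. c i *\<^sub>R u i)) (f - (\<Sum>i\<in>level l. c i *\<^sub>R u i)) = 0"
  then obtain c where c: "ip (f - (\<Sum>i\<in>level l. c i *\<^sub>R u i)) (f - (\<Sum>i\<in>level l. c i *\<^sub>R u i)) = 0" ..
  define p where "p = (\<Sum>i\<in>level l. c i *\<^sub>R u i)"
  have uI: "u i \<in> H" if "i \<in> level l" for i using that u_H by (auto simp: level_def)
  have pH: "p \<in> H" unfolding p_def using uI by (intro en.mem(4,5)) auto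
  have nH: "f - p \<in> H" using f pH by (rule en.mem(3))
  have n0: "ip (f - p) (f - p) = 0" using c unfolding p_def .
  show "\<forall>g\<in>H. E g f = l * ip g f"
  proof
    fix g assume g: "g \<in> H"
    have "E g (f - p) = 0" by (rule en.null_right[OF nH g null_energy[OF nH n0]])
    moreover have "ip g (f - p) = 0" by (rule ip.null_right[OF HL'[OF nH] HL'[OF g] n0])
    moreover have "E g p = (\<Sum>i\<in>level l. E g (c i *\<^sub>R u i))"
      unfolding p_def using uI g by (intro en.sum_right en.mem(4))
    moreover have "ip g p = (\<Sum>i\<in>level l. ip g (c i *\<^sub>R u i))"
      unfolding p_def using uI g HL' by (intro ip.sum_right ip.mem(4)) auto
    moreover have "E g (c i *\<^sub>R u i) = l * ip g (c i *\<^sub>R u i)" if "i \<in> level l" for i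
      using uI[OF that] g HL' u_eig[of i g] that
      by (simp add: en.scale_right ip.scale_right level_def)
    ultimately show "E g f = l * ip g f"
      using en.diff_right[OF f pH g] ip.diff_right[OF HL'[OF f] HL'[OF pH] HL'[OF g]]
      by (simp add: sum_distrib_left)
  qed
qed

end

section \<open>First-order perturbation of the second eigenvalue\<close>

context eigen_basis
begin

text \<open>Monotonicity makes the indices of one eigenvalue contiguous, and
  \<open>lam 1 = 0\<close> excludes the index 1, so the block starts exactly at 2.\<close>

lemma level_two:
  assumes "lam 2 > 0"
  obtains m where "m \<ge> 1" "level (lam 2) = {2..m + 1}"
proof -
  let ?S = "level (lam 2)"
  have 2: "2 \<in> ?S" by (simp add: level_def)
  define M where "M = Max ?S"
  have M: "M \<in> ?S" unfolding M_def using 2 by (intro Max_in level_finite) auto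
  have "M \<ge> 2" unfolding M_def using 2 level_finite by simp
  have "?S = {2..M}"
  proof (rule set_eqI, rule iffI)
    fix i
    assume i: "i \<in> ?S"
    then have "i \<le> M" unfolding M_def using level_finite by simp
    moreover have "i \<noteq> 1" using i assms lam_1 by (auto simp: level_def)
    ultimately show "i \<in> {2..M}" using i by (auto simp: level_def)
  next
    fix i
    assume i: "i \<in> {2..M}"
    then have "lam 2 \<le> lam i" "lam i \<le> lam M" by (auto intro!: lam_mono)
    then show "i \<in> ?S" using i M by (auto simp: level_def)
  qed
  then have "?S = {2..(M - 1) + 1}" using \<open>M \<ge> 2\<close> by simp
  moreover have "M - 1 \<ge> 1" using \<open>M \<ge> 2\<close> by simp
  ultimately show ?thesis using that by blast
qed

lemma rayleigh_lower:
  assumes "f \<in> H" "ip f one = 0"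
  shows "lam 2 * ip f f \<le> E f f"
proof (rule lam_min)
  fix i :: nat assume "1 \<le> i" "i < 2"
  then have "i = 1" by simp
  then show "ip f (u i) = 0" using assms u_1 by simp
qed (use assms in auto)

text \<open>A minimiser does at least as well as \<open>u 2\<close>, so its quotient is
  \<open>lam 2\<close> and Euler-Lagrange applies on the complement of \<open>one\<close>.
  Conversely the eigenvalue equation tested against \<open>one\<close> forces mean zero, since
  \<open>one\<close> has no energy and \<open>lam 2\<close> is positive.\<close>

lemma rayleigh_minimizer_iff:
  assumes l: "lam 2 > 0" and f: "f \<in> H" "ip f f > 0"
  shows "ip f one = 0 \<and> (\<forall>h\<in>H. ip h one = 0 \<longrightarrow> ip h h > 0 \<longrightarrow> E f f / ip f f \<le> E h h / ip h h)
    \<longleftrightarrow> (\<forall>g\<in>H. E g f = lam 2 * ip g f)"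
proof
  assume f1: "ip f one = 0 \<and> (\<forall>h\<in>H. ip h one = 0 \<longrightarrow> ip h h > 0 \<longrightarrow> E f f / ip f f \<le> E h h / ip h h)"
  have u2: "u 2 \<in> H" "ip (u 2) one = 0" "ip (u 2) (u 2) = 1" "E (u 2) (u 2) = lam 2"
    using u_H[of 2] u_ip[of 2 1] u_ip[of 2 2] u_energy[of 2 2] u_1 by auto
  have "E f f / ip f f \<le> lam 2" using f1 u2 by force
  then have "E f f \<le> lam 2 * ip f f" using f(2) by (simp add: pos_divide_le_eq)
  then have eq: "E f f = lam 2 * ip f f" using rayleigh_lower[of f] f f1 by simp
  have oneL: "one \<in> L" using one_H HL' by simp
  have sub: "subspace (perp {one})" using oneL by (intro perp_subspace) simp
  have perp: "g \<in> perp {one} \<longleftrightarrow> g \<in> H \<and> ip g one = 0" for g unfolding perp_def by simp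
  have EL: "E f g = lam 2 * ip f g" if "g \<in> perp {one}" for g
  proof (rule euler_lagrange[OF sub _ _ _ eq that])
    show "perp {one} \<subseteq> H" unfolding perp_def by auto
    show "lam 2 * ip h h \<le> E h h" if "h \<in> perp {one}" for h using that perp rayleigh_lower by simp
    show "f \<in> perp {one}" using perp f f1 by simp
  qed
  show "\<forall>g\<in>H. E g f = lam 2 * ip g f"
  proof
    fix g assume g: "g \<in> H"
    \<comment> \<open>Removing the mean makes the test vector orthogonal to \<open>one\<close>; the
      removed constant contributes nothing to either side.\<close>
    let ?g = "g - ip g one *\<^sub>R one"
    have gH: "?g \<in> H" using g one_H by (intro en.mem(3,4))
    have "?g \<in> perp {one}"
      unfolding perp using gH g oneL HL' one_norm by (simp add: ip.diff_left ip.scale_left ip.mem(4))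
    then have "E f ?g = lam 2 * ip f ?g" by (rule EL)
    moreover have "E f one = 0" by (rule en.null_right[OF one_H f(1) one_energy])
    ultimately have "E f g = lam 2 * ip f g"
      using g f one_H oneL HL' f1
      by (simp add: en.diff_right ip.diff_right en.scale_right ip.scale_right en.mem(4) ip.mem(4))
    then show "E g f = lam 2 * ip g f" using en.sym[OF g f(1)] ip.sym[OF HL'[OF g] HL'[OF f(1)]] by simp
  qed
next
  assume eig: "\<forall>g\<in>H. E g f = lam 2 * ip g f"
  have "E one f = 0" by (rule en.null_left[OF one_H f(1) one_energy])
  then have "ip one f = 0" using eig one_H l by auto
  then have "ip f one = 0" using ip.sym[OF HL'[OF one_H] HL'[OF f(1)]] by simp
  moreover have "E f f / ip f f \<le> E h h / ip h h" if "h \<in> H" "ip h one = 0" "ip h h > 0" for h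
    using rayleigh_lower[OF that(1,2)] eig f that(3) by (simp add: pos_le_divide_eq)
  ultimately show "ip f one = 0 \<and> (\<forall>h\<in>H. ip h one = 0 \<longrightarrow> ip h h > 0 \<longrightarrow> E f f / ip f f \<le> E h h / ip h h)"
    by simp
qed

text \<open>Polarisation after rescaling \<open>p\<close> by \<open>sqrt s\<close> and
  \<open>q\<close> by its inverse. The free parameter \<open>s\<close> is the weight in Young's
  inequality and is later chosen proportional to \<open>t\<close>.\<close>

lemma dominated_cross:
  assumes D: "sym_form H D" and dom: "\<And>f. f \<in> H \<Longrightarrow> \<bar>D f f\<bar> \<le> c * E f f"
    and p: "p \<in> H" and q: "q \<in> H" and s: "s > 0"
  shows "\<bar>2 * D p q\<bar> \<le> c * (s * E p p + E q q / s)"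
proof -
  interpret D: sym_form H D by fact
  define x where "x = sqrt s *\<^sub>R p"
  define y where "y = (1 / sqrt s) *\<^sub>R q"
  have m: "x \<in> H" "y \<in> H" unfolding x_def y_def using p q by (auto intro: en.mem(4))
  have xy: "D x y = D p q" using p q s by (simp add: x_def y_def D.scale_left D.scale_right en.mem(4))
  have E: "E x x = s * E p p" "E y y = E q q / s"
    using p q s by (simp_all add: x_def y_def en.quad_scale power_divide)
  have "4 * D x y = D (x + y) (x + y) - D (x - y) (x - y)"
    using D.quad_add[OF m] D.quad_diff[OF m] by simp
  moreover have "\<bar>D (x + y) (x + y)\<bar> \<le> c * (E x x + 2 * E x y + E y y)"
    using dom[OF en.mem(2)[OF m]] en.quad_add[OF m] by simp
  moreover have "\<bar>D (x - y) (x - y)\<bar> \<le> c * (E x x - 2 * E x y + E y y)"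
    using dom[OF en.mem(3)[OF m]] en.quad_diff[OF m] by simp
  moreover have "c * (E x x + 2 * E x y + E y y) + c * (E x x - 2 * E x y + E y y) = 2 * (c * (E x x + E y y))"
    by (simp add: algebra_simps)
  ultimately have "\<bar>2 * D x y\<bar> \<le> c * (E x x + E y y)" by linarith
  then show ?thesis unfolding xy E .
qed

text \<open>The spectral gap above \<open>lam 2\<close> absorbs the component of \<open>f\<close> outside the eigenspace, at a
  cost of order \<open>t\<^sup>2\<close>.\<close>

lemma perturbed_lower_bound:
  assumes D: "sym_form H D" and dom: "\<And>f. f \<in> H \<Longrightarrow> \<bar>D f f\<bar> \<le> c * E f f" and c: "c > 0"
    and l: "lam 2 > 0" and lev: "level (lam 2) = {2..m + 1}"
    and M: "\<And>a. M * (\<Sum>i\<in>{2..m + 1}. (a i)\<^sup>2)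
      \<le> D (\<Sum>i\<in>{2..m + 1}. a i *\<^sub>R u i) (\<Sum>i\<in>{2..m + 1}. a i *\<^sub>R u i)"
  obtains C t0 where "C \<ge> 0" "t0 > 0"
    "\<And>t f. 0 \<le> t \<Longrightarrow> t \<le> t0 \<Longrightarrow> f \<in> H \<Longrightarrow> ip f one = 0 \<Longrightarrow>
      (lam 2 + t * M - C * t\<^sup>2) * ip f f \<le> E f f + t * D f f"
proof -
  interpret D: sym_form H D by fact
  define I where "I = {2..m + 1}"
  define l2 where "l2 = lam 2"
  \<comment> \<open>The first eigenvalue above the block \<open>{2..m + 1}\<close>.\<close>
  define l' where "l' = lam (m + 2)"
  have I: "finite I" "I \<subseteq> {1..}" unfolding I_def by auto
  have on: "ip.orthonormal I u" by (rule u_on_sub[OF I(2)])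
  have "2 \<in> level (lam 2)" by (simp add: level_def)
  then have "m + 2 \<ge> 2" "m + 2 \<notin> level (lam 2)" unfolding lev by auto
  then have gap: "l' > l2"
    using lam_mono[of 2 "m + 2"] unfolding l'_def l2_def level_def by fastforce
  have l2: "l2 > 0" using l unfolding l2_def .
  then have l': "l' > 0" using gap by simp
  \<comment> \<open>Since \<open>l' * Q \<le> e\<close> for the part \<open>q\<close> outside the
    eigenspace, \<open>l2 * Q\<close> uses at most the share \<open>1 - \<kappa>\<close> of its
    energy \<open>e\<close>; the share \<open>\<kappa>\<close> pays for all perturbation terms on
    \<open>q\<close>.\<close>
  define \<kappa> where "\<kappa> = 1 - l2 / l'"
  have \<kappa>: "\<kappa> > 0" unfolding \<kappa>_def using gap l' by simp
  \<comment> \<open>\<open>C\<close> is the constant that Young's inequality leaves in front of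
    \<open>t\<^sup>2 * P\<close> in \<open>cross\<close>; \<open>t0\<close> keeps the terms of first
    order in \<open>t\<close> on \<open>q\<close> below half of \<open>\<kappa> * e\<close>.\<close>
  define C where "C = 4 * c\<^sup>2 * l2 / \<kappa>"
  define t0 where "t0 = \<kappa> / (2 * (c + \<bar>M\<bar> / l'))"
  have den: "c + \<bar>M\<bar> / l' > 0" using c l' by (simp add: add_pos_nonneg)
  show thesis
  proof (rule that)
    show "C \<ge> 0" unfolding C_def using \<kappa> l2 by simp
    show "t0 > 0" unfolding t0_def using \<kappa> den by simp
    fix t f assume t: "0 \<le> t" "t \<le> t0" and f: "f \<in> H" "ip f one = 0"
    let ?p = "ip.proj I u f"
    define q where "q = f - ?p"
    define P where "P = (\<Sum>i\<in>I. (ip f (u i))\<^sup>2)"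
    define Q where "Q = ip q q"
    define e where "e = E q q"
    note fL = HL'[OF f(1)]
    have pH: "?p \<in> H" by (rule residual_energy(1)[OF I f(1)])
    have qH: "q \<in> H" unfolding q_def using f pH by (intro en.mem(3))
    have lamI: "lam i = l2" if "i \<in> I" for i
      using that lev unfolding I_def l2_def level_def by blast
    have Ep: "E ?p ?p = l2 * P"
      unfolding residual_energy(3)[OF I f(1)] P_def by (simp add: lamI sum_distrib_left)
    have Eq: "e = E f f - l2 * P"
      unfolding e_def q_def residual_energy(2)[OF I f(1)] P_def by (simp add: lamI sum_distrib_left)
    have Qeq: "Q = ip f f - P"
      unfolding Q_def q_def P_def by (rule ip.residual_quad[OF I(1) on fL])
    have P0: "P \<ge> 0" unfolding P_def by (simp add: sum_nonneg)
    have Q0: "Q \<ge> 0" unfolding Q_def using qH HL' by (intro ip.nonneg)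
    have e0: "e \<ge> 0" unfolding e_def using qH by (intro en.nonneg)
    have perp1: "ip ?p one = 0"
    proof -
      have "ip ?p (u 1) = (\<Sum>i\<in>I. ip (ip f (u i) *\<^sub>R u i) (u 1))"
        unfolding ip.proj_def using u_L I by (intro ip.sum_left ip.mem(4)) auto
      also have "\<dots> = 0"
        using u_L I u_ip[of _ 1] by (intro sum.neutral) (auto simp: ip.scale_left I_def)
      finally show ?thesis unfolding u_1 .
    qed
    have "l' * Q \<le> e" unfolding l'_def Q_def e_def
    proof (rule lam_min)
      show "1 \<le> m + 2" by simp
      show "q \<in> H" by (rule qH)
      fix i assume i: "1 \<le> i" "i < m + 2"
      show "ip q (u i) = 0"
      proof (cases "i = 1")
        case True
        then show ?thesis unfolding q_def u_1[symmetric] True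
          using ip.diff_left[OF fL HL'[OF pH] u_L[of 1]] f perp1 by (simp add: u_1[symmetric])
      next
        case False
        then have "i \<in> I" using i unfolding I_def by auto
        then show ?thesis unfolding q_def by (rule ip.residual_basis[OF I(1) on fL])
      qed
    qed
    then have Qe: "Q \<le> e / l'" using l' by (simp add: pos_le_divide_eq mult.commute)
    have fpq: "f = ?p + q" unfolding q_def by simp
    have Df: "D f f = D ?p ?p + 2 * D ?p q + D q q"
      by (subst (1 2) fpq) (rule D.quad_add[OF pH qH])
    have Dp: "M * P \<le> D ?p ?p" using M[of "\<lambda>i. ip f (u i)"] unfolding P_def ip.proj_def I_def .
    have Dq: "- (c * e) \<le> D q q" using dom[OF qH] unfolding e_def by linarith
    have upper: "(l2 + t * M - C * t\<^sup>2) * Q \<le> (1 - \<kappa>) * e + t * (\<bar>M\<bar> / l') * e"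
    proof -
      have "(l2 + t * M - C * t\<^sup>2) * Q \<le> (l2 + t * \<bar>M\<bar>) * Q"
      proof (rule mult_right_mono[OF _ Q0])
        have "t * M \<le> t * \<bar>M\<bar>" using t by (intro mult_left_mono) auto
        moreover have "0 \<le> C * t\<^sup>2" using \<open>C \<ge> 0\<close> by simp
        ultimately show "l2 + t * M - C * t\<^sup>2 \<le> l2 + t * \<bar>M\<bar>" by linarith
      qed
      also have "\<dots> \<le> (l2 + t * \<bar>M\<bar>) * (e / l')"
        using Qe l2 t by (intro mult_left_mono) auto
      also have "\<dots> = (1 - \<kappa>) * e + t * (\<bar>M\<bar> / l') * e" unfolding \<kappa>_def by (simp add: algebra_simps add_divide_distrib)
      finally show ?thesis .
    qed
    have te: "t * (c + \<bar>M\<bar> / l') * e \<le> \<kappa> / 2 * e"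
    proof (rule mult_right_mono[OF _ e0])
      define d where "d = c + \<bar>M\<bar> / l'"
      have "t \<le> \<kappa> / (2 * d)" "d > 0" using t(2) den unfolding t0_def d_def by auto
      then show "t * (c + \<bar>M\<bar> / l') \<le> \<kappa> / 2"
        unfolding d_def[symmetric] by (simp add: field_simps)
    qed
    have cross: "t * (2 * D ?p q) \<ge> - (C * t\<^sup>2 * P) - \<kappa> / 4 * e"
    proof (cases "t = 0")
      case True
      then show ?thesis using \<kappa> e0 by simp
    next
      case False
      then have t0: "t > 0" using t by simp
      \<comment> \<open>This \<open>s\<close> makes the \<open>q\<close> part of the cross term
        equal to \<open>\<kappa> / 4 * e\<close>; it degenerates at \<open>t = 0\<close>, which is
        treated apart.\<close>
      define s where "s = 4 * t * c / \<kappa>"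
      have s: "s > 0" unfolding s_def using t0 c \<kappa> by simp
      have "\<bar>2 * D ?p q\<bar> \<le> c * (s * E ?p ?p + E q q / s)"
        by (rule dominated_cross[OF D dom pH qH s])
      then have "- (2 * D ?p q) \<le> c * (s * (l2 * P) + e / s)" unfolding Ep e_def by linarith
      then have "t * - (2 * D ?p q) \<le> t * (c * (s * (l2 * P) + e / s))" using t0 by (intro mult_left_mono) auto
      also have "\<dots> = C * t\<^sup>2 * P + \<kappa> / 4 * e"
        unfolding s_def C_def using t0 c \<kappa> by (simp add: field_simps power2_eq_square)
      finally show ?thesis by simp
    qed
    have "t * (M * P) \<le> t * D ?p ?p" "t * - (c * e) \<le> t * D q q"
      by (rule mult_left_mono[OF Dp t(1)], rule mult_left_mono[OF Dq t(1)])
    then have "t * D f f \<ge> t * (M * P) - C * t\<^sup>2 * P - \<kappa> / 4 * e - t * c * e"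
      unfolding Df using cross by (simp add: algebra_simps)
    moreover have "(l2 + t * M - C * t\<^sup>2) * ip f f = (l2 + t * M - C * t\<^sup>2) * P + (l2 + t * M - C * t\<^sup>2) * Q"
      unfolding Qeq by (simp add: right_diff_distrib)
    \<comment> \<open>The cross term takes a quarter and the first-order terms half of
      \<open>\<kappa> * e\<close>, so a quarter is left over.\<close>
    moreover have "(1 - \<kappa>) * e + t * (\<bar>M\<bar> / l') * e \<le> e - \<kappa> / 4 * e - t * c * e"
    proof -
      have "t * c * e + t * (\<bar>M\<bar> / l') * e \<le> \<kappa> / 2 * e"
        using te by (simp only: distrib_left distrib_right)
      moreover have "(1 - \<kappa>) * e = e - \<kappa> * e" by (simp add: left_diff_distrib)
      moreover have "0 \<le> \<kappa> * e" using \<kappa> e0 by simp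
      ultimately show ?thesis by linarith
    qed
    ultimately show "(lam 2 + t * M - C * t\<^sup>2) * ip f f \<le> E f f + t * D f f"
      using upper Eq unfolding l2_def[symmetric] by (simp add: algebra_simps)
  qed
qed

end

section \<open>Quadratic forms and test functions\<close>

lemma measurable_vec_nth [measurable (raw)]:
  fixes f :: "'a \<Rightarrow> ('b::euclidean_space)^'n"
  assumes "f \<in> borel_measurable M"
  shows "(\<lambda>x. f x $ i) \<in> borel_measurable M"
proof -
  have "(\<lambda>v::'b^'n. v $ i) \<in> borel_measurable borel"
    by (intro borel_measurable_continuous_onI continuous_intros)
  then show ?thesis using measurable_compose[OF assms] by blast
qed

lemma measurable_vec_lambda [measurable (raw)]:
  fixes f :: "'n::finite \<Rightarrow> 'a \<Rightarrow> 'b::euclidean_space"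
  assumes "\<And>i. f i \<in> borel_measurable M"
  shows "(\<lambda>x. \<chi> i. f i x) \<in> borel_measurable M"
proof (rule borel_measurable_euclidean_space[THEN iffD2], rule ballI)
  fix b :: "'b^'n" assume "b \<in> Basis"
  then obtain i u where b: "b = axis i u" unfolding Basis_vec_def by auto
  have "(\<lambda>x. (\<chi> i. f i x) \<bullet> b) = (\<lambda>x. f i x \<bullet> u)"
    by (simp add: b inner_axis)
  then show "(\<lambda>x. (\<chi> i. f i x) \<bullet> b) \<in> borel_measurable M" using assms by simp
qed

lemma measurable_matrix_ops [measurable (raw)]:
  fixes A B :: "'a \<Rightarrow> real^'n^'n" and v :: "'a \<Rightarrow> real^'n"
  assumes [measurable]: "A \<in> borel_measurable M" "B \<in> borel_measurable M" "v \<in> borel_measurable M"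
  shows "(\<lambda>x. A x *v v x) \<in> borel_measurable M"
    and "(\<lambda>x. A x ** B x) \<in> borel_measurable M"
    and "(\<lambda>x. trace (A x)) \<in> borel_measurable M"
    and "(\<lambda>x. outer (v x)) \<in> borel_measurable M"
  unfolding matrix_vector_mult_def matrix_matrix_mult_def trace_def outer_def by measurable

section \<open>Symmetric matrices dominated by a positive semidefinite one\<close>

lemma sym_inner:
  fixes A :: "real^'n^'n"
  assumes "transpose A = A"
  shows "x \<bullet> (A *v y) = y \<bullet> (A *v x)"
  using dot_lmul_matrix[of x A y] vector_transpose_matrix[of x A] assms by (simp add: inner_commute)

lemma psdD: "psd A \<Longrightarrow> transpose A = A" "psd A \<Longrightarrow> 0 \<le> v \<bullet> (A *v v)"
  unfolding psd_def by auto

text \<open>In the Loewner order this bounds \<open>D\<close> between \<open>- c\<close> and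
  \<open>c\<close> times \<open>W\<close>. It is what admissibility becomes for the difference of
  two fields.\<close>

definition form_dominated :: "real \<Rightarrow> real^'n^'n \<Rightarrow> real^'n^'n \<Rightarrow> bool" where
  "form_dominated c D W \<longleftrightarrow> transpose D = D \<and> (\<forall>v. \<bar>v \<bullet> (D *v v)\<bar> \<le> c * (v \<bullet> (W *v v)))"

lemma form_dominated_self: "psd W \<Longrightarrow> form_dominated 1 W W"
  unfolding form_dominated_def psd_def by simp

lemma form_dominated_cross:
  assumes D: "form_dominated c D W" and W: "psd W"
  shows "\<bar>p \<bullet> (D *v q)\<bar> \<le> c / 2 * (p \<bullet> (W *v p) + q \<bullet> (W *v q))"
proof -
  have sD: "q \<bullet> (D *v p) = p \<bullet> (D *v q)" using D sym_inner unfolding form_dominated_def by metis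
  have sW: "q \<bullet> (W *v p) = p \<bullet> (W *v q)" using W sym_inner psdD(1) by metis
  have dom: "\<bar>v \<bullet> (D *v v)\<bar> \<le> c * (v \<bullet> (W *v v))" for v using D unfolding form_dominated_def by blast
  have "4 * (p \<bullet> (D *v q)) = (p + q) \<bullet> (D *v (p + q)) - (p - q) \<bullet> (D *v (p - q))"
    using sD by (simp add: matrix_vector_right_distrib matrix_vector_mult_diff_distrib inner_add_left inner_add_right
        inner_diff_left inner_diff_right)
  moreover have "c * ((p + q) \<bullet> (W *v (p + q))) + c * ((p - q) \<bullet> (W *v (p - q)))
      = 4 * (c / 2 * (p \<bullet> (W *v p) + q \<bullet> (W *v q)))"
    using sW by (simp add: matrix_vector_right_distrib matrix_vector_mult_diff_distrib inner_add_left inner_add_right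
        inner_diff_left inner_diff_right algebra_simps)
  ultimately show ?thesis using dom[of "p + q"] dom[of "p - q"] by linarith
qed

text \<open>The cross bound between \<open>w\<close> and the multiple by \<open>s\<close> of its
  image under \<open>D\<close> has a left side linear in \<open>s\<close> and a right side of order
  s^2, so the image is 0. Hence a dominated field cannot distinguish two gradients whose difference
  has zero energy.\<close>

lemma form_dominated_null:
  assumes D: "form_dominated c D W" and W: "psd W" and w: "w \<bullet> (W *v w) = 0"
  shows "D *v w = 0"
proof -
  let ?p = "D *v w"
  let ?a = "?p \<bullet> ?p" and ?b = "c / 2 * (?p \<bullet> (W *v ?p))"
  have bb: "\<bar>s * ?a\<bar> \<le> s\<^sup>2 * ?b" for s
    using form_dominated_cross[OF D W, of "s *\<^sub>R ?p" w] w
    by (simp add: matrix_vector_mult_scaleR power2_eq_square algebra_simps)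
  have q: "0 \<le> 0 + 2 * s * (- ?a / 2) + s\<^sup>2 * ?b" for s
    using abs_ge_self[of "s * ?a"] bb[of s] by simp
  have "0 \<le> ?b" using q[of 1] q[of "-1"] by simp
  from quadratic_nonneg_imp[OF q this] show ?thesis by simp
qed

text \<open>Presents the partial derivative as a continuous function vanishing outside the same
  compact set as the test function, together with its meaning along lines; integrability and the
  mean value theorem are applied in this form.\<close>

lemma test_function_partial:
  fixes \<phi> :: "real^'n \<Rightarrow> real"
  assumes "test_function \<phi>"
  obtains \<psi> K where "compact K" "continuous_on UNIV \<phi>" "continuous_on UNIV \<psi>"
    "\<And>x. x \<notin> K \<Longrightarrow> \<phi> x = 0" "\<And>x. x \<notin> K \<Longrightarrow> \<psi> x = 0"
    "\<And>x. frechet_derivative \<phi> (at x) (axis i 1) = \<psi> x"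
    "\<And>x t. ((\<lambda>t. \<phi> (x + t *\<^sub>R axis i 1)) has_real_derivative \<psi> (x + t *\<^sub>R axis i 1)) (at t)"
proof -
  from assms obtain D where D0: "D [] = \<phi>"
    and D: "\<And>\<alpha> x. (D \<alpha> has_derivative (\<lambda>h. \<Sum>i\<in>UNIV. h $ i * D (i # \<alpha>) x)) (at x)"
    unfolding test_function_def smooth_def by auto
  define K where "K = closure {x. \<phi> x \<noteq> 0}"
  have K: "compact K" using assms unfolding test_function_def K_def by simp
  have der: "(\<phi> has_derivative (\<lambda>h. \<Sum>i\<in>UNIV. h $ i * D [i] x)) (at x)" for x
    using D[of "[]"] D0 by simp
  have cont: "continuous_on UNIV (D \<alpha>)" for \<alpha>
    using D by (auto intro!: continuous_at_imp_continuous_on has_derivative_continuous)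
  have ax: "(\<Sum>j\<in>UNIV. axis i (1::real) $ j * D [j] x) = D [i] x" for x
    by (simp add: axis_def if_distrib[of "\<lambda>t. t * _"] cong: if_cong)
  have fr: "frechet_derivative \<phi> (at x) (axis i 1) = D [i] x" for x
    unfolding frechet_derivative_at[OF der[of x], symmetric] by (rule ax)
  have out: "\<phi> x = 0" if "x \<notin> K" for x using that closure_subset[of "{x. \<phi> x \<noteq> 0}"] unfolding K_def by auto
  \<comment> \<open>The complement of the support is open and the function is zero on it, so
    uniqueness of the derivative applies.\<close>
  have out': "D [i] x = 0" if x: "x \<notin> K" for x
  proof -
    have "((\<lambda>_. 0) has_derivative (\<lambda>h. \<Sum>i\<in>UNIV. h $ i * D [i] x)) (at x)"
      by (rule has_derivative_transform_within_open[OF der, of "- K"])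
        (use x out K in \<open>auto simp: compact_imp_closed open_Compl\<close>)
    then have "(\<lambda>h. \<Sum>i\<in>UNIV. h $ i * D [i] x) = (\<lambda>_. 0)"
      by (rule has_derivative_unique[OF _ has_derivative_const])
    from fun_cong[OF this, of "axis i 1"] show ?thesis unfolding ax .
  qed
  have line: "((\<lambda>t. \<phi> (x + t *\<^sub>R axis i 1)) has_real_derivative D [i] (x + t *\<^sub>R axis i 1)) (at t)" for x t
  proof -
    have "((\<lambda>t. x + t *\<^sub>R axis i (1::real)) has_derivative (\<lambda>t. t *\<^sub>R axis i 1)) (at t)"
      by (auto intro!: derivative_eq_intros)
    from has_derivative_compose[OF this der]
    have "((\<lambda>t. \<phi> (x + t *\<^sub>R axis i 1)) has_derivative
        (\<lambda>h. \<Sum>j\<in>UNIV. (h *\<^sub>R axis i 1) $ j * D [j] (x + t *\<^sub>R axis i 1))) (at t)" .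
    moreover have s: "(\<Sum>j\<in>UNIV. (h *\<^sub>R axis i (1::real)) $ j * D [j] y) = D [i] y * h" for h y
      using ax[of y] by (simp add: sum_distrib_left[symmetric] mult.assoc)
    ultimately show ?thesis unfolding has_field_derivative_def s by simp
  qed
  show thesis by (rule that[OF K _ cont[of "[i]"] out out' fr line]) (use cont[of "[]"] D0 in simp)
qed

text \<open>Translation invariance of Lebesgue measure gives every difference quotient the integral
  0, and dominated convergence passes to the derivative. This is what makes 0 a weak gradient of
  constants.\<close>

lemma integral_partial_derivative_zero:
  fixes \<phi> :: "real^'n \<Rightarrow> real"
  assumes "test_function \<phi>"
  shows "(\<integral>x. frechet_derivative \<phi> (at x) (axis i 1) \<partial>lborel) = 0"
proof -
  from assms obtain \<psi> K where K: "compact K" and c: "continuous_on UNIV \<phi>" "continuous_on UNIV \<psi>"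
    and out: "\<And>x. x \<notin> K \<Longrightarrow> \<phi> x = 0" "\<And>x. x \<notin> K \<Longrightarrow> \<psi> x = 0"
    and fr: "\<And>x. frechet_derivative \<phi> (at x) (axis i 1) = \<psi> x"
    and der: "\<And>x t. ((\<lambda>t. \<phi> (x + t *\<^sub>R axis i 1)) has_real_derivative \<psi> (x + t *\<^sub>R axis i 1)) (at t)"
    by (rule test_function_partial[of \<phi> i]) blast
  have [measurable]: "\<phi> \<in> borel_measurable borel" "\<psi> \<in> borel_measurable borel"
    using c by (auto intro: borel_measurable_continuous_onI)
  let ?e = "axis i 1 :: real^'n"
  \<comment> \<open>All points from which a step of length at most 1 along \<open>?e\<close> can
    reach \<open>K\<close>; every difference quotient vanishes outside this set, since
    \<open>h n \<le> 1\<close>.\<close>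
  define K' where "K' = (\<lambda>(x, t). x - t *\<^sub>R ?e) ` (K \<times> {0..1})"
  have K': "compact K'" unfolding K'_def
    by (intro compact_continuous_image compact_Times K) (auto intro!: continuous_intros simp: split_beta)
  have "bounded (\<psi> ` K)" using K c by (intro compact_imp_bounded compact_continuous_image) (auto intro: continuous_on_subset)
  then obtain C where "\<And>y. y \<in> \<psi> ` K \<Longrightarrow> norm y \<le> C" unfolding bounded_iff by auto
  \<comment> \<open>For empty \<open>K\<close> the bound \<open>C\<close> may be negative.\<close>
  then have C: "\<bar>\<psi> x\<bar> \<le> max C 0" for x
    using out(2)[of x] by (cases "x \<in> K") (force simp: le_max_iff_disj)+
  have int\<phi>: "integrable lborel \<phi>"
  proof -
    have "integrable lborel (\<lambda>x. indicator K x *\<^sub>R \<phi> x)"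
      using K c by (intro borel_integrable_compact) (auto intro: continuous_on_subset)
    moreover have "(\<lambda>x. indicator K x *\<^sub>R \<phi> x) = \<phi>"
    proof
      show "indicator K x *\<^sub>R \<phi> x = \<phi> x" for x using out(1)[of x] by (cases "x \<in> K") auto
    qed
    ultimately show ?thesis by (simp only:)
  qed
  define h :: "nat \<Rightarrow> real" where "h n = 1 / (real n + 1)" for n
  have h: "0 < h n" "h n \<le> 1" for n unfolding h_def by auto
  have h0: "h \<longlonglongrightarrow> 0" unfolding h_def using LIMSEQ_inverse_real_of_nat by (simp add: inverse_eq_divide add.commute)
  define q where "q n x = (\<phi> (h n *\<^sub>R ?e + x) - \<phi> x) / h n" for n x
  have "(\<lambda>n. \<integral>x. q n x \<partial>lborel) \<longlonglongrightarrow> (\<integral>x. \<psi> x \<partial>lborel)"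
  proof (rule integral_dominated_convergence[where w = "\<lambda>x. indicator K' x *\<^sub>R max C 0"])
    show "\<psi> \<in> borel_measurable lborel" by simp
    show "q n \<in> borel_measurable lborel" for n unfolding q_def[abs_def] by measurable
    show "integrable lborel (\<lambda>x. indicat_real K' x *\<^sub>R max C 0)"
      using K' by (intro borel_integrable_compact) auto
    show "AE x in lborel. (\<lambda>n. q n x) \<longlonglongrightarrow> \<psi> x"
    proof (rule AE_I2)
      fix x
      have "((\<lambda>s. (\<phi> (x + s *\<^sub>R ?e) - \<phi> x) / s) \<longlongrightarrow> \<psi> x) (at 0)"
        using der[of x 0] unfolding has_field_derivative_iff by simp
      moreover have "filterlim h (at 0) sequentially"
        unfolding filterlim_at using h0 h(1) by (auto simp: less_imp_neq[symmetric])
      ultimately have "(\<lambda>n. (\<phi> (x + h n *\<^sub>R ?e) - \<phi> x) / h n) \<longlonglongrightarrow> \<psi> x"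
        by (rule filterlim_compose)
      then show "(\<lambda>n. q n x) \<longlonglongrightarrow> \<psi> x" unfolding q_def by (simp add: add.commute)
    qed
    show "AE x in lborel. norm (q n x) \<le> indicat_real K' x *\<^sub>R max C 0" for n
    proof (rule AE_I2)
      fix x
      obtain z where z: "0 < z" "z < h n"
        and eq: "\<phi> (x + h n *\<^sub>R ?e) - \<phi> (x + 0 *\<^sub>R ?e) = (h n - 0) * \<psi> (x + z *\<^sub>R ?e)"
        using MVT2[OF h(1)[of n], of "\<lambda>t. \<phi> (x + t *\<^sub>R ?e)" "\<lambda>t. \<psi> (x + t *\<^sub>R ?e)"] der by blast
      have q: "q n x = \<psi> (x + z *\<^sub>R ?e)"
        unfolding q_def using eq h(1)[of n] by (simp add: add.commute)
      show "norm (q n x) \<le> indicat_real K' x *\<^sub>R max C 0"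
      proof (cases "x + z *\<^sub>R ?e \<in> K")
        case True
        then have "x \<in> K'" unfolding K'_def using z h(2)[of n]
          by (intro image_eqI[of _ _ "(x + z *\<^sub>R ?e, z)"]) auto
        then show ?thesis unfolding q using C by simp
      next
        case False
        then show ?thesis unfolding q using out(2) by (simp add: indicator_def)
      qed
    qed
  qed
  moreover have "(\<integral>x. q n x \<partial>lborel) = 0" for n
  proof -
    have tr: "distr lborel borel ((+) (h n *\<^sub>R ?e)) = lborel" by (rule lborel_distr_plus)
    have "(\<integral>x. \<phi> (h n *\<^sub>R ?e + x) \<partial>lborel) = (\<integral>x. \<phi> x \<partial>distr lborel borel ((+) (h n *\<^sub>R ?e)))"
      by (subst integral_distr) auto
    then have 1: "(\<integral>x. \<phi> (h n *\<^sub>R ?e + x) \<partial>lborel) = (\<integral>x. \<phi> x \<partial>lborel)" unfolding tr .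
    have "integrable (distr lborel borel ((+) (h n *\<^sub>R ?e))) \<phi>" unfolding tr by (rule int\<phi>)
    then have "integrable lborel (\<lambda>x. \<phi> (h n *\<^sub>R ?e + x))"
      by (subst (asm) integrable_distr_eq) auto
    then show ?thesis unfolding q_def using 1 int\<phi> by simp
  qed
  ultimately have "(\<integral>x. \<psi> x \<partial>lborel) = 0" by (simp add: LIMSEQ_const_iff)
  then show ?thesis unfolding fr .
qed

section \<open>Weak gradients and the Dirichlet form\<close>

lemma integrable_mult_compact_support:
  fixes f \<psi> :: "real^'n \<Rightarrow> real"
  assumes f: "f \<in> borel_measurable borel" "set_integrable lborel K f"
    and K: "compact K" and c: "continuous_on UNIV \<psi>" and out: "\<And>x. x \<notin> K \<Longrightarrow> \<psi> x = 0"
  shows "integrable lborel (\<lambda>x. f x * \<psi> x)"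
proof -
  have [measurable]: "\<psi> \<in> borel_measurable borel" "f \<in> borel_measurable borel"
    using c f by (auto intro: borel_measurable_continuous_onI)
  have "bounded (\<psi> ` K)"
    using K c by (intro compact_imp_bounded compact_continuous_image) (auto intro: continuous_on_subset)
  then obtain C where C: "\<And>y. y \<in> \<psi> ` K \<Longrightarrow> norm y \<le> C" unfolding bounded_iff by auto
  show ?thesis
  proof (rule Bochner_Integration.integrable_bound)
    show "integrable lborel (\<lambda>x. C * (indicator K x *\<^sub>R f x))"
      using f(2) unfolding set_integrable_def by (rule integrable_mult_right)
    show "(\<lambda>x. f x * \<psi> x) \<in> borel_measurable lborel" by measurable
    show "AE x in lborel. norm (f x * \<psi> x) \<le> norm (C * (indicator K x *\<^sub>R f x))"
    proof (rule AE_I2)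
      fix x
      show "norm (f x * \<psi> x) \<le> norm (C * (indicator K x *\<^sub>R f x))"
      proof (cases "x \<in> K")
        case True
        then have "\<bar>\<psi> x\<bar> \<le> \<bar>C\<bar>" using C[of "\<psi> x"] by auto
        then have "\<bar>f x\<bar> * \<bar>\<psi> x\<bar> \<le> \<bar>f x\<bar> * \<bar>C\<bar>" by (rule mult_left_mono) simp
        then show ?thesis using True by (simp add: abs_mult mult.commute)
      qed (simp add: out)
    qed
  qed
qed

lemma has_weak_gradient_linear:
  fixes f f' :: "real^'n \<Rightarrow> real"
  assumes "has_weak_gradient f g" "has_weak_gradient f' g'"
  shows "has_weak_gradient (\<lambda>x. f x + c * f' x) (\<lambda>x. g x + c *\<^sub>R g' x)"
proof -
  have [measurable]: "f \<in> borel_measurable borel" "f' \<in> borel_measurable borel"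
      "g \<in> borel_measurable borel" "g' \<in> borel_measurable borel"
    and si: "\<And>K. compact K \<Longrightarrow> set_integrable lborel K f" "\<And>K. compact K \<Longrightarrow> set_integrable lborel K f'"
      "\<And>K. compact K \<Longrightarrow> set_integrable lborel K g" "\<And>K. compact K \<Longrightarrow> set_integrable lborel K g'"
    and parts: "\<And>\<phi> i. test_function \<phi> \<Longrightarrow>
        (\<integral>x. f x * frechet_derivative \<phi> (at x) (axis i 1) \<partial>lborel) = - (\<integral>x. g x $ i * \<phi> x \<partial>lborel)"
      "\<And>\<phi> i. test_function \<phi> \<Longrightarrow>
        (\<integral>x. f' x * frechet_derivative \<phi> (at x) (axis i 1) \<partial>lborel) = - (\<integral>x. g' x $ i * \<phi> x \<partial>lborel)"
    using assms unfolding has_weak_gradient_def by auto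
  have "(\<integral>x. (f x + c * f' x) * frechet_derivative \<phi> (at x) (axis i 1) \<partial>lborel)
      = - (\<integral>x. (g x + c *\<^sub>R g' x) $ i * \<phi> x \<partial>lborel)" if t: "test_function \<phi>" for \<phi> i
  proof -
    from t obtain \<psi> K where K: "compact K" and c: "continuous_on UNIV \<phi>" "continuous_on UNIV \<psi>"
      and out: "\<And>x. x \<notin> K \<Longrightarrow> \<phi> x = 0" "\<And>x. x \<notin> K \<Longrightarrow> \<psi> x = 0"
      and fr: "\<And>x. frechet_derivative \<phi> (at x) (axis i 1) = \<psi> x"
      by (rule test_function_partial[of \<phi> i]) blast
    have comp: "set_integrable lborel K (\<lambda>x. g x $ i)" "set_integrable lborel K (\<lambda>x. g' x $ i)"
      using integrable_bounded_linear[OF bounded_linear_vec_nth[of i] si(3)[OF K, unfolded set_integrable_def]]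
        integrable_bounded_linear[OF bounded_linear_vec_nth[of i] si(4)[OF K, unfolded set_integrable_def]]
      unfolding set_integrable_def by simp_all
    have i: "integrable lborel (\<lambda>x. f x * \<psi> x)" "integrable lborel (\<lambda>x. f' x * \<psi> x)"
      "integrable lborel (\<lambda>x. g x $ i * \<phi> x)" "integrable lborel (\<lambda>x. g' x $ i * \<phi> x)"
      by (rule integrable_mult_compact_support[of _ K], simp, simp add: si K comp, rule K, simp add: c, simp add: out)+
    have "(\<integral>x. (f x + c * f' x) * \<psi> x \<partial>lborel) = (\<integral>x. f x * \<psi> x + c * (f' x * \<psi> x) \<partial>lborel)"
      by (intro Bochner_Integration.integral_cong) (auto simp: algebra_simps)
    also have "\<dots> = (\<integral>x. f x * \<psi> x \<partial>lborel) + c * (\<integral>x. f' x * \<psi> x \<partial>lborel)" using i by simp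
    also have "\<dots> = - ((\<integral>x. g x $ i * \<phi> x \<partial>lborel) + c * (\<integral>x. g' x $ i * \<phi> x \<partial>lborel))"
      using parts[OF t, of i] unfolding fr by simp
    also have "(\<integral>x. g x $ i * \<phi> x \<partial>lborel) + c * (\<integral>x. g' x $ i * \<phi> x \<partial>lborel)
        = (\<integral>x. g x $ i * \<phi> x + c * (g' x $ i * \<phi> x) \<partial>lborel)" using i by simp
    also have "\<dots> = (\<integral>x. (g x + c *\<^sub>R g' x) $ i * \<phi> x \<partial>lborel)"
      by (intro Bochner_Integration.integral_cong) (auto simp: algebra_simps)
    finally show ?thesis unfolding fr .
  qed
  moreover have "set_integrable lborel K (\<lambda>x. f x + c * f' x) \<and> set_integrable lborel K (\<lambda>x. g x + c *\<^sub>R g' x)"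
    if "compact K" for K
    using si[OF that] by (auto intro!: set_integral_add set_integrable_mult_right set_integrable_scaleR_right)
  ultimately show ?thesis unfolding has_weak_gradient_def by simp
qed

lemma has_weak_gradient_const: "has_weak_gradient (\<lambda>_. c) (\<lambda>_. 0 :: real^'n)"
proof -
  have "set_integrable lborel K (\<lambda>_. c)" if "compact K" for K :: "(real^'n) set"
    using that unfolding set_integrable_def by (intro borel_integrable_compact) auto
  then show ?thesis
    unfolding has_weak_gradient_def
    by (auto simp: integral_partial_derivative_zero set_integrable_def)
qed

text \<open>These functions vanish for Lebesgue measure but may be nonzero for \<open>\<mu>\<close>;
  they are the test functions that detect a singular part.\<close>

lemma has_weak_gradient_null_indicator:
  assumes A: "A \<in> null_sets (lborel :: (real^'n) measure)"
  shows "has_weak_gradient (indicator A) (\<lambda>_. 0 :: real^'n)"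
proof -
  have [measurable]: "A \<in> sets borel" using A by auto
  have ae: "AE x in lborel. indicator A x = (0::real)"
    using AE_not_in[OF A] by eventually_elim simp
  have "integrable lborel (\<lambda>x. indicator K x *\<^sub>R indicator A x :: real)" if "compact K" for K
  proof -
    have [measurable]: "K \<in> sets borel" using that by (simp add: compact_imp_closed)
    have "integrable lborel (\<lambda>x. indicator K x *\<^sub>R indicator A x :: real) \<longleftrightarrow> integrable lborel (\<lambda>x::real^'n. 0 :: real)"
      using ae by (intro integrable_cong_AE) (measurable, auto)
    then show ?thesis by simp
  qed
  moreover have "(\<integral>x. indicator A x * frechet_derivative \<phi> (at x) (axis i 1) \<partial>lborel) = 0" for \<phi> :: "real^'n \<Rightarrow> real" and i
    by (rule integral_eq_zero_AE) (use ae in \<open>eventually_elim, simp\<close>)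
  ultimately show ?thesis
    unfolding has_weak_gradient_def set_integrable_def by simp
qed

lemma weak_gradient_of_linear:
  assumes "weak_gradient_of \<mu> f g" "weak_gradient_of \<mu> f' g'"
  shows "weak_gradient_of \<mu> (\<lambda>x. f x + c * f' x) (\<lambda>x. g x + c *\<^sub>R g' x)"
proof -
  obtain a b where ab: "has_weak_gradient a b" "AE x in \<mu>. f x = a x \<and> g x = b x"
    using assms(1) unfolding weak_gradient_of_def by auto
  obtain a' b' where ab': "has_weak_gradient a' b'" "AE x in \<mu>. f' x = a' x \<and> g' x = b' x"
    using assms(2) unfolding weak_gradient_of_def by auto
  have "AE x in \<mu>. f x + c * f' x = a x + c * a' x \<and> g x + c *\<^sub>R g' x = b x + c *\<^sub>R b' x"
    using ab(2) ab'(2) by eventually_elim simp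
  moreover have "f \<in> borel_measurable borel" "f' \<in> borel_measurable borel"
      "g \<in> borel_measurable borel" "g' \<in> borel_measurable borel"
    using assms unfolding weak_gradient_of_def by auto
  ultimately show ?thesis
    using has_weak_gradient_linear[OF ab(1) ab'(1), of c] unfolding weak_gradient_of_def by auto
qed

lemma weak_gradient_of_cong:
  assumes "weak_gradient_of \<mu> f g" "AE x in \<mu>. f x = f' x" "f' \<in> borel_measurable borel"
  shows "weak_gradient_of \<mu> f' g"
proof -
  obtain a b where ab: "has_weak_gradient a b" "AE x in \<mu>. f x = a x \<and> g x = b x"
    using assms(1) unfolding weak_gradient_of_def by auto
  have "AE x in \<mu>. f' x = a x \<and> g x = b x" using ab(2) assms(2) by eventually_elim simp
  then show ?thesis using assms ab(1) unfolding weak_gradient_of_def by auto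
qed

lemma weak_gradient_of_has: "has_weak_gradient f g \<Longrightarrow> weak_gradient_of \<mu> f g"
  unfolding weak_gradient_of_def has_weak_gradient_def by auto

lemma weak_gradient_of_wgrad: "weak_gradient_of \<mu> f g \<Longrightarrow> weak_gradient_of \<mu> f (wgrad \<mu> f)"
  unfolding wgrad_def by (rule someI[of "weak_gradient_of \<mu> f"])

lemma weak_gradient_of_measurable:
  "weak_gradient_of \<mu> f g \<Longrightarrow> f \<in> borel_measurable borel"
  "weak_gradient_of \<mu> f g \<Longrightarrow> g \<in> borel_measurable borel"
  unfolding weak_gradient_of_def by auto

text \<open>\<open>well_defined\<close> is the first half of \<open>H1_hilbert\<close>: the choice
  made by \<open>wgrad\<close> matters only up to fields of zero energy.\<close>

locale energy_space = prob_space \<mu> for \<mu> :: "(real^'n) measure" +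
  fixes W :: "real^'n \<Rightarrow> real^'n^'n"
  assumes sets_mu: "sets \<mu> = sets borel"
    and W: "psd_field W"
    and well_defined: "weak_gradient_of \<mu> f g \<Longrightarrow> weak_gradient_of \<mu> f h \<Longrightarrow>
      AE x in \<mu>. (g x - h x) \<bullet> (W x *v (g x - h x)) = 0"
begin

lemma space_mu: "space \<mu> = UNIV"
  using sets_eq_imp_space_eq[OF sets_mu] by simp

lemma measurable_mu: "borel_measurable \<mu> = (borel_measurable borel :: (real^'n \<Rightarrow> 'b::topological_space) set)"
  by (rule measurable_cong_sets[OF sets_mu refl])

lemma W_psd: "psd (W x)" and W_measurable [measurable]: "W \<in> borel_measurable borel"
  using W unfolding psd_field_def by auto

lemma L2_product:
  assumes "f \<in> L2 \<mu>" "g \<in> L2 \<mu>"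
  shows "integrable \<mu> (\<lambda>x. f x * g x)"
proof (rule Bochner_Integration.integrable_bound)
  have m [measurable]: "f \<in> borel_measurable borel" "g \<in> borel_measurable borel"
    using assms unfolding L2_def by auto
  show "integrable \<mu> (\<lambda>x. (f x)\<^sup>2 + (g x)\<^sup>2)" using assms unfolding L2_def by simp
  show "(\<lambda>x. f x * g x) \<in> borel_measurable \<mu>" unfolding measurable_mu by measurable
  show "AE x in \<mu>. norm (f x * g x) \<le> norm ((f x)\<^sup>2 + (g x)\<^sup>2)"
  proof (rule AE_I2)
    fix x
    have "0 \<le> (\<bar>f x\<bar> - \<bar>g x\<bar>)\<^sup>2" by simp
    then have "2 * (\<bar>f x\<bar> * \<bar>g x\<bar>) \<le> (f x)\<^sup>2 + (g x)\<^sup>2" by (simp add: power2_diff)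
    moreover have "0 \<le> \<bar>f x\<bar> * \<bar>g x\<bar>" by simp
    ultimately have "\<bar>f x\<bar> * \<bar>g x\<bar> \<le> (f x)\<^sup>2 + (g x)\<^sup>2" by linarith
    then show "norm (f x * g x) \<le> norm ((f x)\<^sup>2 + (g x)\<^sup>2)" by (simp add: abs_mult)
  qed
qed

lemma L2_linear:
  assumes "f \<in> L2 \<mu>" "g \<in> L2 \<mu>"
  shows "(\<lambda>x. f x + c * g x) \<in> L2 \<mu>"
proof -
  have "integrable \<mu> (\<lambda>x. (f x)\<^sup>2 + 2 * c * (f x * g x) + c\<^sup>2 * (g x)\<^sup>2)"
    using assms L2_product[OF assms] unfolding L2_def by simp
  moreover have "(\<lambda>x. (f x)\<^sup>2 + 2 * c * (f x * g x) + c\<^sup>2 * (g x)\<^sup>2) = (\<lambda>x. (f x + c * g x)\<^sup>2)"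
    by (simp add: fun_eq_iff power2_eq_square algebra_simps)
  ultimately show ?thesis using assms unfolding L2_def by auto
qed

lemma L2_bounded:
  assumes "f \<in> borel_measurable borel" "\<And>x. \<bar>f x\<bar> \<le> C"
  shows "f \<in> L2 \<mu>"
proof -
  have [measurable]: "f \<in> borel_measurable borel" by fact
  have "(\<lambda>x. (f x)\<^sup>2) \<in> borel_measurable \<mu>" unfolding measurable_mu by measurable
  moreover have "norm ((f x)\<^sup>2) \<le> C\<^sup>2" for x using assms(2)[of x] by (simp add: abs_le_square_iff[symmetric])
  ultimately have "integrable \<mu> (\<lambda>x. (f x)\<^sup>2)" by (intro integrable_const_bound[of _ "C\<^sup>2"]) auto
  then show ?thesis using assms unfolding L2_def by auto
qed

lemma L2_integrable: "f \<in> L2 \<mu> \<Longrightarrow> integrable \<mu> f"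
  using L2_product[of f "\<lambda>_. 1"] L2_bounded[of "\<lambda>_. 1" 1] by simp

lemma L2_subspace: "subspace (L2 \<mu>)"
proof (rule subspaceI)
  show z: "0 \<in> L2 \<mu>" unfolding zero_fun_def by (rule L2_bounded[of _ 0]) auto
  show "f + g \<in> L2 \<mu>" if "f \<in> L2 \<mu>" "g \<in> L2 \<mu>" for f g
    using L2_linear[OF that, of 1] by (simp add: plus_fun_def)
  show "c *\<^sub>R f \<in> L2 \<mu>" if "f \<in> L2 \<mu>" for f c
    using L2_linear[OF z that, of c] by (simp add: scaleR_fun_def)
qed

lemma L2_psd_form: "psd_form (L2 \<mu>) (L2_inner \<mu>)"
proof
  show "subspace (L2 \<mu>)" by (rule L2_subspace)
  show "L2_inner \<mu> f g = L2_inner \<mu> g f" for f g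
    unfolding L2_inner_def by (simp add: mult.commute)
  show "L2_inner \<mu> (f + g) h = L2_inner \<mu> f h + L2_inner \<mu> g h"
    if "f \<in> L2 \<mu>" "g \<in> L2 \<mu>" "h \<in> L2 \<mu>" for f g h
    using that unfolding L2_inner_def by (simp add: distrib_right L2_product)
  show "L2_inner \<mu> (c *\<^sub>R f) h = c * L2_inner \<mu> f h" for c f h
    unfolding L2_inner_def by (simp add: mult.assoc)
  show "0 \<le> L2_inner \<mu> f f" for f
    unfolding L2_inner_def by simp
qed

lemma L2_inner_quad: "L2_inner \<mu> f f = (\<integral>x. (f x)\<^sup>2 \<partial>\<mu>)"
  unfolding L2_inner_def power2_eq_square ..

lemma L2_null_iff:
  assumes "f \<in> L2 \<mu>"
  shows "L2_inner \<mu> f f = 0 \<longleftrightarrow> null_fun \<mu> f"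
  unfolding L2_inner_quad null_fun_def
  using assms integral_nonneg_eq_0_iff_AE[of \<mu> "\<lambda>x. (f x)\<^sup>2"] unfolding L2_def by simp

lemma L2_null_pos: "f \<in> L2 \<mu> \<Longrightarrow> \<not> null_fun \<mu> f \<longleftrightarrow> L2_inner \<mu> f f > 0"
  using L2_null_iff[of f] psd_form.nonneg[OF L2_psd_form, of f] by linarith

section \<open>Dominated fields and independence of the choice of weak gradient\<close>

definition dominated_field :: "real \<Rightarrow> (real^'n \<Rightarrow> real^'n^'n) \<Rightarrow> bool" where
  "dominated_field c D \<longleftrightarrow> D \<in> borel_measurable borel \<and> (\<forall>x. form_dominated c (D x) (W x))"

lemma dominated_field_W: "dominated_field 1 W"
  unfolding dominated_field_def using W_psd form_dominated_self by auto

text \<open>Two weak gradients of \<open>f\<close> differ by a field of zero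
  \<open>W\<close>-energy, which every matrix dominated by \<open>W x\<close> sends to 0.\<close>

lemma dominated_wgrad:
  assumes D: "dominated_field c D" and g: "weak_gradient_of \<mu> f g"
  shows "AE x in \<mu>. D x *v wgrad \<mu> f x = D x *v g x"
  using well_defined[OF weak_gradient_of_wgrad[OF g] g]
proof eventually_elim
  case (elim x)
  have "D x *v (wgrad \<mu> f x - g x) = 0"
    using D W_psd elim unfolding dominated_field_def by (intro form_dominated_null[of c _ "W x"]) auto
  then show ?case by (simp add: matrix_vector_mult_diff_distrib)
qed

lemma dominated_integrable:
  assumes D: "dominated_field c D"
    and m: "g \<in> borel_measurable borel" "h \<in> borel_measurable borel"
    and i: "integrable \<mu> (\<lambda>x. g x \<bullet> (W x *v g x))" "integrable \<mu> (\<lambda>x. h x \<bullet> (W x *v h x))"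
  shows "integrable \<mu> (\<lambda>x. g x \<bullet> (D x *v h x))"
proof (rule Bochner_Integration.integrable_bound)
  show "integrable \<mu> (\<lambda>x. c / 2 * (g x \<bullet> (W x *v g x) + h x \<bullet> (W x *v h x)))" using i by simp
  have [measurable]: "D \<in> borel_measurable borel" "g \<in> borel_measurable borel" "h \<in> borel_measurable borel"
    using D m unfolding dominated_field_def by auto
  show "(\<lambda>x. g x \<bullet> (D x *v h x)) \<in> borel_measurable \<mu>" unfolding measurable_mu by measurable
  show "AE x in \<mu>. norm (g x \<bullet> (D x *v h x)) \<le> norm (c / 2 * (g x \<bullet> (W x *v g x) + h x \<bullet> (W x *v h x)))"
  proof (rule AE_I2)
    fix x
    have "form_dominated c (D x) (W x)" using D unfolding dominated_field_def by simp
    from form_dominated_cross[OF this W_psd, of "g x" "h x"]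
    show "norm (g x \<bullet> (D x *v h x)) \<le> norm (c / 2 * (g x \<bullet> (W x *v g x) + h x \<bullet> (W x *v h x)))"
      unfolding real_norm_def by linarith
  qed
qed

text \<open>Only the image of a gradient under \<open>D x\<close> is determined, so symmetry of
  \<open>D x\<close> moves it to the other factor before the second gradient is replaced.\<close>

lemma sym_AE_swap:
  assumes D: "dominated_field c D" and g: "weak_gradient_of \<mu> f g" and h: "weak_gradient_of \<mu> f' h"
  shows "AE x in \<mu>. wgrad \<mu> f x \<bullet> (D x *v wgrad \<mu> f' x) = g x \<bullet> (D x *v h x)"
  using dominated_wgrad[OF D g] dominated_wgrad[OF D h]
proof eventually_elim
  case (elim x)
  have "transpose (D x) = D x" using D unfolding dominated_field_def form_dominated_def by simp
  from sym_inner[OF this] elim show ?case by metis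
qed

text \<open>Allows any convenient pair of weak gradients, such as linear combinations, in place of
  the chosen ones; linearity of the form rests on this.\<close>

lemma dirichlet_eq:
  assumes D: "dominated_field c D" and g: "weak_gradient_of \<mu> f g" and h: "weak_gradient_of \<mu> f' h"
  shows "dirichlet \<mu> D f f' = (\<integral>x. g x \<bullet> (D x *v h x) \<partial>\<mu>)"
proof -
  note m = weak_gradient_of_measurable(2)
  have [measurable]: "D \<in> borel_measurable borel" "g \<in> borel_measurable borel" "h \<in> borel_measurable borel"
      "wgrad \<mu> f \<in> borel_measurable borel" "wgrad \<mu> f' \<in> borel_measurable borel"
    using D m[OF g] m[OF h] m[OF weak_gradient_of_wgrad[OF g]] m[OF weak_gradient_of_wgrad[OF h]]
    unfolding dominated_field_def by auto
  show ?thesis unfolding dirichlet_def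
    by (rule integral_cong_AE[OF _ _ sym_AE_swap[OF D g h]]) (unfold measurable_mu, measurable)
qed

lemma H1D:
  assumes "f \<in> H1 \<mu> W"
  shows "f \<in> L2 \<mu>" "weak_gradient_of \<mu> f (wgrad \<mu> f)" "wgrad \<mu> f \<in> borel_measurable borel"
    "integrable \<mu> (\<lambda>x. wgrad \<mu> f x \<bullet> (W x *v wgrad \<mu> f x))"
proof -
  show "f \<in> L2 \<mu>" "integrable \<mu> (\<lambda>x. wgrad \<mu> f x \<bullet> (W x *v wgrad \<mu> f x))"
    using assms unfolding H1_def by auto
  show g: "weak_gradient_of \<mu> f (wgrad \<mu> f)"
    using assms weak_gradient_of_wgrad unfolding H1_def weakly_differentiable_def by auto
  show "wgrad \<mu> f \<in> borel_measurable borel" by (rule weak_gradient_of_measurable(2)[OF g])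
qed

lemma H1I:
  assumes f: "f \<in> L2 \<mu>" and g: "weak_gradient_of \<mu> f g" and i: "integrable \<mu> (\<lambda>x. g x \<bullet> (W x *v g x))"
  shows "f \<in> H1 \<mu> W"
proof -
  note m = weak_gradient_of_measurable(2)
  have [measurable]: "g \<in> borel_measurable borel" "wgrad \<mu> f \<in> borel_measurable borel"
    using m[OF g] m[OF weak_gradient_of_wgrad[OF g]] by auto
  have "integrable \<mu> (\<lambda>x. wgrad \<mu> f x \<bullet> (W x *v wgrad \<mu> f x)) = integrable \<mu> (\<lambda>x. g x \<bullet> (W x *v g x))"
    by (rule integrable_cong_AE[OF _ _ sym_AE_swap[OF dominated_field_W g g]]) (unfold measurable_mu, measurable)
  then show ?thesis using f g i unfolding H1_def weakly_differentiable_def by auto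
qed

lemma H1_linear:
  assumes f: "f \<in> H1 \<mu> W" and h: "h \<in> H1 \<mu> W"
  shows "(\<lambda>x. f x + c * h x) \<in> H1 \<mu> W"
proof -
  let ?g = "wgrad \<mu> f" and ?k = "wgrad \<mu> h"
  have s: "?k x \<bullet> (W x *v ?g x) = ?g x \<bullet> (W x *v ?k x)" for x
    by (rule sym_inner[OF psdD(1)[OF W_psd]])
  have "integrable \<mu> (\<lambda>x. ?g x \<bullet> (W x *v ?k x))"
    by (rule dominated_integrable[OF dominated_field_W H1D(3)[OF f] H1D(3)[OF h] H1D(4)[OF f] H1D(4)[OF h]])
  then have "integrable \<mu> (\<lambda>x. ?g x \<bullet> (W x *v ?g x) + 2 * c * (?g x \<bullet> (W x *v ?k x)) + c\<^sup>2 * (?k x \<bullet> (W x *v ?k x)))"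
    using H1D(4)[OF f] H1D(4)[OF h] by simp
  moreover have "?g x \<bullet> (W x *v ?g x) + 2 * c * (?g x \<bullet> (W x *v ?k x)) + c\<^sup>2 * (?k x \<bullet> (W x *v ?k x))
      = (?g x + c *\<^sub>R ?k x) \<bullet> (W x *v (?g x + c *\<^sub>R ?k x))" for x
    using s[of x] by (simp add: matrix_vector_right_distrib matrix_vector_mult_scaleR inner_add_left inner_add_right
        power2_eq_square algebra_simps)
  ultimately have "integrable \<mu> (\<lambda>x. (?g x + c *\<^sub>R ?k x) \<bullet> (W x *v (?g x + c *\<^sub>R ?k x)))"
    by (simp only:)
  then show ?thesis
    by (rule H1I[OF L2_linear[OF H1D(1)[OF f] H1D(1)[OF h]] weak_gradient_of_linear[OF H1D(2)[OF f] H1D(2)[OF h]]])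
qed

text \<open>\<open>weak_gradient_of\<close> permits a change of representative, so 0 is a weak
  gradient even if \<open>f\<close> itself is not locally integrable.\<close>

lemma H1_null:
  assumes f: "f \<in> borel_measurable borel" "AE x in \<mu>. f x = 0"
  shows "f \<in> H1 \<mu> W" "weak_gradient_of \<mu> f (\<lambda>_. 0)"
proof -
  have [measurable]: "f \<in> borel_measurable borel" by fact
  have ae: "AE x in \<mu>. 0 = f x" using f(2) by eventually_elim simp
  show g: "weak_gradient_of \<mu> f (\<lambda>_. 0)"
    by (rule weak_gradient_of_cong[OF weak_gradient_of_has[OF has_weak_gradient_const[of 0]] ae f(1)])
  have "integrable \<mu> (\<lambda>x. (f x)\<^sup>2) = integrable \<mu> (\<lambda>x. 0 :: real)"
  proof (rule integrable_cong_AE)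
    show "(\<lambda>x. (f x)\<^sup>2) \<in> borel_measurable \<mu>" unfolding measurable_mu by measurable
    show "AE x in \<mu>. (f x)\<^sup>2 = 0" using f(2) by eventually_elim simp
  qed simp
  then have "f \<in> L2 \<mu>" using f(1) unfolding L2_def by simp
  then show "f \<in> H1 \<mu> W" by (rule H1I[OF _ g]) simp
qed

lemma H1_subspace: "subspace (H1 \<mu> W)"
proof (rule subspaceI)
  show z: "0 \<in> H1 \<mu> W" unfolding zero_fun_def by (rule H1_null(1)) auto
  show "f + g \<in> H1 \<mu> W" if "f \<in> H1 \<mu> W" "g \<in> H1 \<mu> W" for f g
    using H1_linear[OF that, of 1] by (simp add: plus_fun_def)
  show "c *\<^sub>R f \<in> H1 \<mu> W" if "f \<in> H1 \<mu> W" for f c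
    using H1_linear[OF z that, of c] by (simp add: scaleR_fun_def)
qed

lemma dirichlet_sym_form:
  assumes D: "dominated_field c D"
  shows "sym_form (H1 \<mu> W) (dirichlet \<mu> D)"
proof
  have s: "transpose (D x) = D x" for x using D unfolding dominated_field_def form_dominated_def by simp
  note int = dominated_integrable[OF D H1D(3) H1D(3) H1D(4) H1D(4)]
  show "subspace (H1 \<mu> W)" by (rule H1_subspace)
  show "dirichlet \<mu> D f g = dirichlet \<mu> D g f" for f g
    unfolding dirichlet_def by (rule Bochner_Integration.integral_cong[OF refl]) (rule sym_inner[OF s])
  show "dirichlet \<mu> D (f + g) h = dirichlet \<mu> D f h + dirichlet \<mu> D g h"
    if f: "f \<in> H1 \<mu> W" and g: "g \<in> H1 \<mu> W" and h: "h \<in> H1 \<mu> W" for f g h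
  proof -
    have "dirichlet \<mu> D (f + g) h = (\<integral>x. (wgrad \<mu> f x + 1 *\<^sub>R wgrad \<mu> g x) \<bullet> (D x *v wgrad \<mu> h x) \<partial>\<mu>)"
      using weak_gradient_of_linear[OF H1D(2)[OF f] H1D(2)[OF g], of 1]
      by (intro dirichlet_eq[OF D _ H1D(2)[OF h]]) (simp add: plus_fun_def)
    also have "\<dots> = dirichlet \<mu> D f h + dirichlet \<mu> D g h"
      using int[OF f h f h] int[OF g h g h] unfolding dirichlet_def by (simp add: inner_add_left)
    finally show ?thesis .
  qed
  show "dirichlet \<mu> D (c *\<^sub>R f) h = c * dirichlet \<mu> D f h"
    if f: "f \<in> H1 \<mu> W" and h: "h \<in> H1 \<mu> W" for f h c
  proof -
    have "dirichlet \<mu> D (c *\<^sub>R f) h = (\<integral>x. (0 + c *\<^sub>R wgrad \<mu> f x) \<bullet> (D x *v wgrad \<mu> h x) \<partial>\<mu>)"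
      using weak_gradient_of_linear[OF weak_gradient_of_has[OF has_weak_gradient_const[of 0]] H1D(2)[OF f], of c]
      by (intro dirichlet_eq[OF D _ H1D(2)[OF h]]) (simp add: scaleR_fun_def)
    then show ?thesis unfolding dirichlet_def by simp
  qed
qed

lemma dirichlet_psd_form: "psd_form (H1 \<mu> W) (dirichlet \<mu> W)"
  using dirichlet_sym_form[OF dominated_field_W] psdD(2)[OF W_psd]
  by (auto intro!: psd_form.intro psd_form_axioms.intro simp: dirichlet_def)

lemma dirichlet_dominated:
  assumes D: "dominated_field c D" and f: "f \<in> H1 \<mu> W"
  shows "\<bar>dirichlet \<mu> D f f\<bar> \<le> c * dirichlet \<mu> W f f"
proof -
  have i: "integrable \<mu> (\<lambda>x. wgrad \<mu> f x \<bullet> (D x *v wgrad \<mu> f x))"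
    by (rule dominated_integrable[OF D H1D(3)[OF f] H1D(3)[OF f] H1D(4)[OF f] H1D(4)[OF f]])
  have "\<bar>dirichlet \<mu> D f f\<bar> \<le> (\<integral>x. \<bar>wgrad \<mu> f x \<bullet> (D x *v wgrad \<mu> f x)\<bar> \<partial>\<mu>)"
    unfolding dirichlet_def by (rule integral_abs_bound)
  also have "\<dots> \<le> (\<integral>x. c * (wgrad \<mu> f x \<bullet> (W x *v wgrad \<mu> f x)) \<partial>\<mu>)"
    using i H1D(4)[OF f] D unfolding dominated_field_def form_dominated_def
    by (intro integral_mono integrable_abs) auto
  finally show ?thesis unfolding dirichlet_def by simp
qed

lemma dirichlet_null:
  assumes "f \<in> H1 \<mu> W" "L2_inner \<mu> f f = 0"
  shows "dirichlet \<mu> W f f = 0"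
proof -
  have f: "f \<in> borel_measurable borel" "AE x in \<mu>. f x = 0"
    using assms L2_null_iff H1D(1)[OF assms(1)] unfolding null_fun_def L2_def by auto
  show ?thesis using dirichlet_eq[OF dominated_field_W H1_null(2)[OF f] H1_null(2)[OF f]] by simp
qed

lemma one_H1: "(\<lambda>_. 1) \<in> H1 \<mu> W" and one_dirichlet: "dirichlet \<mu> W (\<lambda>_. 1) (\<lambda>_. 1) = 0"
proof -
  have g: "weak_gradient_of \<mu> (\<lambda>_. 1) (\<lambda>_. 0)"
    by (rule weak_gradient_of_has[OF has_weak_gradient_const])
  show "(\<lambda>_. 1) \<in> H1 \<mu> W" by (rule H1I[OF _ g]) (auto intro: L2_bounded[of _ 1])
  show "dirichlet \<mu> W (\<lambda>_. 1) (\<lambda>_. 1) = 0" using dirichlet_eq[OF dominated_field_W g g] by simp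
qed

end

section \<open>Absolute continuity and the Poincare constant\<close>

text \<open>In a separable metric space an atom sits at a point. By Lindelof some point has only
  balls that meet \<open>A\<close> in a nonnull set; indivisibility makes the part of
  \<open>A\<close> outside each ball null, and countably many radii shrinking to 0 leave only the
  point.\<close>

lemma unsplittable_measure_point:
  fixes M :: "'a::{metric_space, second_countable_topology} measure"
  assumes M: "sets M = sets borel" and A: "A \<in> sets borel" "A \<notin> null_sets M"
    and split: "\<And>B. B \<in> sets borel \<Longrightarrow> B \<subseteq> A \<Longrightarrow> B \<in> null_sets M \<or> A - B \<in> null_sets M"
  shows "\<exists>x. A - {x} \<in> null_sets M"
proof -
  have AM: "A \<in> sets M" using A M by simp
  have "\<exists>x. \<forall>r>0. A \<inter> ball x r \<notin> null_sets M"
  proof (rule ccontr)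
    assume "\<not> ?thesis"
    then have "\<forall>x. \<exists>r. r > 0 \<and> A \<inter> ball x r \<in> null_sets M" by auto
    then obtain r where r: "\<And>x. r x > 0" "\<And>x. A \<inter> ball x (r x) \<in> null_sets M" by metis
    obtain F where F: "F \<subseteq> range (\<lambda>x. ball x (r x))" "countable F" "\<Union>F = \<Union>(range (\<lambda>x. ball x (r x)))"
      by (rule Lindelof_openin[of "range (\<lambda>x. ball x (r x))" UNIV]) auto
    have "y \<in> \<Union>F" for y unfolding F(3) using r(1)[of y] by (intro UN_I[of y]) auto
    then have "(\<Union>B\<in>F. A \<inter> B) = A" by blast
    moreover have "(\<Union>B\<in>F. A \<inter> B) \<in> null_sets M" using F r by (intro null_sets_UN') auto
    ultimately show False using A by simp
  qed
  then obtain x where x: "\<And>r. r > 0 \<Longrightarrow> A \<inter> ball x r \<notin> null_sets M" by auto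
  have "(\<Union>n::nat. A - A \<inter> ball x (1 / (real n + 1))) \<in> null_sets M"
  proof (rule null_sets_UN)
    fix n :: nat
    have "A \<inter> ball x (1 / (real n + 1)) \<notin> null_sets M" by (rule x) simp
    then show "A - A \<inter> ball x (1 / (real n + 1)) \<in> null_sets M"
      using split[of "A \<inter> ball x (1 / (real n + 1))"] A by auto
  qed
  moreover have "(\<Union>n::nat. A - A \<inter> ball x (1 / (real n + 1))) = A - {x}"
  proof -
    have "\<exists>n::nat. 1 / (real n + 1) \<le> dist x y" if "y \<noteq> x" for y
    proof -
      have "dist x y > 0" using that by simp
      then obtain n :: nat where "inverse (real (Suc n)) < dist x y" using reals_Archimedean by blast
      then show ?thesis by (intro exI[of _ n]) (simp add: inverse_eq_divide add.commute)
    qed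
    note small = this
    have "A - {x} \<subseteq> (\<Union>n::nat. A - A \<inter> ball x (1 / (real n + 1)))"
    proof
      fix y assume y: "y \<in> A - {x}"
      obtain n :: nat where "1 / (real n + 1) \<le> dist x y" using small[of y] y by auto
      then show "y \<in> (\<Union>n::nat. A - A \<inter> ball x (1 / (real n + 1)))" using y by (intro UN_I[of n]) auto
    qed
    moreover have "(\<Union>n::nat. A - A \<inter> ball x (1 / (real n + 1))) \<subseteq> A - {x}" by auto
    ultimately show ?thesis by (rule equalityI[rotated])
  qed
  ultimately show ?thesis by auto
qed

lemma one_divide_antimono_ennreal:
  fixes a b :: ennreal
  assumes "a \<le> b"
  shows "1 / b \<le> 1 / a"
proof -
  consider "a = 0" | "b = top" | "a \<noteq> 0" "b < top" using top.not_eq_extremum by blast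
  then show ?thesis
  proof cases
    case 3
    then obtain s where b: "b = ennreal s" "s \<ge> 0" by (cases b) auto
    have "a < top" by (rule le_less_trans[OF assms 3(2)])
    then obtain r where a: "a = ennreal r" "r \<ge> 0" by (cases a) auto
    have "r > 0" using 3(1) a by (cases "r = 0") auto
    moreover have "r \<le> s" using assms unfolding a b using b by (simp add: ennreal_le_iff)
    ultimately show ?thesis
      unfolding a b using divide_ennreal[of 1 r] divide_ennreal[of 1 s]
      by (simp add: ennreal_leI frac_le)
  qed auto
qed

lemma poincare_const_lower:
  assumes l: "l > 0" and gap: "\<And>f. f \<in> H1 \<mu> W \<Longrightarrow> l * prob_space.variance \<mu> f \<le> dirichlet \<mu> W f f"
  shows "ennreal l \<le> 1 / poincare_const \<mu> W"
proof -
  have "ennreal (prob_space.variance \<mu> f) \<le> ennreal (1 / l) * ennreal (dirichlet \<mu> W f f)" if "f \<in> H1 \<mu> W" for f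
  proof -
    have "prob_space.variance \<mu> f \<le> (1 / l) * dirichlet \<mu> W f f"
      using gap[OF that] l by (simp add: field_simps)
    then have "ennreal (prob_space.variance \<mu> f) \<le> ennreal ((1 / l) * dirichlet \<mu> W f f)" by (rule ennreal_leI)
    moreover have "ennreal ((1 / l) * dirichlet \<mu> W f f) = ennreal (1 / l) * ennreal (dirichlet \<mu> W f f)"
      using l by (intro ennreal_mult') simp
    ultimately show ?thesis by (simp only:)
  qed
  then have "poincare_const \<mu> W \<le> ennreal (1 / l)"
    unfolding poincare_const_def by (intro Inf_lower) simp
  then have "1 / ennreal (1 / l) \<le> 1 / poincare_const \<mu> W"
    by (rule one_divide_antimono_ennreal)
  moreover have "1 / ennreal (1 / l) = ennreal l"
    using l divide_ennreal[of 1 "1 / l"] by simp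
  ultimately show ?thesis by simp
qed

lemma poincare_const_upper:
  assumes f: "f \<in> H1 \<mu> W" and v: "prob_space.variance \<mu> f = v" "v > 0" and nn: "dirichlet \<mu> W f f \<ge> 0"
  shows "1 / poincare_const \<mu> W \<le> ennreal (dirichlet \<mu> W f f / v)"
proof (cases "dirichlet \<mu> W f f = 0")
  case True
  \<comment> \<open>A function of positive variance and zero energy rules out every
    \<open>C\<close>, including infinity, because infinity times 0 is 0 in \<open>ennreal\<close>;
    the infimum of the empty set is then infinity and its reciprocal 0.\<close>
  have "\<not> ennreal (prob_space.variance \<mu> f) \<le> C * ennreal (dirichlet \<mu> W f f)" for C
    unfolding v(1) True using v(2) by simp
  then have "{C. \<forall>f\<in>H1 \<mu> W. ennreal (prob_space.variance \<mu> f) \<le> C * ennreal (dirichlet \<mu> W f f)} = {}"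
    using f by blast
  then have "poincare_const \<mu> W = top" unfolding poincare_const_def by (simp only: Inf_empty)
  then show ?thesis by simp
next
  case False
  then have E: "dirichlet \<mu> W f f > 0" using nn by simp
  have "ennreal (v / dirichlet \<mu> W f f) \<le> poincare_const \<mu> W"
    unfolding poincare_const_def
  proof (rule Inf_greatest)
    fix C assume "C \<in> {C. \<forall>f\<in>H1 \<mu> W. ennreal (prob_space.variance \<mu> f) \<le> C * ennreal (dirichlet \<mu> W f f)}"
    then have "ennreal v \<le> C * ennreal (dirichlet \<mu> W f f)" using f v(1) by blast
    then have "ennreal v / ennreal (dirichlet \<mu> W f f) \<le> C"
      using E by (intro divide_le_posI_ennreal) (auto simp: mult.commute)
    then show "ennreal (v / dirichlet \<mu> W f f) \<le> C" using E v(2) by (simp add: divide_ennreal)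
  qed
  then have "1 / poincare_const \<mu> W \<le> 1 / ennreal (v / dirichlet \<mu> W f f)"
    by (rule one_divide_antimono_ennreal)
  also have "\<dots> = ennreal (dirichlet \<mu> W f f / v)"
    using E v(2) divide_ennreal[of 1 "v / dirichlet \<mu> W f f"] by simp
  finally show ?thesis .
qed

context energy_space
begin

lemma variance_L2:
  assumes "f \<in> L2 \<mu>"
  shows "variance f = L2_inner \<mu> f f - (L2_inner \<mu> f (\<lambda>_. 1))\<^sup>2"
  using variance_eq[OF L2_integrable[OF assms]] assms unfolding L2_inner_quad
  by (simp add: L2_def L2_inner_def)

text \<open>Reduces variances to squared norms of mean-zero functions; subtracting a constant adds
  nothing to the gradient, so the dominated forms keep their values.\<close>

lemma variance_centered:
  assumes "f \<in> H1 \<mu> W"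
  defines "h \<equiv> f - L2_inner \<mu> f (\<lambda>_. 1) *\<^sub>R (\<lambda>_. 1)"
  shows "h \<in> H1 \<mu> W" "L2_inner \<mu> h (\<lambda>_. 1) = 0" "L2_inner \<mu> h h = variance f"
    "dominated_field c D \<Longrightarrow> dirichlet \<mu> D h h = dirichlet \<mu> D f f"
proof -
  interpret ip: psd_form "L2 \<mu>" "L2_inner \<mu>" by (rule L2_psd_form)
  interpret en: psd_form "H1 \<mu> W" "dirichlet \<mu> W" by (rule dirichlet_psd_form)
  have fL: "f \<in> L2 \<mu>" using assms(1) H1D(1) by auto
  have oneL: "(\<lambda>_. 1) \<in> L2 \<mu>" using one_H1 H1D(1) by auto
  have one1: "L2_inner \<mu> (\<lambda>_. 1) (\<lambda>_. 1) = 1" by (simp add: L2_inner_def prob_space)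
  show hH: "h \<in> H1 \<mu> W" unfolding h_def using assms(1) one_H1 by (intro en.mem(3,4))
  show "L2_inner \<mu> h (\<lambda>_. 1) = 0"
    unfolding h_def using fL oneL one1 by (simp add: ip.diff_left ip.scale_left ip.mem(4))
  show "L2_inner \<mu> h h = variance f"
    unfolding h_def variance_L2[OF fL] using fL oneL one1
    by (simp add: ip.quad_diff ip.scale_left ip.scale_right ip.mem(4) power2_eq_square)
  show "dirichlet \<mu> D h h = dirichlet \<mu> D f f" if D: "dominated_field c D"
  proof -
    have g: "weak_gradient_of \<mu> (\<lambda>x. f x + (- L2_inner \<mu> f (\<lambda>_. 1)) * 1) (\<lambda>x. wgrad \<mu> f x + (- L2_inner \<mu> f (\<lambda>_. 1)) *\<^sub>R 0)"
      by (rule weak_gradient_of_linear[OF H1D(2)[OF assms(1)] weak_gradient_of_has[OF has_weak_gradient_const]])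
    have h: "h = (\<lambda>x. f x + (- L2_inner \<mu> f (\<lambda>_. 1)) * 1)" unfolding h_def by (simp add: fun_eq_iff)
    show ?thesis using dirichlet_eq[OF D g g] unfolding h[symmetric] by (simp add: dirichlet_def)
  qed
qed

end

text \<open>A Dirac mass has a one-dimensional \<open>L2\<close> and no second eigenvalue, whence
  \<open>not_dirac\<close>.\<close>

locale compact_energy_space = energy_space \<mu> W for \<mu> :: "(real^'n) measure" and W +
  assumes not_dirac: "measure \<mu> {x} \<noteq> 1"
    and hilbert: "H1_hilbert \<mu> W"
    and compact: "H1_compact_in_L2 \<mu> W"
    and dense: "H1_dense_in_L2 \<mu> W"
    and poincare_finite: "poincare_const \<mu> W < \<infinity>"
begin

section \<open>The Poincare inequality excludes singular parts and atoms\<close>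

lemma poincare_inequality:
  obtains C where "C \<ge> 0" "\<And>f. f \<in> H1 \<mu> W \<Longrightarrow> variance f \<le> C * dirichlet \<mu> W f f"
proof -
  obtain C where C: "C < \<infinity>" "\<And>f. f \<in> H1 \<mu> W \<Longrightarrow> ennreal (variance f) \<le> C * ennreal (dirichlet \<mu> W f f)"
    using poincare_finite unfolding poincare_const_def Inf_less_iff by auto
  have "variance f \<le> enn2real C * dirichlet \<mu> W f f" if f: "f \<in> H1 \<mu> W" for f
  proof -
    have nn: "0 \<le> dirichlet \<mu> W f f" by (rule psd_form.nonneg[OF dirichlet_psd_form f])
    have "ennreal (variance f) \<le> ennreal (enn2real C) * ennreal (dirichlet \<mu> W f f)"
      using C(2)[OF f] C(1) by (simp add: less_top)
    also have "\<dots> = ennreal (enn2real C * dirichlet \<mu> W f f)" by (simp add: ennreal_mult nn)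
    finally show ?thesis using nn by (simp add: ennreal_le_iff)
  qed
  then show ?thesis using that[of "enn2real C"] by simp
qed

text \<open>Indicators of Lebesgue-null sets have weak gradient \<open>0\<close>, so the Poincare inequality forces
  their measure to be \<open>0\<close> or \<open>1\<close>; since \<open>\<mu>\<close> is not a Dirac mass, \<open>\<mu>\<close> is absolutely continuous.\<close>

lemma null_set_prob:
  assumes "A \<in> null_sets lborel"
  shows "prob A = 0 \<or> prob A = 1"
proof -
  have A: "A \<in> sets borel" using assms by auto
  let ?f = "indicator A :: real^'n \<Rightarrow> real"
  have g: "weak_gradient_of \<mu> ?f (\<lambda>_. 0)"
    by (rule weak_gradient_of_has[OF has_weak_gradient_null_indicator[OF assms]])
  have fL: "?f \<in> L2 \<mu>" using A by (intro L2_bounded[of _ 1]) (auto simp: indicator_def)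
  have f: "?f \<in> H1 \<mu> W" by (rule H1I[OF fL g]) simp
  obtain C where "variance ?f \<le> C * dirichlet \<mu> W ?f ?f" using poincare_inequality f by metis
  then have "variance ?f \<le> 0" using dirichlet_eq[OF dominated_field_W g g] by simp
  moreover have "variance ?f = prob A - (prob A)\<^sup>2"
  proof -
    have "L2_inner \<mu> ?f ?f = (\<integral>x. ?f x \<partial>\<mu>)"
      unfolding L2_inner_def by (intro Bochner_Integration.integral_cong) (auto simp: indicator_def)
    then show ?thesis unfolding variance_L2[OF fL] using A by (simp add: L2_inner_def space_mu)
  qed
  ultimately have "prob A * (1 - prob A) \<le> 0" by (simp add: power2_eq_square algebra_simps)
  then show ?thesis using measure_nonneg[of \<mu> A] prob_le_1[of A] by (auto simp: mult_le_0_iff)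
qed

lemma null_iff_prob: "A \<in> sets borel \<Longrightarrow> A \<in> null_sets \<mu> \<longleftrightarrow> prob A = 0"
  using sets_mu by (auto simp: null_sets_def emeasure_eq_measure)

text \<open>A charged Lebesgue-null set would have full measure and each of its Borel subsets
  measure 0 or 1, so it would be an atom concentrated at one point, which would then carry measure
  1.\<close>

lemma absolutely_continuous_mu:
  assumes N: "N \<in> null_sets lborel"
  shows "N \<in> null_sets \<mu>"
proof (rule ccontr)
  assume nn: "N \<notin> null_sets \<mu>"
  have NB: "N \<in> sets borel" using N by auto
  then have N1: "prob N = 1" using null_set_prob[OF N] nn null_iff_prob by auto
  have "\<exists>x. N - {x} \<in> null_sets \<mu>"
  proof (rule unsplittable_measure_point[OF sets_mu NB nn])
    fix B assume B: "B \<in> sets borel" "B \<subseteq> N"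
    then have "B \<in> null_sets lborel" using N null_sets_subset[of N lborel B] by simp
    then consider "prob B = 0" | "prob B = 1" using null_set_prob by auto
    then show "B \<in> null_sets \<mu> \<or> N - B \<in> null_sets \<mu>"
    proof cases
      case 2
      have "prob (N - B) = prob N - prob B" using B NB sets_mu by (intro finite_measure_Diff) auto
      then show ?thesis using 2 N1 B NB null_iff_prob[of "N - B"] by auto
    qed (use B null_iff_prob in auto)
  qed
  then obtain x where x: "N - {x} \<in> null_sets \<mu>" by auto
  have "prob N \<le> prob ((N - {x}) \<union> {x})" using NB sets_mu by (intro finite_measure_mono) auto
  also have "\<dots> \<le> prob (N - {x}) + prob {x}" using NB sets_mu by (intro measure_Un_le) auto
  finally have "prob N \<le> prob (N - {x}) + prob {x}" .
  moreover have "prob (N - {x}) = 0" using x by (auto simp: null_sets_def measure_def)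
  ultimately have "prob {x} = 1" using N1 prob_le_1[of "{x}"] by simp
  then show False using not_dirac by simp
qed

text \<open>Points are Lebesgue-null, hence \<open>\<mu>\<close>-null, so no set of positive measure
  can be concentrated at one point.\<close>

lemma split_set:
  assumes A: "A \<in> sets borel" "A \<notin> null_sets \<mu>"
  shows "\<exists>B. B \<in> sets borel \<and> B \<notin> null_sets \<mu> \<and> B \<subseteq> A \<and> A - B \<notin> null_sets \<mu>"
proof (rule ccontr)
  assume "\<not> ?thesis"
  then have "\<exists>x. A - {x} \<in> null_sets \<mu>" by (intro unsplittable_measure_point[OF sets_mu A]) blast
  then obtain x where "A - {x} \<in> null_sets \<mu>" by auto
  moreover have "{x} \<in> null_sets \<mu>" by (rule absolutely_continuous_mu) (auto simp: null_sets_def)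
  ultimately have "(A - {x}) \<union> {x} \<in> null_sets \<mu>" by (rule null_sets.Un)
  moreover have "A \<subseteq> (A - {x}) \<union> {x}" by auto
  ultimately show False using A sets_mu null_sets_subset[of "(A - {x}) \<union> {x}" \<mu> A] by auto
qed

text \<open>Repeated splitting gives a decreasing chain of sets; the successive differences are
  disjoint and of positive measure, and their normalised indicators are orthonormal.\<close>

lemma infinite_orthonormal: "\<exists>e::nat \<Rightarrow> _. psd_form.orthonormal (L2 \<mu>) (L2_inner \<mu>) UNIV e"
proof -
  interpret ip: psd_form "L2 \<mu>" "L2_inner \<mu>" by (rule L2_psd_form)
  have "UNIV \<notin> null_sets \<mu>" using prob_space null_iff_prob[of UNIV] by (simp add: space_mu)
  then have "\<exists>A. \<forall>n::nat. (A n \<in> sets borel \<and> A n \<notin> null_sets \<mu>) \<and>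
      (A (Suc n) \<subseteq> A n \<and> A n - A (Suc n) \<notin> null_sets \<mu>)"
    using split_set by (intro dependent_nat_choice) auto
  then obtain A where A: "\<And>n::nat. A n \<in> sets borel" "\<And>n. A (Suc n) \<subseteq> A n"
      "\<And>n. A n - A (Suc n) \<notin> null_sets \<mu>" by auto
  define B where "B n = A n - A (Suc n)" for n
  have B: "B n \<in> sets borel" for n unfolding B_def using A by auto
  have Bpos: "prob (B n) > 0" for n
    using A(3)[of n] null_iff_prob[OF B[of n]] measure_nonneg[of \<mu> "B n"] unfolding B_def by linarith
  have anti: "A n \<subseteq> A m" if "m \<le> n" for m n using that A(2) by (rule lift_Suc_antimono_le[rotated])
  have disj: "B m \<inter> B n = {}" if "m < n" for m n
    using anti[of "Suc m" n] that unfolding B_def by auto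
  have disj': "B m \<inter> B n = {}" if "m \<noteq> n" for m n
    using disj[of m n] disj[of n m] that by (cases "m < n") auto
  define e where "e n = (\<lambda>x. indicator (B n) x / sqrt (prob (B n)))" for n
  have eL: "e n \<in> L2 \<mu>" for n
    unfolding e_def using B by (intro L2_bounded[of _ "1 / sqrt (prob (B n))"]) (auto simp: indicator_def)
  have "L2_inner \<mu> (e m) (e n) = (if m = n then 1 else 0)" for m n
  proof (cases "m = n")
    case True
    have "e n x * e n x = indicator (B n) x / prob (B n)" for x
      unfolding e_def by (simp add: indicator_def)
    then show ?thesis unfolding True L2_inner_def using B[of n] Bpos[of n] by (simp add: space_mu)
  next
    case False
    then have z: "e m x * e n x = 0" for x using disj'[of m n] unfolding e_def by (auto simp: indicator_def)
    show ?thesis unfolding L2_inner_def z using False by simp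
  qed
  then have "ip.orthonormal UNIV e" unfolding ip.orthonormal_def using eL by blast
  then show ?thesis by blast
qed

lemma H1_norm_eq: "H1_norm \<mu> W f = sqrt (L2_inner \<mu> f f + dirichlet \<mu> W f f)"
  unfolding H1_norm_def L2_inner_quad ..

lemma L2_norm_eq: "L2_norm \<mu> f = sqrt (L2_inner \<mu> f f)"
  unfolding L2_norm_def L2_inner_quad ..

lemma form_space: "form_space (L2 \<mu>) (H1 \<mu> W) (L2_inner \<mu>) (dirichlet \<mu> W) (\<lambda>_. 1)"
proof -
  interpret ip: psd_form "L2 \<mu>" "L2_inner \<mu>" by (rule L2_psd_form)
  interpret en: psd_form "H1 \<mu> W" "dirichlet \<mu> W" by (rule dirichlet_psd_form)
  have diff: "(\<lambda>x. f x - g x) = f - g" for f g :: "real^'n \<Rightarrow> real" by (simp add: fun_eq_iff)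
  show ?thesis
  proof
    show "H1 \<mu> W \<subseteq> L2 \<mu>" using H1D(1) by auto
    show "dirichlet \<mu> W f f = 0" if "f \<in> H1 \<mu> W" "L2_inner \<mu> f f = 0" for f
      by (rule dirichlet_null[OF that])
    show "\<exists>r::nat \<Rightarrow> nat. strict_mono r \<and> (\<forall>e>0. \<exists>N. \<forall>m\<ge>N. \<forall>n\<ge>N.
        L2_inner \<mu> (F (r m) - F (r n)) (F (r m) - F (r n)) < e)"
      if F: "\<And>n. F n \<in> H1 \<mu> W" "\<And>n. L2_inner \<mu> (F n) (F n) + dirichlet \<mu> W (F n) (F n) \<le> B" for F :: "nat \<Rightarrow> _" and B
    proof -
      have "H1_norm \<mu> W (F n) \<le> sqrt B" for n using F(2)[of n] unfolding H1_norm_eq by simp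
      then obtain f and r :: "nat \<Rightarrow> nat" where f: "f \<in> L2 \<mu>" and r: "strict_mono r"
        and lim: "(\<lambda>n. L2_norm \<mu> (\<lambda>x. F (r n) x - f x)) \<longlonglongrightarrow> 0"
        using compact F(1) unfolding H1_compact_in_L2_def by blast
      have FL: "F n \<in> L2 \<mu>" for n using F(1) H1D(1) by auto
      have "\<exists>N. \<forall>m\<ge>N. \<forall>n\<ge>N. L2_inner \<mu> (F (r m) - F (r n)) (F (r m) - F (r n)) < e" if e: "e > 0" for e
      proof -
        \<comment> \<open>A quarter of \<open>e\<close>, since the squared distance of two terms is
          at most twice the sum of their squared distances to the limit.\<close>
        obtain N where N: "\<And>n. n \<ge> N \<Longrightarrow> \<bar>sqrt (L2_inner \<mu> (F (r n) - f) (F (r n) - f))\<bar> < sqrt (e / 4)"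
          using LIMSEQ_D[OF lim, of "sqrt (e / 4)"] e unfolding diff L2_norm_eq by auto
        have N': "L2_inner \<mu> (F (r n) - f) (F (r n) - f) < e / 4" if "n \<ge> N" for n
          using N[OF that] by (simp add: abs_less_iff)
        have "L2_inner \<mu> (F (r m) - F (r n)) (F (r m) - F (r n)) < e" if mn: "m \<ge> N" "n \<ge> N" for m n
        proof -
          let ?a = "F (r m) - f" and ?b = "F (r n) - f"
          have m: "?a \<in> L2 \<mu>" "?b \<in> L2 \<mu>" using FL f by (auto intro: ip.mem(3))
          have eq: "F (r m) - F (r n) = ?a - ?b" by simp
          have "0 \<le> L2_inner \<mu> (?a + ?b) (?a + ?b)" by (rule ip.nonneg[OF ip.mem(2)[OF m]])
          then show ?thesis unfolding eq using ip.quad_add[OF m] ip.quad_diff[OF m] N'[OF mn(1)] N'[OF mn(2)]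
            by linarith
        qed
        then show ?thesis by blast
      qed
      then show ?thesis using r by blast
    qed
    show "\<exists>f\<in>H1 \<mu> W. (\<lambda>n. L2_inner \<mu> (F n - f) (F n - f) + dirichlet \<mu> W (F n - f) (F n - f)) \<longlonglongrightarrow> 0"
      if F: "\<And>n. F n \<in> H1 \<mu> W"
        and cau: "\<And>e. e > 0 \<Longrightarrow> \<exists>N. \<forall>m\<ge>N. \<forall>n\<ge>N.
          L2_inner \<mu> (F m - F n) (F m - F n) + dirichlet \<mu> W (F m - F n) (F m - F n) < e" for F :: "nat \<Rightarrow> _"
    proof -
      have "\<exists>N. \<forall>m\<ge>N. \<forall>n\<ge>N. H1_norm \<mu> W (\<lambda>x. F m x - F n x) < e" if e: "e > 0" for e
      proof -
        obtain N where N: "\<forall>m\<ge>N. \<forall>n\<ge>N. L2_inner \<mu> (F m - F n) (F m - F n) + dirichlet \<mu> W (F m - F n) (F m - F n) < e\<^sup>2"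
          using cau[of "e\<^sup>2"] e by auto
        have "H1_norm \<mu> W (\<lambda>x. F m x - F n x) < e" if "m \<ge> N" "n \<ge> N" for m n
          unfolding diff H1_norm_eq using N that e by (intro real_less_lsqrt) auto
        then show ?thesis by blast
      qed
      then obtain f where f: "f \<in> H1 \<mu> W" and lim: "(\<lambda>n. H1_norm \<mu> W (\<lambda>x. F n x - f x)) \<longlonglongrightarrow> 0"
        using hilbert F unfolding H1_hilbert_def by blast
      have "(\<lambda>n. (H1_norm \<mu> W (\<lambda>x. F n x - f x))\<^sup>2) \<longlonglongrightarrow> 0\<^sup>2" by (intro tendsto_power lim)
      moreover have "(H1_norm \<mu> W (\<lambda>x. F n x - f x))\<^sup>2
          = L2_inner \<mu> (F n - f) (F n - f) + dirichlet \<mu> W (F n - f) (F n - f)" for n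
      proof -
        have m: "F n - f \<in> H1 \<mu> W" using F f by (rule en.mem(3))
        then show ?thesis unfolding diff H1_norm_eq
          using ip.nonneg[OF H1D(1)[OF m]] en.nonneg[OF m] by simp
      qed
      ultimately show ?thesis using f by auto
    qed
    show "\<exists>h\<in>H1 \<mu> W. L2_inner \<mu> (f - h) (f - h) < e" if fe: "f \<in> L2 \<mu>" "e > 0" for f e
    proof -
      have se: "sqrt e > 0" using fe by simp
      then obtain h where "h \<in> H1 \<mu> W" "L2_norm \<mu> (\<lambda>x. f x - h x) < sqrt e"
        using dense[unfolded H1_dense_in_L2_def, rule_format, OF fe(1) se] by auto
      then show ?thesis unfolding diff L2_norm_eq by auto
    qed
    show "\<exists>e::nat \<Rightarrow> _. ip.orthonormal UNIV e" by (rule infinite_orthonormal)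
    show "(\<lambda>_. 1) \<in> H1 \<mu> W" by (rule one_H1)
    show "L2_inner \<mu> (\<lambda>_. 1) (\<lambda>_. 1) = 1" by (simp add: L2_inner_def prob_space)
    show "dirichlet \<mu> W (\<lambda>_. 1) (\<lambda>_. 1) = 0" by (rule one_dirichlet)
  qed
qed

end

section \<open>Matrix algebra\<close>

lemma norm_vec_power2:
  fixes v :: "'b::real_normed_vector^'n"
  shows "(norm v)\<^sup>2 = (\<Sum>i\<in>UNIV. (norm (v $ i))\<^sup>2)"
  by (simp add: norm_vec_def L2_set_def sum_nonneg)

lemma norm_matrix_vector_le:
  fixes A :: "real^'n^'m"
  shows "norm (A *v x) \<le> norm A * norm x"
proof (rule power2_le_imp_le)
  have "(norm (A *v x))\<^sup>2 = (\<Sum>i\<in>UNIV. (norm ((A $ i) \<bullet> x))\<^sup>2)"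
    unfolding norm_vec_power2[of "A *v x"] matrix_vector_mul_component ..
  also have "\<dots> \<le> (\<Sum>i\<in>UNIV. (norm (A $ i) * norm x)\<^sup>2)"
    by (intro sum_mono power_mono) (simp_all add: Cauchy_Schwarz_ineq2)
  also have "\<dots> = (norm A * norm x)\<^sup>2"
    unfolding power_mult_distrib norm_vec_power2[of A] sum_distrib_right ..
  finally show "(norm (A *v x))\<^sup>2 \<le> (norm A * norm x)\<^sup>2" .
qed simp

lemma norm_transpose: "norm (transpose A) = norm (A :: real^'n^'m)"
proof -
  have "(norm (transpose A))\<^sup>2 = (\<Sum>i\<in>UNIV. \<Sum>j\<in>UNIV. (norm (A $ j $ i))\<^sup>2)"
    unfolding norm_vec_power2[of "transpose A"] norm_vec_power2[of "transpose A $ _"] by (simp add: transpose_def)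
  also have "\<dots> = (norm A)\<^sup>2"
    unfolding norm_vec_power2[of A] norm_vec_power2[of "A $ _"] by (rule sum.swap)
  finally show ?thesis by simp
qed

lemma norm_matrix_matrix_le:
  fixes A :: "real^'n^'m" and B :: "real^'k^'n"
  shows "norm (A ** B) \<le> norm A * norm B"
proof (rule power2_le_imp_le)
  have row: "(A ** B) $ i = transpose B *v (A $ i)" for i
    by (simp add: vec_eq_iff matrix_matrix_mult_def matrix_vector_mult_def transpose_def mult.commute)
  have "(norm (A ** B))\<^sup>2 = (\<Sum>i\<in>UNIV. (norm (transpose B *v (A $ i)))\<^sup>2)"
    unfolding norm_vec_power2[of "A ** B"] row ..
  also have "\<dots> \<le> (\<Sum>i\<in>UNIV. (norm (A $ i) * norm B)\<^sup>2)"
  proof (intro sum_mono power_mono norm_ge_zero)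
    show "norm (transpose B *v (A $ i)) \<le> norm (A $ i) * norm B" for i
      using norm_matrix_vector_le[of "transpose B" "A $ i"] unfolding norm_transpose
      by (subst mult.commute)
  qed
  also have "\<dots> = (norm A * norm B)\<^sup>2"
    unfolding power_mult_distrib norm_vec_power2[of A] sum_distrib_right ..
  finally show "(norm (A ** B))\<^sup>2 \<le> (norm A * norm B)\<^sup>2" .
qed simp

definition outer2 :: "real^'n \<Rightarrow> real^'n \<Rightarrow> real^'n^'n" where
  "outer2 p q = (\<chi> i j. p $ i * q $ j)"

lemma outer_eq: "outer v = outer2 v v"
  unfolding outer_def outer2_def ..

lemma norm_outer2: "norm (outer2 p q) = norm p * norm q"
proof -
  have "(norm (outer2 p q))\<^sup>2 = (norm p * norm q)\<^sup>2"
    unfolding power_mult_distrib power2_norm_eq_inner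
    by (simp add: outer2_def inner_vec_def sum_product algebra_simps)
  then show ?thesis by simp
qed

lemma transpose_component: "transpose A $ i $ j = A $ j $ i"
  by (simp add: transpose_def)

lemma trace_outer2: "trace (D ** outer2 p q) = q \<bullet> (D *v p)"
  unfolding trace_def matrix_matrix_mult_def outer2_def inner_vec_def matrix_vector_mult_def
  by (simp add: sum_distrib_left algebra_simps)

lemma outer2_sandwich:
  assumes "transpose W = W"
  shows "W ** outer2 p q ** W = outer2 (W *v p) (W *v q)"
proof -
  have W: "W $ i $ j = W $ j $ i" for i j
    using assms transpose_component[of W i j] by simp
  have "W ** outer2 p q = outer2 (W *v p) q"
    by (simp add: vec_eq_iff outer2_def matrix_matrix_mult_def matrix_vector_mult_def sum_distrib_right mult.assoc)
  moreover have "outer2 r q ** W = outer2 r (W *v q)" for r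
    unfolding outer2_def matrix_matrix_mult_def matrix_vector_mult_def
    by (simp add: vec_eq_iff sum_distrib_left mult.assoc) (simp add: W mult.commute)
  ultimately show ?thesis by simp
qed

lemma transpose_sandwich:
  fixes W F :: "real^'n^'n"
  assumes "transpose W = W" "transpose F = F"
  shows "transpose (W ** F ** W) = W ** F ** W"
  using assms by (simp add: matrix_transpose_mul matrix_mul_assoc)

lemma trace_sym_inner:
  fixes F K :: "real^'n^'n"
  assumes "transpose F = F"
  shows "trace (F ** K) = F \<bullet> K"
proof -
  have F: "F $ i $ j = F $ j $ i" for i j using assms transpose_component[of F i j] by simp
  have "trace (F ** K) = (\<Sum>i\<in>UNIV. \<Sum>j\<in>UNIV. F $ i $ j * K $ j $ i)"
    unfolding trace_def matrix_matrix_mult_def by simp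
  also have "\<dots> = (\<Sum>j\<in>UNIV. \<Sum>i\<in>UNIV. F $ j $ i * K $ j $ i)"
    by (subst sum.swap) (simp add: F)
  finally show ?thesis by (simp add: inner_vec_def)
qed

text \<open>The map from F to W F W is moved to the other factor by the cyclic property of the
  trace. Hence testing a field with the direction W F W measures only its sandwich by
  \<open>W\<close>.\<close>

lemma trace_sandwich:
  fixes W F K :: "real^'n^'n"
  assumes "transpose F = F"
  shows "trace ((W ** F ** W) ** K) = F \<bullet> (W ** K ** W)"
proof -
  have "trace ((W ** F ** W) ** K) = trace (W ** (F ** W ** K))" by (simp add: matrix_mul_assoc)
  also have "\<dots> = trace ((F ** W ** K) ** W)" by (rule trace_mul_sym)
  also have "\<dots> = trace (F ** (W ** K ** W))" by (simp add: matrix_mul_assoc)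
  finally show ?thesis using trace_sym_inner[OF assms] by simp
qed

text \<open>Cauchy-Schwarz for the form of \<open>W\<close> between \<open>W *v v\<close> and
  \<open>v\<close>, followed by cancelling one factor of the squared norm.\<close>

lemma psd_norm_mult:
  fixes W :: "real^'n^'n"
  assumes W: "psd W"
  shows "(norm (W *v v))\<^sup>2 \<le> norm W * (v \<bullet> (W *v v))"
proof -
  let ?w = "W *v v"
  have c: "\<bar>s * (norm ?w)\<^sup>2\<bar> \<le> 1 / 2 * (s\<^sup>2 * (?w \<bullet> (W *v ?w)) + v \<bullet> ?w)" for s
    using form_dominated_cross[OF form_dominated_self[OF W] W, of "s *\<^sub>R ?w" v]
    by (simp add: matrix_vector_mult_scaleR power2_eq_square power2_norm_eq_inner[symmetric] algebra_simps)
  have "0 \<le> v \<bullet> ?w + 2 * s * (- (norm ?w)\<^sup>2) + s\<^sup>2 * (?w \<bullet> (W *v ?w))" for s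
    using c[of s] abs_ge_self[of "s * (norm ?w)\<^sup>2"] by simp
  then have "(- (norm ?w)\<^sup>2)\<^sup>2 \<le> (v \<bullet> ?w) * (?w \<bullet> (W *v ?w))"
    by (rule quadratic_nonneg_imp) (rule psdD(2)[OF W])
  also have "\<dots> \<le> (v \<bullet> ?w) * (norm W * (norm ?w)\<^sup>2)"
  proof (rule mult_left_mono[OF _ psdD(2)[OF W]])
    have "?w \<bullet> (W *v ?w) \<le> norm ?w * norm (W *v ?w)" by (rule norm_cauchy_schwarz)
    also have "\<dots> \<le> norm ?w * (norm W * norm ?w)" by (intro mult_left_mono norm_matrix_vector_le) simp
    finally show "?w \<bullet> (W *v ?w) \<le> norm W * (norm ?w)\<^sup>2" by (simp add: power2_eq_square algebra_simps)
  qed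
  finally have "(norm ?w)\<^sup>2 * (norm ?w)\<^sup>2 \<le> (norm W * (v \<bullet> ?w)) * (norm ?w)\<^sup>2"
    by (simp add: power2_eq_square algebra_simps)
  then show ?thesis
  proof (cases "?w = 0")
    case False
    then have "0 < (norm ?w)\<^sup>2" by simp
    with \<open>(norm ?w)\<^sup>2 * (norm ?w)\<^sup>2 \<le> _\<close> show ?thesis by (rule mult_right_le_imp_le)
  qed simp
qed

text \<open>Makes sandwiches by \<open>W\<close> available as perturbation directions: the quadratic
  form is that of \<open>F\<close> at \<open>W *v v\<close>, whose squared norm the form of
  \<open>W\<close> controls.\<close>

lemma dominated_sandwich:
  fixes W F :: "real^'n^'n"
  assumes W: "psd W" and F: "transpose F = F"
  shows "form_dominated (norm F * norm W) (W ** F ** W) W"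
proof -
  have "\<bar>v \<bullet> ((W ** F ** W) *v v)\<bar> \<le> norm F * norm W * (v \<bullet> (W *v v))" for v
  proof -
    let ?w = "W *v v"
    have "v \<bullet> ((W ** F ** W) *v v) = ?w \<bullet> (F *v ?w)"
      using sym_inner[OF psdD(1)[OF W], of v "F *v ?w"]
      by (simp add: matrix_vector_mul_assoc[symmetric] inner_commute)
    also have "\<bar>\<dots>\<bar> \<le> norm ?w * norm (F *v ?w)" by (rule Cauchy_Schwarz_ineq2)
    also have "\<dots> \<le> norm ?w * (norm F * norm ?w)" by (intro mult_left_mono norm_matrix_vector_le) simp
    also have "\<dots> = norm F * (norm ?w)\<^sup>2" by (simp add: power2_eq_square)
    also have "\<dots> \<le> norm F * (norm W * (v \<bullet> (W *v v)))" by (intro mult_left_mono psd_norm_mult[OF W]) simp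
    finally show ?thesis by (simp add: mult.assoc)
  qed
  then show ?thesis unfolding form_dominated_def using transpose_sandwich[OF psdD(1)[OF W] F] by blast
qed

text \<open>The reason is that \<open>D\<close> vanishes on the kernel of \<open>W\<close>.\<close>

lemma dominated_factor:
  fixes W D :: "real^'n^'n"
  assumes D: "form_dominated c D W" and W: "psd W"
  obtains X where "D = W ** X ** W"
proof -
  have sW: "transpose W = W" using psdD(1)[OF W] .
  have sD: "transpose D = D" using D unfolding form_dominated_def by simp
  have ker: "D *v v = 0" if "W *v v = 0" for v
    using form_dominated_null[OF D W, of v] that by simp
  let ?R = "range (\<lambda>v. W *v v)"
  have sub: "subspace ?R" by (intro linear_subspace_image subspace_UNIV) simp
  \<comment> \<open>\<open>P\<close> is the orthogonal projection onto the range of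
    \<open>W\<close>.\<close>
  obtain P where P: "\<And>x. P x \<in> ?R" "\<And>x r. r \<in> ?R \<Longrightarrow> (x - P x) \<bullet> r = 0"
  proof -
    have "\<forall>x. \<exists>y\<in>?R. \<forall>r\<in>?R. (x - y) \<bullet> r = 0"
    proof
      fix x
      obtain y z where "y \<in> span ?R" "\<And>w. w \<in> span ?R \<Longrightarrow> orthogonal z w" "x = y + z"
        using orthogonal_subspace_decomp_exists[of ?R x] by blast
      moreover have "span ?R = ?R" using sub by simp
      ultimately show "\<exists>y\<in>?R. \<forall>r\<in>?R. (x - y) \<bullet> r = 0"
        by (intro bexI[of _ y]) (auto simp: orthogonal_def)
    qed
    then show ?thesis using that by metis
  qed
  have "\<forall>i. \<exists>q. P (axis i 1) = W *v q" using P(1) by auto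
  then obtain q where q: "\<And>i. P (axis i 1) = W *v q i" by metis
  \<comment> \<open>The columns solve \<open>W *v q i = P (axis i 1)\<close>, so
    \<open>W ** Q\<close> is the matrix of \<open>P\<close>. It fixes \<open>D\<close> from both
    sides, and its symmetry turns the right factor into \<open>transpose Q ** W\<close>, which gives
    the factor X as \<open>Q ** D ** transpose Q\<close>.\<close>
  define Q :: "real^'n^'n" where "Q = (\<chi> i j. q j $ i)"
  have Qax: "Q *v axis i 1 = q i" for i
    unfolding Q_def matrix_vector_mult_basis by (simp add: column_def vec_eq_iff)
  have WQ: "(W ** Q) *v axis i 1 = P (axis i 1)" for i
    unfolding matrix_vector_mul_assoc[symmetric] Qax q ..
  have entry: "(W ** Q) $ i $ j = P (axis j 1) \<bullet> axis i 1" for i j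
    using WQ[of j] unfolding matrix_vector_mult_basis
    by (simp add: inner_axis column_def vec_eq_iff)
  have swap: "P x \<bullet> y = P y \<bullet> x" for x y
  proof -
    have "(y - P y) \<bullet> P x = 0" "(x - P x) \<bullet> P y = 0" using P by auto
    then have "y \<bullet> P x = P y \<bullet> P x" "x \<bullet> P y = P x \<bullet> P y" by (simp_all add: inner_diff_left)
    then show ?thesis
      using inner_commute[of "P x" y] inner_commute[of "P y" x] inner_commute[of "P x" "P y"] by simp
  qed
  have sWQ: "transpose (W ** Q) = W ** Q"
    unfolding vec_eq_iff transpose_def by (simp add: entry swap)
  have "D *v ((W ** Q) *v axis i 1) = D *v axis i 1" for i
  proof -
    let ?d = "axis i 1 - P (axis i 1)"
    \<comment> \<open>\<open>?d\<close> is orthogonal to the range of \<open>W\<close>, so it lies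
      in the kernel of the symmetric \<open>W\<close>.\<close>
    have "(W *v ?d) \<bullet> (W *v ?d) = ?d \<bullet> (W *v (W *v ?d))"
      using sym_inner[OF sW, of ?d "W *v ?d"] by simp
    also have "\<dots> = 0" by (rule P(2)) simp
    finally have "D *v ?d = 0" by (intro ker) simp
    then show ?thesis unfolding WQ by (simp add: matrix_vector_mult_diff_distrib)
  qed
  then have "column i (D ** (W ** Q)) = column i D" for i
    unfolding matrix_vector_mult_basis[symmetric] matrix_vector_mul_assoc[symmetric] .
  then have DP: "D ** (W ** Q) = D" by (simp add: vec_eq_iff column_def)
  have PD: "(W ** Q) ** D = D"
    using arg_cong[OF DP, of transpose] unfolding matrix_transpose_mul sWQ sD
    by (simp add: matrix_transpose_mul[symmetric] sWQ)
  have Pt: "W ** Q = transpose Q ** W"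
    using sWQ unfolding matrix_transpose_mul sW by simp
  have "D = (W ** Q) ** D ** (W ** Q)" using DP PD by simp
  also have "\<dots> = (W ** Q) ** D ** (transpose Q ** W)" by (simp only: Pt[symmetric])
  also have "\<dots> = W ** (Q ** D ** transpose Q) ** W" by (simp add: matrix_mul_assoc)
  finally show thesis by (rule that)
qed

text \<open>With the factorisation of \<open>D\<close> and the cyclic trace, pairing with
  \<open>D\<close> passes through the sandwich by \<open>W\<close>. Fields with equal sandwiches
  thus pair equally with every dominated direction.\<close>

lemma trace_dominated_zero:
  fixes W D Y :: "real^'n^'n"
  assumes D: "form_dominated c D W" and W: "psd W" and Y: "W ** Y ** W = 0"
  shows "trace (D ** Y) = 0"
proof -
  obtain X where X: "D = W ** X ** W" by (rule dominated_factor[OF D W])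
  have "trace (D ** Y) = trace (W ** (X ** W ** Y))" unfolding X by (simp add: matrix_mul_assoc)
  also have "\<dots> = trace ((X ** W ** Y) ** W)" by (rule trace_mul_sym)
  also have "\<dots> = trace (X ** (W ** Y ** W))" by (simp add: matrix_mul_assoc)
  finally show ?thesis unfolding Y by (simp add: trace_def)
qed

section \<open>Convex combinations of rank-one forms\<close>

text \<open>The coefficient matrices of convex combinations of rank-one forms. Entries outside the index
  set vanish, which makes the set compact.\<close>

definition density_coeffs :: "'i set \<Rightarrow> ('i \<times> 'i \<Rightarrow> real) set" where
  "density_coeffs I = {a. (\<forall>i j. a (i, j) = a (j, i)) \<and> (\<forall>p. p \<notin> I \<times> I \<longrightarrow> a p = 0) \<and>
     (\<forall>c. 0 \<le> (\<Sum>i\<in>I. \<Sum>j\<in>I. c i * c j * a (i, j))) \<and> (\<Sum>i\<in>I. a (i, i)) = 1}"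

lemma density_coeffs_rank_one:
  assumes "(\<Sum>i\<in>I. (c i)\<^sup>2) = 1"
  shows "(\<lambda>(i, j). if i \<in> I \<and> j \<in> I then c i * c j else 0) \<in> density_coeffs I"
proof -
  have "(\<Sum>i\<in>I. \<Sum>j\<in>I. d i * d j * (if i \<in> I \<and> j \<in> I then c i * c j else 0)) = (\<Sum>i\<in>I. d i * c i)\<^sup>2" for d
    unfolding power2_eq_square sum_product by (intro sum.cong refl) (simp add: algebra_simps)
  then show ?thesis using assms unfolding density_coeffs_def by (auto simp: power2_eq_square)
qed

lemma density_coeffs_convex:
  assumes a: "a \<in> density_coeffs I" and b: "b \<in> density_coeffs I" and s: "0 \<le> s" "s \<le> 1"
  shows "(\<lambda>p. a p + s * (b p - a p)) \<in> density_coeffs I"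
proof -
  have "0 \<le> (\<Sum>i\<in>I. \<Sum>j\<in>I. c i * c j * (a (i, j) + s * (b (i, j) - a (i, j))))" for c
  proof -
    have "(\<Sum>i\<in>I. \<Sum>j\<in>I. c i * c j * (a (i, j) + s * (b (i, j) - a (i, j))))
        = (1 - s) * (\<Sum>i\<in>I. \<Sum>j\<in>I. c i * c j * a (i, j)) + s * (\<Sum>i\<in>I. \<Sum>j\<in>I. c i * c j * b (i, j))"
      by (simp add: sum_distrib_left sum.distrib[symmetric] algebra_simps)
    also have "0 \<le> \<dots>"
      using a b s unfolding density_coeffs_def by (intro add_nonneg_nonneg mult_nonneg_nonneg) auto
    finally show ?thesis .
  qed
  moreover have "(\<Sum>i\<in>I. a (i, i) + s * (b (i, i) - a (i, i))) = 1"
    using a b unfolding density_coeffs_def by (simp add: sum.distrib sum_subtractf sum_distrib_left[symmetric])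
  moreover have "a (i, j) + s * (b (i, j) - a (i, j)) = a (j, i) + s * (b (j, i) - a (j, i))" for i j
    using a b unfolding density_coeffs_def by simp
  moreover have "a p + s * (b p - a p) = 0" if "p \<notin> I \<times> I" for p
  proof -
    have "a p = 0" "b p = 0" using a b that unfolding density_coeffs_def by blast+
    then show ?thesis by simp
  qed
  ultimately show ?thesis unfolding density_coeffs_def by blast
qed

text \<open>Restricts the form to coefficient vectors supported on two indices, that is, to a
  principal 2 by 2 block.\<close>

lemma psd_coeffs_entries:
  assumes I: "finite I" and sym: "\<And>i j. a (i, j) = a (j, i)"
    and psd: "\<And>c. 0 \<le> (\<Sum>i\<in>I. \<Sum>j\<in>I. c i * c j * (a (i, j) :: real))"
    and ij: "i \<in> I" "j \<in> I" "i \<noteq> j"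
  shows "0 \<le> x\<^sup>2 * a (i, i) + 2 * x * y * a (i, j) + y\<^sup>2 * a (j, j)"
proof -
  let ?c = "\<lambda>k. if k = i then x else if k = j then y else 0"
  have s: "(\<Sum>k\<in>I. ?c k * f k) = x * f i + y * f j" for f :: "_ \<Rightarrow> real"
  proof -
    have "(\<Sum>k\<in>I. ?c k * f k) = (\<Sum>k\<in>{i, j}. ?c k * f k)"
      using I ij by (intro sum.mono_neutral_right) auto
    then show ?thesis using ij by simp
  qed
  have "(\<Sum>k\<in>I. \<Sum>l\<in>I. ?c k * ?c l * a (k, l)) = (\<Sum>k\<in>I. ?c k * (\<Sum>l\<in>I. ?c l * a (k, l)))"
    by (simp only: sum_distrib_left mult.assoc)
  also have "\<dots> = x * (x * a (i, i) + y * a (i, j)) + y * (x * a (j, i) + y * a (j, j))"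
    by (simp only: s)
  finally show ?thesis using psd[of ?c] sym[of j i] by (simp add: power2_eq_square algebra_simps)
qed

lemma psd_coeffs_diag:
  assumes I: "finite I" and psd: "\<And>c. 0 \<le> (\<Sum>i\<in>I. \<Sum>j\<in>I. c i * c j * (a (i, j) :: real))"
    and i: "i \<in> I"
  shows "0 \<le> a (i, i)"
proof -
  let ?c = "\<lambda>k. if k = i then 1 else 0 :: real"
  have s: "(\<Sum>k\<in>I. ?c k * f k) = f i" for f :: "_ \<Rightarrow> real"
  proof -
    have "(\<Sum>k\<in>I. ?c k * f k) = (\<Sum>k\<in>{i}. ?c k * f k)"
      using I i by (intro sum.mono_neutral_right) auto
    then show ?thesis by simp
  qed
  have "(\<Sum>k\<in>I. \<Sum>l\<in>I. ?c k * ?c l * a (k, l)) = (\<Sum>k\<in>I. ?c k * (\<Sum>l\<in>I. ?c l * a (k, l)))"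
    by (simp only: sum_distrib_left mult.assoc)
  also have "\<dots> = a (i, i)" by (simp only: s)
  finally show ?thesis using psd[of ?c] by simp
qed

text \<open>Diagonal entries are nonnegative with sum 1; an off-diagonal entry is bounded by the
  mean of two of them, by testing the 2 by 2 block at (1, 1) and (1, -1).\<close>

lemma density_coeffs_bounded:
  assumes I: "finite I" and a: "a \<in> density_coeffs I"
  shows "\<bar>a p\<bar> \<le> 1"
proof -
  obtain i j where p: "p = (i, j)" by (cases p)
  have sym: "a (i, j) = a (j, i)" for i j using a unfolding density_coeffs_def by auto
  have psd: "0 \<le> (\<Sum>i\<in>I. \<Sum>j\<in>I. c i * c j * a (i, j))" for c using a unfolding density_coeffs_def by auto
  have tr: "(\<Sum>i\<in>I. a (i, i)) = 1" using a unfolding density_coeffs_def by auto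
  have d0: "0 \<le> a (i, i)" if "i \<in> I" for i by (rule psd_coeffs_diag[OF I psd that])
  have d1: "a (i, i) \<le> 1" if "i \<in> I" for i
    using member_le_sum[of i I "\<lambda>i. a (i, i)"] that d0 I tr by simp
  show ?thesis
  proof (cases "i \<in> I \<and> j \<in> I")
    case True
    show ?thesis
    proof (cases "i = j")
      case False
      note e = psd_coeffs_entries[OF I sym psd, of i j]
      have "0 \<le> a (i, i) + 2 * a (i, j) + a (j, j)" "0 \<le> a (i, i) - 2 * a (i, j) + a (j, j)"
        using e[of 1 1] e[of 1 "-1"] True False by simp_all
      then show ?thesis unfolding p using d1[of i] d1[of j] True by simp
    qed (use True d0[of i] d1[of i] p in auto)
  qed (use a p in \<open>auto simp: density_coeffs_def\<close>)
qed

text \<open>All defining conditions are closed in the product topology and the entries lie in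
  [-1, 1], so Tychonoff's theorem applies.\<close>

lemma density_coeffs_compact:
  assumes I: "finite I"
  shows "compact (density_coeffs I)"
proof -
  have "compactin (product_topology (\<lambda>_. euclidean) UNIV) (PiE UNIV (\<lambda>_::'a \<times> 'a. {-1..1::real}))"
    unfolding compactin_PiE by simp
  then have box: "compact (PiE UNIV (\<lambda>_::'a \<times> 'a. {-1..1::real}))"
    unfolding euclidean_product_topology by simp
  have co: "continuous_on UNIV (\<lambda>a::'a \<times> 'a \<Rightarrow> real. a p)" for p by simp
  have cl: "closed {a::'a \<times> 'a \<Rightarrow> real. \<forall>i j. a (i, j) = a (j, i)}"
    "closed {a::'a \<times> 'a \<Rightarrow> real. \<forall>p. p \<notin> I \<times> I \<longrightarrow> a p = 0}"
    "closed {a::'a \<times> 'a \<Rightarrow> real. \<forall>c. 0 \<le> (\<Sum>i\<in>I. \<Sum>j\<in>I. c i * c j * a (i, j))}"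
    "closed {a::'a \<times> 'a \<Rightarrow> real. (\<Sum>i\<in>I. a (i, i)) = 1}"
    by (intro closed_Collect_all closed_Collect_imp closed_Collect_eq closed_Collect_le continuous_intros co; simp)+
  have "closed (density_coeffs I)"
    unfolding density_coeffs_def Collect_conj_eq by (intro closed_Int cl)
  moreover have "density_coeffs I \<subseteq> PiE UNIV (\<lambda>_. {-1..1})"
  proof
    fix a assume "a \<in> density_coeffs I"
    then have "a p \<in> {-1..1}" for p using density_coeffs_bounded[OF I, of a p] by (simp add: abs_le_iff)
    then show "a \<in> PiE UNIV (\<lambda>_. {-1..1})" by auto
  qed
  ultimately show ?thesis using box compact_Int_closed[of "PiE UNIV (\<lambda>_. {-1..1})" "density_coeffs I"]
    by (simp add: Int_absorb1)
qed

text \<open>A Cholesky factorisation by induction on the index set. A zero pivot forces its whole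
  row to vanish; otherwise subtracting the rank-one part of the pivot row leaves the Schur
  complement, which is again positive semidefinite.\<close>

lemma gram_decomposition:
  assumes "finite I" and "\<And>i j. a (i, j) = a (j, i)"
    and "\<And>c. 0 \<le> (\<Sum>i\<in>I. \<Sum>j\<in>I. c i * c j * (a (i, j) :: real))"
  shows "\<exists>(N::nat) z. \<forall>i\<in>I. \<forall>j\<in>I. a (i, j) = (\<Sum>k<N. z k i * z k j)"
  using assms
proof (induction I arbitrary: a rule: finite_induct)
  case empty
  then show ?case by auto
next
  case (insert i0 I)
  note sym = insert.prems(1) and psd = insert.prems(2)
  have fin: "finite (insert i0 I)" using insert by simp
  have ni: "i0 \<notin> I" by fact
  define d where "d = a (i0, i0)"
  have d0: "d \<ge> 0" unfolding d_def by (rule psd_coeffs_diag[OF fin psd]) simp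
  have ex: "(\<Sum>i\<in>insert i0 I. \<Sum>j\<in>insert i0 I. c i * c j * a (i, j))
      = (c i0)\<^sup>2 * d + 2 * c i0 * (\<Sum>j\<in>I. c j * a (i0, j)) + (\<Sum>i\<in>I. \<Sum>j\<in>I. c i * c j * a (i, j))" for c
  proof -
    have "(\<Sum>i\<in>insert i0 I. \<Sum>j\<in>insert i0 I. c i * c j * a (i, j))
        = c i0 * c i0 * d + (\<Sum>j\<in>I. c i0 * c j * a (i0, j))
          + ((\<Sum>i\<in>I. c i * c i0 * a (i, i0)) + (\<Sum>i\<in>I. \<Sum>j\<in>I. c i * c j * a (i, j)))"
      unfolding sum.insert[OF insert.hyps] sum.distrib d_def by (simp only: add_ac)
    moreover have "(\<Sum>j\<in>I. c i0 * c j * a (i0, j)) = c i0 * (\<Sum>j\<in>I. c j * a (i0, j))"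
      unfolding sum_distrib_left mult.assoc ..
    moreover have "(\<Sum>i\<in>I. c i * c i0 * a (i, i0)) = c i0 * (\<Sum>j\<in>I. c j * a (i0, j))"
      unfolding sum_distrib_left by (intro sum.cong refl) (simp add: sym[of _ i0] mult_ac)
    ultimately show ?thesis by (simp add: power2_eq_square)
  qed
  show ?case
  proof (cases "d = 0")
    case True
    have z: "a (i0, j) = 0" if j: "j \<in> I" for j
    proof -
      have "0 \<le> x\<^sup>2 * a (i0, i0) + 2 * x * y * a (i0, j) + y\<^sup>2 * a (j, j)" for x y
        by (rule psd_coeffs_entries[OF fin sym psd]) (use j ni in auto)
      from this[of _ 1] have "0 \<le> a (j, j) + 2 * x * a (i0, j) + x\<^sup>2 * 0" for x
        using True unfolding d_def by (simp add: algebra_simps)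
      from quadratic_nonneg_imp[OF this] show ?thesis by simp
    qed
    have psdI: "0 \<le> (\<Sum>i\<in>I. \<Sum>j\<in>I. c i * c j * a (i, j))" for c
    proof -
      have "(\<Sum>i\<in>I. \<Sum>j\<in>I. c i * c j * a (i, j)) = (\<Sum>i\<in>insert i0 I. \<Sum>j\<in>insert i0 I. c i * c j * a (i, j))"
        unfolding ex using True z by simp
      then show ?thesis using psd by simp
    qed
    obtain N :: nat and z' where z': "\<And>i j. i \<in> I \<Longrightarrow> j \<in> I \<Longrightarrow> a (i, j) = (\<Sum>k<N. z' k i * z' k j)"
      using insert.IH[of a, OF sym psdI] by blast
    let ?z = "\<lambda>k i. if i = i0 then 0 else z' k i"
    have g: "a (i, j) = (\<Sum>k<N. ?z k i * ?z k j)" if "i \<in> insert i0 I" "j \<in> insert i0 I" for i j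
    proof (cases "i = i0 \<or> j = i0")
      case True
      then have "a (i, j) = 0"
        using that z[of i] z[of j] sym[of i j] \<open>d = 0\<close> unfolding d_def by (cases "i = i0"; cases "j = i0") auto
      then show ?thesis using True by auto
    next
      case False
      then show ?thesis using that z'[of i j] by auto
    qed
    show ?thesis by (intro exI[of _ N] exI[of _ ?z] ballI g)
  next
    case False
    then have dp: "d > 0" using d0 by simp
    define a' where "a' = (\<lambda>(i, j). a (i, j) - a (i0, i) * a (i0, j) / d)"
    have sym': "a' (i, j) = a' (j, i)" for i j unfolding a'_def using sym[of i j] by simp
    have psd': "0 \<le> (\<Sum>i\<in>I. \<Sum>j\<in>I. c i * c j * a' (i, j))" for c
    proof -
      \<comment> \<open>\<open>- t / d\<close> is the value at \<open>i0\<close> that minimises the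
        full form for given coefficients on \<open>I\<close>; the minimum is the form of the Schur
        complement.\<close>
      define t where "t = (\<Sum>j\<in>I. c j * a (i0, j))"
      let ?c = "\<lambda>i. if i = i0 then - t / d else c i"
      have cI: "(\<Sum>j\<in>I. ?c j * f j) = (\<Sum>j\<in>I. c j * f j)" for f
        using ni by (intro sum.cong) auto
      have cII: "(\<Sum>i\<in>I. \<Sum>j\<in>I. ?c i * ?c j * a (i, j)) = (\<Sum>i\<in>I. \<Sum>j\<in>I. c i * c j * a (i, j))"
        using ni by (intro sum.cong) auto
      have "(\<Sum>i\<in>insert i0 I. \<Sum>j\<in>insert i0 I. ?c i * ?c j * a (i, j))
          = (- t / d)\<^sup>2 * d + 2 * (- t / d) * t + (\<Sum>i\<in>I. \<Sum>j\<in>I. c i * c j * a (i, j))"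
        unfolding ex cI cII t_def[symmetric] by simp
      also have "(- t / d)\<^sup>2 * d + 2 * (- t / d) * t = - (t * t / d)"
        using dp by (simp add: power2_eq_square field_simps)
      also have "t * t / d = (\<Sum>i\<in>I. \<Sum>j\<in>I. c i * c j * (a (i0, i) * a (i0, j) / d))"
        unfolding t_def sum_product sum_divide_distrib by (intro sum.cong refl) simp
      also have "- \<dots> + (\<Sum>i\<in>I. \<Sum>j\<in>I. c i * c j * a (i, j)) = (\<Sum>i\<in>I. \<Sum>j\<in>I. c i * c j * a' (i, j))"
        unfolding a'_def by (simp add: sum_subtractf right_diff_distrib)
      finally show ?thesis using psd[of ?c] by simp
    qed
    obtain N :: nat and z' where z': "\<And>i j. i \<in> I \<Longrightarrow> j \<in> I \<Longrightarrow> a' (i, j) = (\<Sum>k<N. z' k i * z' k j)"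
      using insert.IH[of a', OF sym' psd'] by blast
    \<comment> \<open>The indices below \<open>N\<close> come from the Schur complement and vanish
      at \<open>i0\<close>; the index \<open>N\<close> holds the pivot row divided by
      \<open>sqrt d\<close>.\<close>
    let ?z = "\<lambda>k i. if k < N then (if i = i0 then 0 else z' k i) else a (i0, i) / sqrt d"
    have g: "a (i, j) = (\<Sum>k<Suc N. ?z k i * ?z k j)" if ij: "i \<in> insert i0 I" "j \<in> insert i0 I" for i j
    proof -
      have "(\<Sum>k<Suc N. ?z k i * ?z k j) = (\<Sum>k<N. ?z k i * ?z k j) + a (i0, i) * a (i0, j) / d"
        using dp by simp
      moreover have "(\<Sum>k<N. ?z k i * ?z k j) = a (i, j) - a (i0, i) * a (i0, j) / d"
      proof (cases "i = i0 \<or> j = i0")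
        case True
        then have "a (i, j) = a (i0, i) * a (i0, j) / d"
          using dp sym[of i i0] unfolding d_def by auto
        moreover have "(\<Sum>k<N. ?z k i * ?z k j) = 0" using True by (intro sum.neutral) auto
        ultimately show ?thesis by simp
      next
        case False
        then have "(\<Sum>k<N. ?z k i * ?z k j) = (\<Sum>k<N. z' k i * z' k j)" by (intro sum.cong) auto
        also have "\<dots> = a' (i, j)" using z'[of i j] ij False by auto
        finally show ?thesis unfolding a'_def by simp
      qed
      ultimately show ?thesis by simp
    qed
    show ?thesis by (intro exI[of _ "Suc N"] exI[of _ ?z] ballI g)
  qed
qed

section \<open>Nearest point in a compact convex set of combinations\<close>

context psd_form
begin

text \<open>The squared distance is a continuous function of finitely many coefficients on a compact
  set. The last claim is the variational inequality of the nearest point: a small step towards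
  \<open>c\<close> would otherwise shorten the residual.\<close>

lemma density_coeffs_minimizer:
  assumes I: "finite I" and ne: "I \<noteq> {}" and X: "X \<in> S" and Y: "\<And>p. p \<in> I \<times> I \<Longrightarrow> Y p \<in> S"
  defines "R \<equiv> \<lambda>a. X - (\<Sum>p\<in>I \<times> I. a p *\<^sub>R Y p)"
  obtains a where "a \<in> density_coeffs I"
    "\<And>c. c \<in> density_coeffs I \<Longrightarrow> b (R a) (R a) \<le> b (R c) (R c)"
    "\<And>c. c \<in> density_coeffs I \<Longrightarrow> (\<Sum>p\<in>I \<times> I. c p * b (R a) (Y p)) \<le> (\<Sum>p\<in>I \<times> I. a p * b (R a) (Y p))"
proof -
  have SS: "(\<Sum>p\<in>I \<times> I. a p *\<^sub>R Y p) \<in> S" for a using Y by (intro mem(4,5))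
  have RS: "R a \<in> S" for a unfolding R_def using X SS by (intro mem(3))
  have quad: "b (R a) (R a) = b X X - 2 * (\<Sum>p\<in>I \<times> I. a p * b X (Y p))
      + (\<Sum>p\<in>I \<times> I. \<Sum>q\<in>I \<times> I. a p * a q * b (Y p) (Y q))" for a
  proof -
    have "b X (\<Sum>p\<in>I \<times> I. a p *\<^sub>R Y p) = (\<Sum>p\<in>I \<times> I. a p * b X (Y p))"
      using X Y sum_right[of "I \<times> I" "\<lambda>p. a p *\<^sub>R Y p" X] by (simp add: mem(4) scale_right)
    then show ?thesis unfolding R_def using quad_diff[OF X SS, of a] quad_sum[of "I \<times> I" Y a] Y by simp
  qed
  obtain i0 where i0: "i0 \<in> I" using ne by auto
  have nonempty: "density_coeffs I \<noteq> {}"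
  proof -
    have "(\<Sum>i\<in>I. (if i = i0 then 1 else 0 :: real)\<^sup>2) = (\<Sum>i\<in>{i0}. (if i = i0 then 1 else 0 :: real)\<^sup>2)"
      using I i0 by (intro sum.mono_neutral_right) auto
    then show ?thesis using density_coeffs_rank_one[of "\<lambda>i. if i = i0 then 1 else 0" I] by auto
  qed
  have cont: "continuous_on (density_coeffs I) (\<lambda>a. b (R a) (R a))"
    unfolding quad by (intro continuous_intros continuous_on_subset[OF continuous_on_product_coordinates]) auto
  obtain a where a: "a \<in> density_coeffs I"
    and min: "\<And>c. c \<in> density_coeffs I \<Longrightarrow> b (R a) (R a) \<le> b (R c) (R c)"
    using continuous_attains_inf[OF density_coeffs_compact[OF I] nonempty cont] by blast
  have "(\<Sum>p\<in>I \<times> I. c p * b (R a) (Y p)) \<le> (\<Sum>p\<in>I \<times> I. a p * b (R a) (Y p))"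
    if c: "c \<in> density_coeffs I" for c
  proof (rule ccontr)
    assume nle: "\<not> ?thesis"
    define Z where "Z = (\<Sum>p\<in>I \<times> I. (c p - a p) *\<^sub>R Y p)"
    have ZS: "Z \<in> S" unfolding Z_def by (rule SS)
    define t where "t = b (R a) Z"
    have "t = (\<Sum>p\<in>I \<times> I. (c p - a p) * b (R a) (Y p))"
      unfolding t_def Z_def using RS[of a] Y sum_right[of "I \<times> I" "\<lambda>p. (c p - a p) *\<^sub>R Y p" "R a"]
      by (simp add: mem(4) scale_right)
    then have t: "t > 0" using nle by (simp add: left_diff_distrib sum_subtractf)
    define q where "q = b Z Z"
    have q: "q \<ge> 0" unfolding q_def using nonneg[OF ZS] .
    \<comment> \<open>Small enough that the quadratic cost \<open>s * q\<close> stays below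
      \<open>2 * t\<close>; the \<open>+ 1\<close> covers \<open>q = 0\<close>.\<close>
    define s where "s = min 1 (t / (q + 1))"
    have s: "0 < s" "s \<le> 1" "s \<le> t / (q + 1)" unfolding s_def using t q by auto
    let ?e = "\<lambda>p. a p + s * (c p - a p)"
    have "?e \<in> density_coeffs I" using s by (intro density_coeffs_convex a c) auto
    then have "b (R a) (R a) \<le> b (R ?e) (R ?e)" by (rule min)
    moreover have "R ?e = R a - s *\<^sub>R Z"
      unfolding R_def Z_def by (simp add: scaleR_add_left sum.distrib scaleR_right.sum)
    ultimately have "0 \<le> s\<^sup>2 * q - 2 * s * t"
      using RS[of a] ZS unfolding q_def t_def
      by (simp add: quad_diff mem(4) scale_left scale_right power2_eq_square)
    then have "0 \<le> s * (s * q - 2 * t)" by (simp add: power2_eq_square algebra_simps)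
    then have "2 * t \<le> s * q" using s(1) by (simp add: zero_le_mult_iff)
    moreover have "s * q \<le> t"
    proof -
      have "s * q \<le> s * (q + 1)" using s by simp
      also have "\<dots> \<le> t" using s(3) q by (simp add: pos_le_divide_eq)
      finally show ?thesis .
    qed
    ultimately show False using t by simp
  qed
  then show ?thesis using that a min by blast
qed

end

section \<open>Perturbed weights\<close>

lemma transpose_linear: "linear (transpose :: real^'n^'m \<Rightarrow> real^'m^'n)"
  by (rule linearI) (simp_all add: transpose_def vec_eq_iff)

lemma trace_mult_linear: "linear (\<lambda>E::real^'n^'n. trace (D ** E))"
  by (rule linearI)
    (simp_all add: trace_def matrix_matrix_mult_def sum.distrib sum_distrib_left algebra_simps)

lemma sandwich_linear: "linear (\<lambda>E::real^'n^'n. W ** E ** W)"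
  by (rule linearI)
    (simp_all add: vec_eq_iff matrix_matrix_mult_def sum.distrib sum_distrib_left sum_distrib_right algebra_simps)

lemma quad_form_linear: "linear (\<lambda>M::real^'n^'n. v \<bullet> (M *v w))"
  by (rule linearI)
    (simp_all add: inner_vec_def matrix_vector_mult_def sum.distrib sum_distrib_left sum_distrib_right algebra_simps)

lemmas quad_form_simps =
  linear_add[OF quad_form_linear] linear_diff[OF quad_form_linear] linear_scale[OF quad_form_linear]
lemmas transpose_simps =
  linear_add[OF transpose_linear] linear_diff[OF transpose_linear] linear_scale[OF transpose_linear]

context energy_space
begin

definition perturb :: "(real^'n \<Rightarrow> real^'n^'n) \<Rightarrow> real \<Rightarrow> real^'n \<Rightarrow> real^'n^'n" where
  "perturb D t = (\<lambda>x. W x + t *\<^sub>R D x)"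

lemma dominated_fieldD:
  assumes "dominated_field c D"
  shows "D \<in> borel_measurable borel" "transpose (D x) = D x"
    "\<bar>v \<bullet> (D x *v v)\<bar> \<le> c * (v \<bullet> (W x *v v))"
  using assms unfolding dominated_field_def form_dominated_def by auto

lemma W_nonneg: "0 \<le> v \<bullet> (W x *v v)"
  by (rule psdD(2)[OF W_psd])

lemma perturb_psd:
  assumes D: "dominated_field c D" and t: "\<bar>t\<bar> * c \<le> 1"
  shows "psd_field (perturb D t)"
proof -
  have [measurable]: "D \<in> borel_measurable borel" by (rule dominated_fieldD(1)[OF D])
  have "psd (perturb D t x)" for x
  proof -
    have "0 \<le> v \<bullet> (perturb D t x *v v)" for v
    proof -
      have "\<bar>t * (v \<bullet> (D x *v v))\<bar> \<le> \<bar>t\<bar> * (c * (v \<bullet> (W x *v v)))"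
        unfolding abs_mult by (intro mult_left_mono dominated_fieldD(3)[OF D]) simp
      also have "\<dots> \<le> 1 * (v \<bullet> (W x *v v))"
        unfolding mult.assoc[symmetric] by (rule mult_right_mono[OF t W_nonneg])
      finally show ?thesis unfolding perturb_def by (simp add: quad_form_simps abs_le_iff)
    qed
    then show ?thesis
      unfolding psd_def using dominated_fieldD(2)[OF D] psdD(1)[OF W_psd]
      by (simp add: perturb_def transpose_simps)
  qed
  moreover have "perturb D t \<in> borel_measurable borel" unfolding perturb_def by measurable
  ultimately show ?thesis unfolding psd_field_def by simp
qed

lemma perturb_admissible:
  assumes D: "dominated_field c D" and t: "\<bar>t\<bar> * c \<le> 1"
  shows "admissible W (perturb D t)"
proof -
  have "loewner_le (perturb D t x) (2 *\<^sub>R W x)" for x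
  proof -
    \<comment> \<open>The factor 2 works because the defect is the perturbation with the opposite
      sign, which is again positive semidefinite.\<close>
    have "2 *\<^sub>R W x - perturb D t x = perturb D (- t) x"
      unfolding perturb_def by (simp add: scaleR_2)
    moreover have "psd_field (perturb D (- t))" using t by (intro perturb_psd[OF D]) simp
    ultimately show ?thesis unfolding loewner_le_def psd_field_def by simp
  qed
  then show ?thesis unfolding admissible_def using perturb_psd[OF assms] by blast
qed

text \<open>As W' lies between 0 and \<Omega> W, the difference lies between - W and (\<Omega> - 1)
  W; the constant \<open>\<bar>\<Omega>\<bar> + 1\<close> covers both ends and is positive.\<close>

lemma admissible_dominated:
  assumes "admissible W W'"
  obtains c where "c > 0" "dominated_field c (\<lambda>x. W' x - W x)" "W' = perturb (\<lambda>x. W' x - W x) 1"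
proof -
  obtain \<Omega> where W': "psd_field W'" and \<Omega>: "\<And>x. psd (\<Omega> *\<^sub>R W x - W' x)"
    using assms unfolding admissible_def loewner_le_def by auto
  have [measurable]: "W' \<in> borel_measurable borel" using W' unfolding psd_field_def by simp
  have p: "psd (W' x)" for x using W' unfolding psd_field_def by simp
  have "form_dominated (\<bar>\<Omega>\<bar> + 1) (W' x - W x) (W x)" for x
  proof -
    have "\<bar>v \<bullet> ((W' x - W x) *v v)\<bar> \<le> (\<bar>\<Omega>\<bar> + 1) * (v \<bullet> (W x *v v))" for v
    proof -
      have "0 \<le> v \<bullet> (W' x *v v)" by (rule psdD(2)[OF p])
      moreover have "v \<bullet> (W' x *v v) \<le> \<Omega> * (v \<bullet> (W x *v v))"
        using psdD(2)[OF \<Omega>, of v x] by (simp add: quad_form_simps)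
      moreover have "\<Omega> * (v \<bullet> (W x *v v)) \<le> \<bar>\<Omega>\<bar> * (v \<bullet> (W x *v v))"
        by (intro mult_right_mono W_nonneg) simp
      ultimately show ?thesis using W_nonneg[of v x]
        by (simp add: quad_form_simps abs_le_iff algebra_simps)
    qed
    then show ?thesis unfolding form_dominated_def
      using psdD(1)[OF p] psdD(1)[OF W_psd] by (simp add: transpose_simps)
  qed
  then have "dominated_field (\<bar>\<Omega>\<bar> + 1) (\<lambda>x. W' x - W x)" unfolding dominated_field_def by simp
  moreover have "W' = perturb (\<lambda>x. W' x - W x) 1" unfolding perturb_def by simp
  ultimately show ?thesis using that[of "\<bar>\<Omega>\<bar> + 1"] by simp
qed

lemma H1_dominated_integrable:
  assumes D: "dominated_field c D" and f: "f \<in> H1 \<mu> W" and g: "g \<in> H1 \<mu> W"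
  shows "integrable \<mu> (\<lambda>x. wgrad \<mu> f x \<bullet> (D x *v wgrad \<mu> g x))"
  by (rule dominated_integrable[OF D H1D(3)[OF f] H1D(3)[OF g] H1D(4)[OF f] H1D(4)[OF g]])

lemma perturb_dirichlet:
  assumes D: "dominated_field c D" and f: "f \<in> H1 \<mu> W" and g: "g \<in> H1 \<mu> W"
  shows "dirichlet \<mu> (perturb D t) f g = dirichlet \<mu> W f g + t * dirichlet \<mu> D f g"
  using H1_dominated_integrable[OF D f g] H1_dominated_integrable[OF dominated_field_W f g]
  unfolding dirichlet_def perturb_def by (simp add: quad_form_simps)

lemma perturb_H1:
  assumes D: "dominated_field c D" and f: "f \<in> H1 \<mu> W"
  shows "f \<in> H1 \<mu> (perturb D t)"
  using H1_dominated_integrable[OF D f f] H1_dominated_integrable[OF dominated_field_W f f] f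
  unfolding H1_def perturb_def by (simp add: quad_form_simps)

text \<open>The strict bound lets the perturbed energy control the original one with the factor
  \<open>1 - \<bar>t\<bar> * c\<close>. Lower bounds on the perturbed eigenvalue range over all of
  the perturbed space and use the equality; upper bounds use only \<open>perturb_H1\<close>.\<close>

lemma perturb_H1_eq:
  assumes D: "dominated_field c D" and t: "\<bar>t\<bar> * c < 1"
  shows "H1 \<mu> (perturb D t) = H1 \<mu> W"
proof
  show "H1 \<mu> W \<subseteq> H1 \<mu> (perturb D t)" using perturb_H1[OF D] by auto
  show "H1 \<mu> (perturb D t) \<subseteq> H1 \<mu> W"
  proof
    fix f assume f: "f \<in> H1 \<mu> (perturb D t)"
    let ?g = "wgrad \<mu> f"
    have wd: "f \<in> L2 \<mu>" "weakly_differentiable \<mu> f" and i: "integrable \<mu> (\<lambda>x. ?g x \<bullet> (perturb D t x *v ?g x))"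
      using f unfolding H1_def by auto
    obtain g0 where "weak_gradient_of \<mu> f g0" using wd(2) unfolding weakly_differentiable_def by auto
    then have [measurable]: "?g \<in> borel_measurable borel"
      using weak_gradient_of_measurable(2)[OF weak_gradient_of_wgrad] by auto
    define k where "k = 1 - \<bar>t\<bar> * c"
    have k: "k > 0" unfolding k_def using t by simp
    have le: "k * (v \<bullet> (W x *v v)) \<le> v \<bullet> (perturb D t x *v v)" for v x
    proof -
      have "\<bar>t * (v \<bullet> (D x *v v))\<bar> \<le> \<bar>t\<bar> * (c * (v \<bullet> (W x *v v)))"
        unfolding abs_mult by (intro mult_left_mono dominated_fieldD(3)[OF D]) simp
      then show ?thesis unfolding perturb_def k_def by (simp add: quad_form_simps abs_le_iff algebra_simps)
    qed
    have "integrable \<mu> (\<lambda>x. ?g x \<bullet> (W x *v ?g x))"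
    proof (rule Bochner_Integration.integrable_bound)
      show "integrable \<mu> (\<lambda>x. (1 / k) * (?g x \<bullet> (perturb D t x *v ?g x)))" using i by simp
      show "(\<lambda>x. ?g x \<bullet> (W x *v ?g x)) \<in> borel_measurable \<mu>" unfolding measurable_mu by measurable
      show "AE x in \<mu>. norm (?g x \<bullet> (W x *v ?g x)) \<le> norm ((1 / k) * (?g x \<bullet> (perturb D t x *v ?g x)))"
      proof (rule AE_I2)
        fix x
        have "?g x \<bullet> (W x *v ?g x) \<le> (1 / k) * (?g x \<bullet> (perturb D t x *v ?g x))"
          using le[of "?g x" x] k by (simp add: field_simps)
        then show "norm (?g x \<bullet> (W x *v ?g x)) \<le> norm ((1 / k) * (?g x \<bullet> (perturb D t x *v ?g x)))"
          unfolding real_norm_def using W_nonneg[of "?g x" x] by linarith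
      qed
    qed
    then show "f \<in> H1 \<mu> W" using wd unfolding H1_def by simp
  qed
qed

lemma perturb_poincare_upper:
  assumes D: "dominated_field c D" and psd: "psd_field (perturb D t)" and f: "f \<in> H1 \<mu> W"
    and c: "L2_inner \<mu> f (\<lambda>_. 1) = 0" and n: "L2_inner \<mu> f f = n" "n > 0"
  shows "1 / poincare_const \<mu> (perturb D t) \<le> ennreal ((dirichlet \<mu> W f f + t * dirichlet \<mu> D f f) / n)"
proof -
  have v: "variance f = n" using variance_L2[OF H1D(1)[OF f]] c n by simp
  have "0 \<le> dirichlet \<mu> (perturb D t) f f"
    using psd unfolding dirichlet_def psd_field_def psd_def by (intro Bochner_Integration.integral_nonneg) simp
  from poincare_const_upper[OF perturb_H1[OF D f] v n(2) this]
  show ?thesis unfolding perturb_dirichlet[OF D f f] .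
qed

end

section \<open>Spectral data and the perturbed Poincare constant\<close>

locale spectral_space = compact_energy_space \<mu> W for \<mu> :: "(real^'n) measure" and W +
  fixes u :: "nat \<Rightarrow> real^'n \<Rightarrow> real" and lam :: "nat \<Rightarrow> real" and m :: nat
  assumes eigen_basis: "eigen_basis (L2 \<mu>) (H1 \<mu> W) (L2_inner \<mu>) (dirichlet \<mu> W) (\<lambda>_. 1) u lam"
    and gap: "lam 2 > 0" and m: "m \<ge> 1" and level_two: "{i. 1 \<le> i \<and> lam i = lam 2} = {2..m + 1}"
begin

sublocale eb: eigen_basis "L2 \<mu>" "H1 \<mu> W" "L2_inner \<mu>" "dirichlet \<mu> W" "\<lambda>_. 1" u lam
  by (rule eigen_basis)

abbreviation "I \<equiv> {2..m + 1}"

definition comb :: "(nat \<Rightarrow> real) \<Rightarrow> real^'n \<Rightarrow> real" where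
  "comb d = (\<Sum>i\<in>I. d i *\<^sub>R u i)"

lemma comb_apply: "comb d x = (\<Sum>i\<in>I. d i * u i x)"
  unfolding comb_def by (simp add: sum_fun_apply)

lemma u_H1: "i \<in> I \<Longrightarrow> u i \<in> H1 \<mu> W"
  using eb.u_H by simp

lemma comb_H1: "comb d \<in> H1 \<mu> W"
  unfolding comb_def using u_H1 by (intro eb.en.mem(4,5))

lemma I_orthonormal: "eb.ip.orthonormal I u"
  by (rule eb.u_on_sub) auto

lemma comb_norm: "L2_inner \<mu> (comb d) (comb d) = (\<Sum>i\<in>I. (d i)\<^sup>2)"
  unfolding comb_def by (rule eb.ip.comb_quad[OF _ I_orthonormal]) simp

lemma comb_mean: "L2_inner \<mu> (comb d) (\<lambda>_. 1) = 0"
proof -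
  have "L2_inner \<mu> (d i *\<^sub>R u i) (u 1) = 0" if "i \<in> I" for i
    using that eb.u_ip[of i 1] eb.u_L[of i] eb.u_L[of 1] by (simp add: eb.ip.scale_left)
  moreover have "L2_inner \<mu> (comb d) (u 1) = (\<Sum>i\<in>I. L2_inner \<mu> (d i *\<^sub>R u i) (u 1))"
    unfolding comb_def using eb.u_L by (intro eb.ip.sum_left eb.ip.mem(4)) auto
  ultimately have "L2_inner \<mu> (comb d) (u 1) = 0" by simp
  then show ?thesis unfolding eb.u_1 .
qed

lemma I_energy: "i \<in> I \<Longrightarrow> j \<in> I \<Longrightarrow> dirichlet \<mu> W (u i) (u j) = (if i = j then lam 2 else 0)"
proof -
  assume ij: "i \<in> I" "j \<in> I"
  from ij(1) have "i \<in> {i. 1 \<le> i \<and> lam i = lam 2}" unfolding level_two .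
  then show ?thesis using eb.u_energy[of i j] ij by (cases "i = j") auto
qed

text \<open>Centering reduces the Poincare inequality for the perturbed field to mean-zero
  functions, to which the abstract perturbation bound applies.\<close>

lemma perturb_poincare_lower:
  assumes D: "dominated_field c D" and c: "c > 0"
    and M: "\<And>a. M * (\<Sum>i\<in>I. (a i)\<^sup>2) \<le> dirichlet \<mu> D (comb a) (comb a)"
  obtains C t0 where "C \<ge> 0" "t0 > 0"
    "\<And>t. 0 \<le> t \<Longrightarrow> t \<le> t0 \<Longrightarrow> t * c < 1 \<and> 0 < lam 2 + t * M - C * t\<^sup>2 \<and>
      ennreal (lam 2 + t * M - C * t\<^sup>2) \<le> 1 / poincare_const \<mu> (perturb D t)"
proof -
  have lev: "eb.level (lam 2) = I" unfolding eb.level_def by (rule level_two)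
  obtain C t1 where C: "C \<ge> 0" and t1: "t1 > 0" and low:
    "\<And>t f. 0 \<le> t \<Longrightarrow> t \<le> t1 \<Longrightarrow> f \<in> H1 \<mu> W \<Longrightarrow> L2_inner \<mu> f (\<lambda>_. 1) = 0 \<Longrightarrow>
      (lam 2 + t * M - C * t\<^sup>2) * L2_inner \<mu> f f \<le> dirichlet \<mu> W f f + t * dirichlet \<mu> D f f"
    using eb.perturbed_lower_bound[OF dirichlet_sym_form[OF D] dirichlet_dominated[OF D] c gap lev
        M[unfolded comb_def]] by blast
  \<comment> \<open>The four bounds give, in order: the abstract estimate,
    \<open>t\<^sup>2 \<le> t\<close>, at least half of \<open>lam 2\<close> left over as a lower
    bound, and \<open>t * c \<le> 1 / 2\<close>, so that the space \<open>H1\<close> does not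
    change.\<close>
  define t0 where "t0 = Min {t1, 1, lam 2 / (2 * (\<bar>M\<bar> + C + 1)), 1 / (2 * c)}"
  have den: "2 * (\<bar>M\<bar> + C + 1) > 0" using C by simp
  have t0: "t0 > 0" unfolding t0_def using t1 gap den c by simp
  have tle: "t0 \<le> t1" "t0 \<le> 1" "t0 \<le> lam 2 / (2 * (\<bar>M\<bar> + C + 1))" "t0 \<le> 1 / (2 * c)"
    unfolding t0_def by (rule Min_le, simp, simp)+
  have main: "t * c < 1 \<and> 0 < lam 2 + t * M - C * t\<^sup>2 \<and>
      ennreal (lam 2 + t * M - C * t\<^sup>2) \<le> 1 / poincare_const \<mu> (perturb D t)" if t: "0 \<le> t" "t \<le> t0" for t
  proof -
    have "t \<le> 1 / (2 * c)" using t tle by linarith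
    then have "t * c \<le> 1 / 2" using c by (simp add: field_simps)
    then have tc: "t * c < 1" by simp
    have "t \<le> lam 2 / (2 * (\<bar>M\<bar> + C + 1))" using t tle by linarith
    then have "t * (2 * (\<bar>M\<bar> + C + 1)) \<le> lam 2" using den pos_le_divide_eq by blast
    then have "2 * (t * \<bar>M\<bar>) + 2 * (t * C) + 2 * t \<le> lam 2" by (simp add: algebra_simps)
    moreover have "- (t * \<bar>M\<bar>) \<le> t * M" using mult_left_mono[OF _ t(1), of "- \<bar>M\<bar>" M] by (simp add: abs_le_iff)
    moreover have "C * t\<^sup>2 \<le> t * C"
    proof -
      have "t * t \<le> t * 1" using t tle by (intro mult_left_mono) auto
      then have "C * (t * t) \<le> C * t" using C by (intro mult_left_mono) auto
      then show ?thesis by (simp add: power2_eq_square mult.commute)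
    qed
    moreover have "0 \<le> t * \<bar>M\<bar>" "0 \<le> t * C" using t C by auto
    ultimately have pos: "0 < lam 2 + t * M - C * t\<^sup>2" using gap t by linarith
    have "ennreal (lam 2 + t * M - C * t\<^sup>2) \<le> 1 / poincare_const \<mu> (perturb D t)"
    proof (rule poincare_const_lower[OF pos])
      fix f assume "f \<in> H1 \<mu> (perturb D t)"
      then have f: "f \<in> H1 \<mu> W" using perturb_H1_eq[OF D, of t] t tc by simp
      let ?h = "f - L2_inner \<mu> f (\<lambda>_. 1) *\<^sub>R (\<lambda>_. 1)"
      note h = variance_centered[OF f]
      have "(lam 2 + t * M - C * t\<^sup>2) * L2_inner \<mu> ?h ?h \<le> dirichlet \<mu> W ?h ?h + t * dirichlet \<mu> D ?h ?h"
        using t tle by (intro low h(1,2)) auto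
      then show "(lam 2 + t * M - C * t\<^sup>2) * variance f \<le> dirichlet \<mu> (perturb D t) f f"
        unfolding h(3) h(4)[OF D] h(4)[OF dominated_field_W] perturb_dirichlet[OF D f f] .
    qed
    then show ?thesis using tc pos by simp
  qed
  show ?thesis by (rule that[OF C t0 main])
qed

lemma poincare_eq: "1 / poincare_const \<mu> W = ennreal (lam 2)"
proof (rule antisym)
  have D: "dominated_field 1 W" by (rule dominated_field_W)
  \<comment> \<open>The unperturbed upper bound is read off from the general one at
    \<open>t = 0\<close>.\<close>
  have W0: "perturb W 0 = W" unfolding perturb_def by simp
  have u2: "u 2 \<in> H1 \<mu> W" "L2_inner \<mu> (u 2) (\<lambda>_. 1) = 0" "L2_inner \<mu> (u 2) (u 2) = 1" "dirichlet \<mu> W (u 2) (u 2) = lam 2"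
    using eb.u_H[of 2] eb.u_ip[of 2 1, unfolded eb.u_1] eb.u_ip[of 2 2] eb.u_energy[of 2 2] by auto
  show "1 / poincare_const \<mu> W \<le> ennreal (lam 2)"
    using perturb_poincare_upper[OF D, of 0 "u 2" 1] u2 W unfolding W0 by simp
  show "ennreal (lam 2) \<le> 1 / poincare_const \<mu> W"
  proof (rule poincare_const_lower[OF gap])
    fix f assume f: "f \<in> H1 \<mu> W"
    show "lam 2 * variance f \<le> dirichlet \<mu> W f f"
      using eb.rayleigh_lower[OF variance_centered(1,2)[OF f]]
      unfolding variance_centered(3)[OF f] variance_centered(4)[OF f D] .
  qed
qed

end

section \<open>The superdifferential\<close>

lemma measurable_outer2 [measurable (raw)]:
  assumes [measurable]: "p \<in> borel_measurable M" "q \<in> borel_measurable M"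
  shows "(\<lambda>x. outer2 (p x) (q x)) \<in> borel_measurable M"
  unfolding outer2_def by measurable

lemma transpose_outer2: "transpose (outer2 p q) = outer2 q p"
  by (simp add: transpose_def outer2_def vec_eq_iff mult.commute)

context spectral_space
begin

lemma grad_measurable: "i \<in> I \<Longrightarrow> wgrad \<mu> (u i) \<in> borel_measurable borel"
  by (rule H1D(3)[OF u_H1])

definition grad_outer :: "nat \<times> nat \<Rightarrow> real^'n \<Rightarrow> real^'n^'n" where
  "grad_outer p x = outer2 (wgrad \<mu> (u (fst p)) x) (wgrad \<mu> (u (snd p)) x)"

text \<open>The gradient of a combination of the \<open>u i\<close> is chosen separately by
  \<open>wgrad\<close>, so these fields are compared with the generators of the convex hull only
  after sandwiching by \<open>W\<close>.\<close>

definition mix :: "(nat \<times> nat \<Rightarrow> real) \<Rightarrow> real^'n \<Rightarrow> real^'n^'n" where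
  "mix a x = (\<Sum>p\<in>I \<times> I. a p *\<^sub>R grad_outer p x)"

lemma grad_outer_measurable [measurable]: "p \<in> I \<times> I \<Longrightarrow> grad_outer p \<in> borel_measurable borel"
proof -
  assume p: "p \<in> I \<times> I"
  then have [measurable]: "wgrad \<mu> (u (fst p)) \<in> borel_measurable borel" "wgrad \<mu> (u (snd p)) \<in> borel_measurable borel"
    by (auto intro!: grad_measurable)
  show ?thesis unfolding grad_outer_def by measurable
qed

lemma mix_measurable [measurable]: "mix a \<in> borel_measurable borel"
  unfolding mix_def by (intro borel_measurable_sum borel_measurable_scaleR borel_measurable_const grad_outer_measurable)

lemma mix_symmetric:
  assumes "a \<in> density_coeffs I"
  shows "transpose (mix a x) = mix a x"
proof -
  have s: "a (i, j) = a (j, i)" for i j using assms unfolding density_coeffs_def by auto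
  have "transpose (mix a x) = (\<Sum>p\<in>I \<times> I. a p *\<^sub>R outer2 (wgrad \<mu> (u (snd p)) x) (wgrad \<mu> (u (fst p)) x))"
    unfolding mix_def grad_outer_def linear_sum[OF transpose_linear] linear_scale[OF transpose_linear] transpose_outer2 ..
  also have "\<dots> = mix a x"
    unfolding mix_def grad_outer_def
    by (rule sum.reindex_bij_witness[of _ prod.swap prod.swap]) (auto simp: s)
  finally show ?thesis .
qed

lemma trace_mix: "trace (D ** mix a x) = (\<Sum>p\<in>I \<times> I. a p * trace (D ** grad_outer p x))"
  unfolding mix_def linear_sum[OF trace_mult_linear] linear_scale[OF trace_mult_linear] by simp

lemma sandwich_mix: "V ** mix a x ** V = (\<Sum>p\<in>I \<times> I. a p *\<^sub>R (V ** grad_outer p x ** V))"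
  unfolding mix_def linear_sum[OF sandwich_linear] linear_scale[OF sandwich_linear] ..

lemma trace_grad_outer:
  assumes D: "dominated_field c D" and p: "p \<in> I \<times> I"
  shows "integrable \<mu> (\<lambda>x. trace (D x ** grad_outer p x))"
    "(\<integral>x. trace (D x ** grad_outer p x) \<partial>\<mu>) = dirichlet \<mu> D (u (snd p)) (u (fst p))"
  using p H1_dominated_integrable[OF D u_H1 u_H1]
  unfolding dirichlet_def grad_outer_def trace_outer2 by auto

lemma trace_mix_integral:
  assumes D: "dominated_field c D"
  shows "integrable \<mu> (\<lambda>x. trace (D x ** mix a x))"
    "(\<integral>x. trace (D x ** mix a x) \<partial>\<mu>) = (\<Sum>p\<in>I \<times> I. a p * dirichlet \<mu> D (u (snd p)) (u (fst p)))"
proof -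
  have i: "integrable \<mu> (\<lambda>x. a p * trace (D x ** grad_outer p x))" if "p \<in> I \<times> I" for p
    using trace_grad_outer(1)[OF D that] by simp
  show "integrable \<mu> (\<lambda>x. trace (D x ** mix a x))"
    unfolding trace_mix by (intro Bochner_Integration.integrable_sum i)
  have "(\<integral>x. trace (D x ** mix a x) \<partial>\<mu>) = (\<Sum>p\<in>I \<times> I. \<integral>x. a p * trace (D x ** grad_outer p x) \<partial>\<mu>)"
    unfolding trace_mix by (rule Bochner_Integration.integral_sum[OF i])
  also have "\<dots> = (\<Sum>p\<in>I \<times> I. a p * dirichlet \<mu> D (u (snd p)) (u (fst p)))"
    using trace_grad_outer(2)[OF D] by (intro sum.cong refl) simp
  finally show "(\<integral>x. trace (D x ** mix a x) \<partial>\<mu>) = (\<Sum>p\<in>I \<times> I. a p * dirichlet \<mu> D (u (snd p)) (u (fst p)))" .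
qed

text \<open>Splits a coefficient matrix into rank-one parts; any symmetric form paired with it
  becomes a sum of diagonal values at eigenfunctions of total squared norm 1.\<close>

lemma gram_comb:
  assumes a: "a \<in> density_coeffs I"
  obtains N :: nat and z where "\<And>i j. i \<in> I \<Longrightarrow> j \<in> I \<Longrightarrow> a (i, j) = (\<Sum>k<N. z k i * z k j)"
    "(\<Sum>k<N. \<Sum>i\<in>I. (z k i)\<^sup>2) = 1"
    "\<And>B. sym_form (H1 \<mu> W) B \<Longrightarrow>
      (\<Sum>p\<in>I \<times> I. a p * B (u (snd p)) (u (fst p))) = (\<Sum>k<N. B (comb (z k)) (comb (z k)))"
proof -
  have sy: "a (i, j) = a (j, i)" for i j using a unfolding density_coeffs_def by auto
  have psd: "0 \<le> (\<Sum>i\<in>I. \<Sum>j\<in>I. c i * c j * a (i, j))" for c using a unfolding density_coeffs_def by auto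
  have tr: "(\<Sum>i\<in>I. a (i, i)) = 1" using a unfolding density_coeffs_def by auto
  obtain N :: nat and z where z: "\<And>i j. i \<in> I \<Longrightarrow> j \<in> I \<Longrightarrow> a (i, j) = (\<Sum>k<N. z k i * z k j)"
    using gram_decomposition[OF _ sy psd] by blast
  have 1: "(\<Sum>k<N. \<Sum>i\<in>I. (z k i)\<^sup>2) = 1"
    unfolding tr[symmetric] by (subst sum.swap) (simp add: z power2_eq_square)
  have 2: "(\<Sum>p\<in>I \<times> I. a p * B (u (snd p)) (u (fst p))) = (\<Sum>k<N. B (comb (z k)) (comb (z k)))"
    if B: "sym_form (H1 \<mu> W) B" for B
  proof -
    interpret B: sym_form "H1 \<mu> W" B by fact
    have "(\<Sum>k<N. B (comb (z k)) (comb (z k))) = (\<Sum>k<N. \<Sum>i\<in>I. \<Sum>j\<in>I. z k i * z k j * B (u i) (u j))"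
      unfolding comb_def by (intro sum.cong refl B.quad_sum u_H1)
    also have "\<dots> = (\<Sum>i\<in>I. \<Sum>k<N. \<Sum>j\<in>I. z k i * z k j * B (u i) (u j))"
      by (rule sum.swap)
    also have "\<dots> = (\<Sum>i\<in>I. \<Sum>j\<in>I. \<Sum>k<N. z k i * z k j * B (u i) (u j))"
      by (intro sum.cong[OF refl] sum.swap)
    also have "\<dots> = (\<Sum>i\<in>I. \<Sum>j\<in>I. a (i, j) * B (u i) (u j))"
      by (intro sum.cong refl) (simp add: z sum_distrib_right)
    also have "\<dots> = (\<Sum>i\<in>I. \<Sum>j\<in>I. a (i, j) * B (u j) (u i))"
      by (intro sum.cong refl arg_cong2[where f="(*)"] B.sym u_H1)
    finally show ?thesis unfolding sum.cartesian_product by (simp add: case_prod_unfold)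
  qed
  show ?thesis by (rule that[OF z 1 2])
qed

lemma comb_energy: "dirichlet \<mu> W (comb d) (comb d) = lam 2 * (\<Sum>i\<in>I. (d i)\<^sup>2)"
proof -
  have "dirichlet \<mu> W (comb d) (comb d) = (\<Sum>i\<in>I. \<Sum>j\<in>I. d i * d j * dirichlet \<mu> W (u i) (u j))"
    unfolding comb_def by (rule eb.en.quad_sum[OF u_H1])
  also have "\<dots> = (\<Sum>i\<in>I. \<Sum>j\<in>I. if i = j then lam 2 * (d i)\<^sup>2 else 0)"
    by (intro sum.cong refl) (simp add: I_energy power2_eq_square)
  also have "\<dots> = (\<Sum>i\<in>I. lam 2 * (d i)\<^sup>2)" by (intro sum.cong refl) (simp add: sum.delta)
  finally show ?thesis unfolding sum_distrib_left .
qed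

text \<open>Each rank-one part supplies an eigenfunction that serves as test function for
  \<open>W'\<close>; the Rayleigh bounds, averaged with the squared norms as weights, give the
  supergradient inequality. Only upper bounds are involved, so \<open>W'\<close> may be far from
  \<open>W\<close> or degenerate.\<close>

lemma superdiff_mem:
  assumes G: "sym_field G" and a: "a \<in> density_coeffs I"
    and agree: "AE x in \<mu>. W x ** G x ** W x = W x ** mix a x ** W x"
  shows "G \<in> superdiff \<mu> W"
proof -
  have [measurable]: "G \<in> borel_measurable borel" using G unfolding sym_field_def by simp
  have "pairable \<mu> (\<lambda>x. W' x - W x) G \<and>
      enn2ereal (1 / poincare_const \<mu> W') \<le> enn2ereal (1 / poincare_const \<mu> W) + ereal (pairing \<mu> (\<lambda>x. W' x - W x) G)"
    if adm: "admissible W W'" for W'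
  proof -
    obtain c where c: "c > 0" and D: "dominated_field c (\<lambda>x. W' x - W x)" and W': "W' = perturb (\<lambda>x. W' x - W x) 1"
      by (rule admissible_dominated[OF adm])
    define D where "D = (\<lambda>x. W' x - W x)"
    note D = D[folded D_def] and W' = W'[folded D_def]
    have psd: "psd_field (perturb D 1)" using adm unfolding W'[symmetric] admissible_def by simp
    have [measurable]: "D \<in> borel_measurable borel" by (rule dominated_fieldD(1)[OF D])
    have ae: "AE x in \<mu>. trace (D x ** G x) = trace (D x ** mix a x)"
      using agree
    proof eventually_elim
      case (elim x)
      have "trace (D x ** (G x - mix a x)) = 0"
      proof (rule trace_dominated_zero[OF _ W_psd])
        show "form_dominated c (D x) (W x)" using D unfolding dominated_field_def by simp
        show "W x ** (G x - mix a x) ** W x = 0" unfolding linear_diff[OF sandwich_linear] using elim by simp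
      qed
      then show ?case unfolding linear_diff[OF trace_mult_linear] by simp
    qed
    have m: "(\<lambda>x. trace (D x ** G x)) \<in> borel_measurable \<mu>" "(\<lambda>x. trace (D x ** mix a x)) \<in> borel_measurable \<mu>"
      unfolding measurable_mu by measurable
    have pairable: "pairable \<mu> D G"
      unfolding pairable_def using integrable_cong_AE[OF m ae] trace_mix_integral(1)[OF D] by simp
    have pr: "pairing \<mu> D G = (\<Sum>p\<in>I \<times> I. a p * dirichlet \<mu> D (u (snd p)) (u (fst p)))"
      unfolding pairing_def using integral_cong_AE[OF m ae] trace_mix_integral(2)[OF D] by simp
    obtain N :: nat and z where "\<And>i j. i \<in> I \<Longrightarrow> j \<in> I \<Longrightarrow> a (i, j) = (\<Sum>k<N. z k i * z k j)"
      and z: "(\<Sum>k<N. \<Sum>i\<in>I. (z k i)\<^sup>2) = 1"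
      and zB: "\<And>B. sym_form (H1 \<mu> W) B \<Longrightarrow>
        (\<Sum>p\<in>I \<times> I. a p * B (u (snd p)) (u (fst p))) = (\<Sum>k<N. B (comb (z k)) (comb (z k)))"
      by (rule gram_comb[OF a]) (rule that)
    define n where "n k = (\<Sum>i\<in>I. (z k i)\<^sup>2)" for k
    have n0: "n k \<ge> 0" for k unfolding n_def by (simp add: sum_nonneg)
    define e where "e k = lam 2 * n k + dirichlet \<mu> D (comb (z k)) (comb (z k))" for k
    have upper: "1 / poincare_const \<mu> W' \<le> ennreal (e k / n k)" if "n k > 0" for k
      using perturb_poincare_upper[OF D psd comb_H1 comb_mean, of "z k" "n k"] that
      unfolding W'[symmetric] comb_norm comb_energy n_def e_def by simp
    have e0: "e k \<ge> 0" for k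
    proof -
      have "0 \<le> dirichlet \<mu> (perturb D 1) (comb (z k)) (comb (z k))"
        using psd unfolding dirichlet_def psd_field_def psd_def by (intro Bochner_Integration.integral_nonneg) simp
      then show ?thesis unfolding perturb_dirichlet[OF D comb_H1 comb_H1] e_def comb_energy n_def by simp
    qed
    define \<iota> where "\<iota> = enn2real (1 / poincare_const \<mu> W')"
    \<comment> \<open>One part of positive norm makes \<open>1 / poincare_const \<mu> W'\<close>
      finite, so that the average can be taken in the reals.\<close>
    obtain k0 where "n k0 > 0"
    proof -
      have "\<exists>k. n k \<noteq> 0"
      proof (rule ccontr)
        assume "\<not> ?thesis"
        then have "(\<Sum>k<N. n k) = 0" by simp
        then show False using z unfolding n_def by simp
      qed
      then show ?thesis using that n0 by (metis less_le)
    qed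
    from upper[OF this] have fin: "1 / poincare_const \<mu> W' < top" by (rule le_less_trans) simp
    then have \<iota>: "1 / poincare_const \<mu> W' = ennreal \<iota>" unfolding \<iota>_def by simp
    have \<iota>0: "\<iota> \<ge> 0" unfolding \<iota>_def by simp
    \<comment> \<open>The multiplied form of the Rayleigh bound also covers parts of norm 0.\<close>
    have le: "\<iota> * n k \<le> e k" for k
    proof (cases "n k > 0")
      case True
      then have "\<iota> \<le> e k / n k" using upper[OF True] e0[of k] unfolding \<iota> by (simp add: ennreal_le_iff)
      then show ?thesis using True by (simp add: pos_le_divide_eq)
    next
      case False
      then have "n k = 0" using n0[of k] by simp
      then show ?thesis using e0[of k] by simp
    qed
    have sn: "(\<Sum>k<N. n k) = 1" unfolding n_def by (rule z)
    have "\<iota> = (\<Sum>k<N. \<iota> * n k)" unfolding sum_distrib_left[symmetric] sn by simp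
    also have "\<dots> \<le> (\<Sum>k<N. e k)" by (intro sum_mono le)
    also have "\<dots> = lam 2 + pairing \<mu> D G"
      unfolding pr zB[OF dirichlet_sym_form[OF D]] e_def sum.distrib sum_distrib_left[symmetric] sn by simp
    finally have "ereal \<iota> \<le> ereal (lam 2 + pairing \<mu> D G)" by simp
    then show ?thesis
      using pairable \<iota>0 gap unfolding D_def[symmetric] \<iota> poincare_eq by (simp add: enn2ereal_ennreal)
  qed
  then show ?thesis unfolding superdiff_def using G by simp
qed

end

section \<open>A weighted square-mean distance between fields\<close>

lemma trace_scale_left: "trace ((k *\<^sub>R A) ** B) = k * trace (A ** B)" for A B :: "real^'n^'n"
  by (simp add: trace_def matrix_matrix_mult_def sum_distrib_left mult.assoc)

text \<open>A carrier on which all pairings are finite; the weighted fields belong to it.\<close>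

definition bounded_fields :: "(real^'n \<Rightarrow> real^'n^'n) set" where
  "bounded_fields = {F. F \<in> borel_measurable borel \<and> (\<exists>C. \<forall>x. norm (F x) \<le> C)}"

definition field_inner :: "(real^'n) measure \<Rightarrow> (real^'n \<Rightarrow> real^'n^'n) \<Rightarrow> (real^'n \<Rightarrow> real^'n^'n) \<Rightarrow> real" where
  "field_inner \<mu> F K = (\<integral>x. F x \<bullet> K x \<partial>\<mu>)"

context energy_space
begin

lemma bounded_fields_integrable:
  assumes "F \<in> bounded_fields" "K \<in> bounded_fields"
  shows "integrable \<mu> (\<lambda>x. F x \<bullet> K x)"
proof -
  obtain A B where A: "\<And>x. norm (F x) \<le> A" and B: "\<And>x. norm (K x) \<le> B"
    using assms unfolding bounded_fields_def by auto
  have [measurable]: "F \<in> borel_measurable borel" "K \<in> borel_measurable borel"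
    using assms unfolding bounded_fields_def by auto
  show ?thesis
  proof (rule integrable_const_bound[of _ "A * B"])
    show "(\<lambda>x. F x \<bullet> K x) \<in> borel_measurable \<mu>" unfolding measurable_mu by measurable
    show "AE x in \<mu>. norm (F x \<bullet> K x) \<le> A * B"
    proof (rule AE_I2)
      fix x
      have "norm (F x \<bullet> K x) \<le> norm (F x) * norm (K x)" using Cauchy_Schwarz_ineq2 by simp
      also have "\<dots> \<le> A * B" using A[of x] B[of x] norm_ge_zero[of "F x"] by (intro mult_mono) (auto intro: order.trans[OF norm_ge_zero])
      finally show "norm (F x \<bullet> K x) \<le> A * B" .
    qed
  qed
qed

lemma bounded_fields_psd_form: "psd_form bounded_fields (field_inner \<mu>)"
proof
  show "subspace (bounded_fields :: (real^'n \<Rightarrow> real^'n^'n) set)"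
  proof (rule subspaceI)
    show "0 \<in> (bounded_fields :: (real^'n \<Rightarrow> real^'n^'n) set)" unfolding bounded_fields_def zero_fun_def by auto
    show "F + K \<in> bounded_fields" if FK: "F \<in> bounded_fields" "K \<in> bounded_fields" for F K :: "real^'n \<Rightarrow> real^'n^'n"
    proof -
      obtain A B where "\<And>x. norm (F x) \<le> A" "\<And>x. norm (K x) \<le> B"
        using FK unfolding bounded_fields_def by auto
      then have "norm ((F + K) x) \<le> A + B" for x by (simp add: norm_triangle_le add_mono)
      then show ?thesis using FK unfolding bounded_fields_def plus_fun_def by auto
    qed
    show "c *\<^sub>R F \<in> bounded_fields" if F: "F \<in> bounded_fields" for F :: "real^'n \<Rightarrow> real^'n^'n" and c
    proof -
      obtain A where "\<And>x. norm (F x) \<le> A" using F unfolding bounded_fields_def by auto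
      then have "norm ((c *\<^sub>R F) x) \<le> \<bar>c\<bar> * A" for x by (simp add: mult_left_mono)
      then show ?thesis using F unfolding bounded_fields_def scaleR_fun_def by auto
    qed
  qed
  show "field_inner \<mu> F K = field_inner \<mu> K F" for F K
    unfolding field_inner_def by (simp add: inner_commute)
  show "field_inner \<mu> (F + K) J = field_inner \<mu> F J + field_inner \<mu> K J"
    if "F \<in> bounded_fields" "K \<in> bounded_fields" "J \<in> bounded_fields" for F K J
    using that unfolding field_inner_def by (simp add: inner_add_left bounded_fields_integrable)
  show "field_inner \<mu> (c *\<^sub>R F) J = c * field_inner \<mu> F J" for F J c
    unfolding field_inner_def by simp
  show "0 \<le> field_inner \<mu> F F" for F
    unfolding field_inner_def by simp
qed

lemma field_inner_null:
  assumes "F \<in> bounded_fields" "field_inner \<mu> F F \<le> 0"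
  shows "AE x in \<mu>. F x = 0"
proof -
  have "field_inner \<mu> F F = 0"
    using assms psd_form.nonneg[OF bounded_fields_psd_form assms(1)] by simp
  then have "AE x in \<mu>. F x \<bullet> F x = 0"
    unfolding field_inner_def using bounded_fields_integrable[OF assms(1) assms(1)]
    by (subst (asm) integral_nonneg_eq_0_iff_AE) auto
  then show ?thesis by simp
qed

end

context spectral_space
begin

text \<open>The weight makes all sandwiched fields bounded, so that \<open>G - mix a\<close> can be minimised in a
  quadratic mean although neither field need be square integrable.\<close>

definition grad_size :: "real^'n \<Rightarrow> real" where
  "grad_size x = (\<Sum>i\<in>I. (norm (wgrad \<mu> (u i) x))\<^sup>2)"

text \<open>The first factor absorbs the two multiplications by \<open>W x\<close>, the second
  bounds \<open>G\<close> and all products of gradients. The weight is positive everywhere, so a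
  vanishing weighted residual still means equal sandwiches.\<close>

definition weight :: "(real^'n \<Rightarrow> real^'n^'n) \<Rightarrow> real^'n \<Rightarrow> real" where
  "weight G x = 1 / ((1 + norm (W x))\<^sup>2 * (1 + norm (G x) + grad_size x))"

definition weighted :: "(real^'n \<Rightarrow> real^'n^'n) \<Rightarrow> (real^'n \<Rightarrow> real^'n^'n) \<Rightarrow> real^'n \<Rightarrow> real^'n^'n" where
  "weighted G F = (\<lambda>x. weight G x *\<^sub>R (W x ** F x ** W x))"

definition residual :: "(real^'n \<Rightarrow> real^'n^'n) \<Rightarrow> (nat \<times> nat \<Rightarrow> real) \<Rightarrow> real^'n \<Rightarrow> real^'n^'n" where
  "residual G a = weighted G G - (\<Sum>p\<in>I \<times> I. a p *\<^sub>R weighted G (grad_outer p))"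

lemma grad_size_nonneg: "0 \<le> grad_size x"
  unfolding grad_size_def by (intro sum_nonneg) simp

lemma weight_bounds:
  "0 < weight G x" "weight G x * norm (W x) \<le> 1"
  "weight G x * (norm (W x))\<^sup>2 * (1 + norm (G x) + grad_size x) \<le> 1"
  "weight G x * (norm (W x))\<^sup>2 \<le> 1"
proof -
  let ?w = "norm (W x)" and ?s = "1 + norm (G x) + grad_size x"
  have s: "1 \<le> ?s" using grad_size_nonneg[of x] by simp
  have q: "1 \<le> (1 + ?w)\<^sup>2" "?w\<^sup>2 \<le> (1 + ?w)\<^sup>2" by (auto intro!: one_le_power power_mono)
  have q': "?w \<le> (1 + ?w)\<^sup>2"
    using zero_le_power2[of ?w] norm_ge_zero[of "W x"] by (simp add: power2_sum)
  have d: "0 < (1 + ?w)\<^sup>2 * ?s" 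
    by (rule mult_pos_pos[OF less_le_trans[OF zero_less_one q(1)] less_le_trans[OF zero_less_one s]])
  show w: "0 < weight G x" unfolding weight_def using d by simp
  have "?w \<le> (1 + ?w)\<^sup>2 * ?s" using mult_mono[OF q' s] by simp
  then show "weight G x * ?w \<le> 1" unfolding weight_def using d by simp
  have "?w\<^sup>2 * ?s \<le> (1 + ?w)\<^sup>2 * ?s" using q s by (intro mult_right_mono) auto
  then have "?w\<^sup>2 * ?s / ((1 + ?w)\<^sup>2 * ?s) \<le> 1" unfolding pos_divide_le_eq[OF d] by simp
  then show 3: "weight G x * ?w\<^sup>2 * ?s \<le> 1" unfolding weight_def by (simp only: times_divide_eq_left mult_1)
  have "weight G x * ?w\<^sup>2 * 1 \<le> weight G x * ?w\<^sup>2 * ?s" using w s by (intro mult_left_mono) auto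
  then show "weight G x * ?w\<^sup>2 \<le> 1" using 3 by linarith
qed

lemma weight_measurable:
  assumes "sym_field G"
  shows "weight G \<in> borel_measurable borel"
proof -
  have [measurable]: "G \<in> borel_measurable borel" using assms unfolding sym_field_def by simp
  have [measurable]: "grad_size \<in> borel_measurable borel"
    unfolding grad_size_def
    by (intro borel_measurable_sum borel_measurable_power measurable_compose[OF grad_measurable borel_measurable_norm])
  show ?thesis unfolding weight_def by measurable
qed

lemma norm_sandwich_le: "norm (V ** F ** V) \<le> (norm V)\<^sup>2 * norm (F :: real^'n^'n)"
proof -
  have "norm (V ** F ** V) \<le> norm (V ** F) * norm V" by (rule norm_matrix_matrix_le)
  also have "\<dots> \<le> (norm V * norm F) * norm V" by (intro mult_right_mono norm_matrix_matrix_le) simp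
  finally show ?thesis by (simp add: power2_eq_square algebra_simps)
qed

text \<open>The weighted sandwich is a contraction, hence approximation in the L2 norm of fields
  implies approximation in the weighted distance.\<close>

lemma weighted_le: "norm (weighted G F x) \<le> norm (F x)"
proof -
  have "norm (weighted G F x) \<le> weight G x * ((norm (W x))\<^sup>2 * norm (F x))"
    unfolding weighted_def using norm_sandwich_le[of "W x" "F x"] weight_bounds(1)[of G x] by simp
  also have "\<dots> = (weight G x * (norm (W x))\<^sup>2) * norm (F x)" by simp
  also have "\<dots> \<le> 1 * norm (F x)" by (intro mult_right_mono weight_bounds(4)) simp
  finally show ?thesis by simp
qed

lemma weighted_bounded:
  assumes G: "sym_field G" and F: "F \<in> borel_measurable borel"
    and le: "\<And>x. norm (F x) \<le> 1 + norm (G x) + grad_size x"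
  shows "weighted G F \<in> bounded_fields"
proof -
  have [measurable]: "F \<in> borel_measurable borel" "weight G \<in> borel_measurable borel"
    using F weight_measurable[OF G] by auto
  have "norm (weighted G F x) \<le> 1" for x
  proof -
    have "norm (weighted G F x) \<le> weight G x * ((norm (W x))\<^sup>2 * norm (F x))"
      unfolding weighted_def using norm_sandwich_le[of "W x" "F x"] weight_bounds(1)[of G x] by simp
    also have "\<dots> \<le> weight G x * ((norm (W x))\<^sup>2 * (1 + norm (G x) + grad_size x))"
      using weight_bounds(1)[of G x] le[of x] by (intro mult_left_mono) auto
    also have "\<dots> \<le> 1" using weight_bounds(3)[of G x] by (simp only: mult.assoc)
    finally show ?thesis .
  qed
  moreover have "weighted G F \<in> borel_measurable borel" unfolding weighted_def by measurable
  ultimately show ?thesis unfolding bounded_fields_def by auto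
qed

lemma norm_grad_outer_le:
  assumes "p \<in> I \<times> I"
  shows "norm (grad_outer p x) \<le> grad_size x"
proof -
  let ?n = "\<lambda>i. norm (wgrad \<mu> (u i) x)"
  have le: "(?n i)\<^sup>2 \<le> grad_size x" if "i \<in> I" for i
    unfolding grad_size_def by (rule member_le_sum[OF that]) auto
  have "0 \<le> (?n (fst p) - ?n (snd p))\<^sup>2" by simp
  then have "2 * (?n (fst p) * ?n (snd p)) \<le> (?n (fst p))\<^sup>2 + (?n (snd p))\<^sup>2" by (simp add: power2_diff)
  moreover have "(?n (fst p))\<^sup>2 \<le> grad_size x" "(?n (snd p))\<^sup>2 \<le> grad_size x"
    using assms by (auto simp del: One_nat_def intro!: le)
  ultimately show ?thesis unfolding grad_outer_def norm_outer2 by linarith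
qed

lemma weighted_mem:
  assumes G: "sym_field G"
  shows "weighted G G \<in> bounded_fields" "p \<in> I \<times> I \<Longrightarrow> weighted G (grad_outer p) \<in> bounded_fields"
proof -
  show "weighted G G \<in> bounded_fields"
    using G grad_size_nonneg unfolding sym_field_def by (intro weighted_bounded[OF G]) auto
  show "weighted G (grad_outer p) \<in> bounded_fields" if p: "p \<in> I \<times> I"
  proof (rule weighted_bounded[OF G grad_outer_measurable[OF p]])
    fix x show "norm (grad_outer p x) \<le> 1 + norm (G x) + grad_size x"
      using norm_grad_outer_le[OF p, of x] norm_ge_zero[of "G x"] by linarith
  qed
qed

lemma residual_apply: "residual G a x = weight G x *\<^sub>R (W x ** (G x - mix a x) ** W x)"
  unfolding residual_def weighted_def linear_diff[OF sandwich_linear] sandwich_mix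
  by (simp add: sum_fun_apply scaleR_diff_right scaleR_right.sum algebra_simps)

lemma residual_mem:
  assumes G: "sym_field G"
  shows "residual G a \<in> bounded_fields"
proof -
  interpret b: psd_form "bounded_fields :: (real^'n \<Rightarrow> real^'n^'n) set" "field_inner \<mu>" by (rule bounded_fields_psd_form)
  show ?thesis unfolding residual_def by (intro b.mem(3,4,5) weighted_mem[OF G])
qed

lemma residual_null:
  assumes G: "sym_field G" and z: "field_inner \<mu> (residual G a) (residual G a) \<le> 0"
  shows "AE x in \<mu>. W x ** G x ** W x = W x ** mix a x ** W x"
  using field_inner_null[OF residual_mem[OF G] z]
proof eventually_elim
  case (elim x)
  then have "W x ** (G x - mix a x) ** W x = 0"
    unfolding residual_apply using weight_bounds(1)[of G x] by simp
  then show ?case unfolding linear_diff[OF sandwich_linear] by simp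
qed

lemma best_mix:
  assumes G: "sym_field G"
  obtains a where "a \<in> density_coeffs I"
    "\<And>c. c \<in> density_coeffs I \<Longrightarrow>
      field_inner \<mu> (residual G a) (residual G a) \<le> field_inner \<mu> (residual G c) (residual G c)"
    "\<And>c. c \<in> density_coeffs I \<Longrightarrow>
      (\<Sum>p\<in>I \<times> I. c p * field_inner \<mu> (residual G a) (weighted G (grad_outer p)))
      \<le> (\<Sum>p\<in>I \<times> I. a p * field_inner \<mu> (residual G a) (weighted G (grad_outer p)))"
proof (rule psd_form.density_coeffs_minimizer[OF bounded_fields_psd_form,
      of I "weighted G G" "\<lambda>p. weighted G (grad_outer p)", folded residual_def])
  show "finite I" "I \<noteq> {}" using m by auto
  show "weighted G G \<in> bounded_fields" by (rule weighted_mem(1)[OF G])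
  show "weighted G (grad_outer p) \<in> bounded_fields" if "p \<in> I \<times> I" for p
    by (rule weighted_mem(2)[OF G that])
qed (rule that)

lemma residual_quad:
  assumes G: "sym_field G"
  shows "field_inner \<mu> (residual G a) (residual G a) = field_inner \<mu> (residual G a) (weighted G G)
    - (\<Sum>p\<in>I \<times> I. a p * field_inner \<mu> (residual G a) (weighted G (grad_outer p)))"
proof -
  interpret b: psd_form "bounded_fields :: (real^'n \<Rightarrow> real^'n^'n) set" "field_inner \<mu>" by (rule bounded_fields_psd_form)
  note w = weighted_mem[OF G] and r = residual_mem[OF G, of a]
  have s: "(\<Sum>p\<in>I \<times> I. a p *\<^sub>R weighted G (grad_outer p)) \<in> bounded_fields"
    by (intro b.mem(4,5) w)
  have "field_inner \<mu> (residual G a) (residual G a) = field_inner \<mu> (residual G a) (weighted G G)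
      - field_inner \<mu> (residual G a) (\<Sum>p\<in>I \<times> I. a p *\<^sub>R weighted G (grad_outer p))"
    by (subst (2) residual_def) (rule b.diff_right[OF w(1) s r])
  also have "field_inner \<mu> (residual G a) (\<Sum>p\<in>I \<times> I. a p *\<^sub>R weighted G (grad_outer p))
      = (\<Sum>p\<in>I \<times> I. field_inner \<mu> (residual G a) (a p *\<^sub>R weighted G (grad_outer p)))"
    by (rule b.sum_right[OF b.mem(4)[OF w(2)] r])
  also have "\<dots> = (\<Sum>p\<in>I \<times> I. a p * field_inner \<mu> (residual G a) (weighted G (grad_outer p)))"
    by (intro sum.cong refl b.scale_right w r)
  finally show ?thesis .
qed

definition rank_one :: "(nat \<Rightarrow> real) \<Rightarrow> nat \<times> nat \<Rightarrow> real" where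
  "rank_one d = (\<lambda>(i, j). if i \<in> I \<and> j \<in> I then d i * d j / (\<Sum>i\<in>I. (d i)\<^sup>2) else 0)"

lemma rank_one_density:
  assumes n: "(\<Sum>i\<in>I. (d i)\<^sup>2) > 0"
  shows "rank_one d \<in> density_coeffs I"
proof -
  define n where "n = (\<Sum>i\<in>I. (d i)\<^sup>2)"
  have np: "n > 0" unfolding n_def by (rule assms)
  let ?d = "\<lambda>i. d i / sqrt n"
  have "(\<Sum>i\<in>I. (?d i)\<^sup>2) = (\<Sum>i\<in>I. (d i)\<^sup>2 / n)"
    using np by (intro sum.cong refl) (simp add: power_divide)
  also have "\<dots> = 1" unfolding sum_divide_distrib[symmetric] n_def[symmetric] using np by simp
  finally have "(\<lambda>(i, j). if i \<in> I \<and> j \<in> I then ?d i * ?d j else 0) \<in> density_coeffs I"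
    by (rule density_coeffs_rank_one)
  moreover have "(\<lambda>(i, j). if i \<in> I \<and> j \<in> I then ?d i * ?d j else 0) = rank_one d"
    unfolding rank_one_def n_def[symmetric] using np by (auto simp: fun_eq_iff)
  ultimately show ?thesis by simp
qed

text \<open>Testing a supergradient \<open>G\<close> against the perturbation in the direction of the residual of its
  best approximation forces the residual to vanish.\<close>

lemma superdiff_rep:
  assumes Gs: "G \<in> superdiff \<mu> W"
  shows "\<exists>a\<in>density_coeffs I. AE x in \<mu>. W x ** G x ** W x = W x ** mix a x ** W x"
proof -
  have G: "sym_field G" using Gs unfolding superdiff_def by simp
  have [measurable]: "G \<in> borel_measurable borel" "weight G \<in> borel_measurable borel"
    using G weight_measurable[OF G] unfolding sym_field_def by auto
  obtain a where a: "a \<in> density_coeffs I"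
    and opt: "\<And>c. c \<in> density_coeffs I \<Longrightarrow>
      (\<Sum>p\<in>I \<times> I. c p * field_inner \<mu> (residual G a) (weighted G (grad_outer p)))
      \<le> (\<Sum>p\<in>I \<times> I. a p * field_inner \<mu> (residual G a) (weighted G (grad_outer p)))"
    by (rule best_mix[OF G]) (rule that)
  define R where "R = residual G a"
  define Y where "Y p = field_inner \<mu> R (weighted G (grad_outer p))" for p
  \<comment> \<open>\<open>y\<close> and \<open>x0\<close> pair the residual with its nearest point
    and with \<open>G\<close>; by \<open>residual_quad\<close> the squared norm of the residual is
    \<open>x0 - y\<close>, so it remains to show \<open>x0 \<le> y\<close>.\<close>
  define y where "y = (\<Sum>p\<in>I \<times> I. a p * Y p)"
  define x0 where "x0 = field_inner \<mu> R (weighted G G)"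
  have RS: "R \<in> bounded_fields" unfolding R_def by (rule residual_mem[OF G])
  then have [measurable]: "R \<in> borel_measurable borel" unfolding bounded_fields_def by simp
  obtain C0 where "\<And>x. norm (R x) \<le> C0" using RS unfolding bounded_fields_def by auto
  \<comment> \<open>The maximum with 1 makes the domination constant positive, as the perturbation
    estimate requires.\<close>
  then have C0: "norm (R x) \<le> max C0 1" for x by (simp add: le_max_iff_disj)
  define C1 where "C1 = max C0 1"
  have C1: "C1 > 0" unfolding C1_def by simp
  have sG: "transpose (G x) = G x" for x using G unfolding sym_field_def by simp
  have sW: "transpose (W x) = W x" for x by (rule psdD(1)[OF W_psd])
  have sR: "transpose (R x) = R x" for x
    unfolding R_def residual_apply using transpose_sandwich[OF sW, of "G x - mix a x" x]
    by (simp add: transpose_simps sG mix_symmetric[OF a])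
  \<comment> \<open>The weight bounds \<open>D\<close> by a constant multiple of \<open>W\<close>;
    by \<open>trace_sandwich\<close>, pairing with \<open>D\<close> is minus the weighted inner
    product with \<open>R\<close>.\<close>
  define D where "D x = - weight G x *\<^sub>R (W x ** R x ** W x)" for x
  have D: "dominated_field C1 D"
  proof -
    have "form_dominated C1 (D x) (W x)" for x
    proof -
      have f: "form_dominated (norm (R x) * norm (W x)) (W x ** R x ** W x) (W x)"
        by (rule dominated_sandwich[OF W_psd sR])
      have "\<bar>v \<bullet> (D x *v v)\<bar> \<le> C1 * (v \<bullet> (W x *v v))" for v
      proof -
        have "\<bar>v \<bullet> (D x *v v)\<bar> = weight G x * \<bar>v \<bullet> ((W x ** R x ** W x) *v v)\<bar>"
          unfolding D_def quad_form_simps using weight_bounds(1)[of G x] by (simp add: abs_mult)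
        also have "\<dots> \<le> weight G x * (norm (R x) * norm (W x) * (v \<bullet> (W x *v v)))"
          using f weight_bounds(1)[of G x] unfolding form_dominated_def by (intro mult_left_mono) auto
        also have "\<dots> = (weight G x * norm (W x)) * (norm (R x) * (v \<bullet> (W x *v v)))" by simp
        also have "\<dots> \<le> 1 * (norm (R x) * (v \<bullet> (W x *v v)))"
          using W_nonneg[of v x] by (intro mult_right_mono weight_bounds(2)) auto
        also have "\<dots> \<le> C1 * (v \<bullet> (W x *v v))"
          using C0[of x] W_nonneg[of v x] unfolding C1_def by (simp add: mult_right_mono)
        finally show ?thesis .
      qed
      moreover have "transpose (D x) = D x"
        unfolding D_def linear_scale[OF transpose_linear] transpose_sandwich[OF sW sR] ..
      ultimately show ?thesis unfolding form_dominated_def by blast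
    qed
    moreover have "D \<in> borel_measurable borel" unfolding D_def[abs_def] by measurable
    ultimately show ?thesis unfolding dominated_field_def by blast
  qed
  have tr: "trace (D x ** F x) = - (R x \<bullet> weighted G F x)" for F x
  proof -
    have "trace (D x ** F x) = - weight G x * trace ((W x ** R x ** W x) ** F x)"
      unfolding D_def by (rule trace_scale_left)
    then show ?thesis unfolding trace_sandwich[OF sR] weighted_def by simp
  qed
  have DY: "dirichlet \<mu> D (u (snd p)) (u (fst p)) = - Y p" if "p \<in> I \<times> I" for p
    using trace_grad_outer(2)[OF D that] unfolding tr Y_def field_inner_def by simp
  \<comment> \<open>Normalised eigenfunctions correspond to rank-one coefficient matrices, on which
    optimality of \<open>a\<close> bounds the pairing with \<open>R\<close> by
    \<open>y\<close>.\<close>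
  have M: "- y * (\<Sum>i\<in>I. (d i)\<^sup>2) \<le> dirichlet \<mu> D (comb d) (comb d)" for d
  proof -
    interpret B: sym_form "H1 \<mu> W" "dirichlet \<mu> D" by (rule dirichlet_sym_form[OF D])
    have "dirichlet \<mu> D (comb d) (comb d) = (\<Sum>i\<in>I. \<Sum>j\<in>I. d i * d j * dirichlet \<mu> D (u i) (u j))"
      unfolding comb_def by (rule B.quad_sum[OF u_H1])
    also have "\<dots> = (\<Sum>i\<in>I. \<Sum>j\<in>I. - (d i * d j * Y (i, j)))"
    proof (intro sum.cong refl)
      fix i j assume ij: "i \<in> I" "j \<in> I"
      show "d i * d j * dirichlet \<mu> D (u i) (u j) = - (d i * d j * Y (i, j))"
        using DY[of "(i, j)"] B.sym[OF u_H1[OF ij(1)] u_H1[OF ij(2)]] ij by simp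
    qed
    also have "\<dots> = - (\<Sum>p\<in>I \<times> I. d (fst p) * d (snd p) * Y p)"
      unfolding sum.cartesian_product by (simp add: sum_negf case_prod_unfold)
    finally have E: "dirichlet \<mu> D (comb d) (comb d) = - (\<Sum>p\<in>I \<times> I. d (fst p) * d (snd p) * Y p)" .
    define n where "n = (\<Sum>i\<in>I. (d i)\<^sup>2)"
    have n0: "n \<ge> 0" unfolding n_def by (simp add: sum_nonneg)
    have "(\<Sum>p\<in>I \<times> I. d (fst p) * d (snd p) * Y p) \<le> y * n"
    proof (cases "n = 0")
      case True
      then have "d i = 0" if "i \<in> I" for i
        using that sum_nonneg_eq_0_iff[of I "\<lambda>i. (d i)\<^sup>2"] unfolding n_def by simp
      then have "(\<Sum>p\<in>I \<times> I. d (fst p) * d (snd p) * Y p) = 0" by (intro sum.neutral) auto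
      then show ?thesis using True by simp
    next
      case False
      then have np: "n > 0" using n0 by simp
      from opt[OF rank_one_density[OF np[unfolded n_def]]]
      have "(\<Sum>p\<in>I \<times> I. rank_one d p * Y p) \<le> y" unfolding Y_def y_def R_def .
      moreover have "(\<Sum>p\<in>I \<times> I. rank_one d p * Y p) = (\<Sum>p\<in>I \<times> I. d (fst p) * d (snd p) * Y p / n)"
        unfolding rank_one_def n_def[symmetric] by (intro sum.cong refl) auto
      ultimately have "(\<Sum>p\<in>I \<times> I. d (fst p) * d (snd p) * Y p) / n \<le> y"
        unfolding sum_divide_distrib by simp
      then show ?thesis using np by (simp add: pos_divide_le_eq)
    qed
    then show ?thesis unfolding E n_def[symmetric] by simp
  qed
  obtain C t0 where C: "C \<ge> 0" and t0: "t0 > 0" and low: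
    "\<And>t. 0 \<le> t \<Longrightarrow> t \<le> t0 \<Longrightarrow> t * C1 < 1 \<and> 0 < lam 2 + t * - y - C * t\<^sup>2 \<and>
      ennreal (lam 2 + t * - y - C * t\<^sup>2) \<le> 1 / poincare_const \<mu> (perturb D t)"
    by (rule perturb_poincare_lower[OF D C1 M]) (rule that)
  \<comment> \<open>The lower bound from the perturbation estimate meets the upper bound from the
    supergradient inequality; \<open>lam 2\<close> cancels and \<open>t\<close> is divided
    out.\<close>
  have key: "- y - C * t \<le> - x0" if t: "0 < t" "t \<le> t0" for t
  proof -
    have l: "t * C1 < 1" "0 < lam 2 + t * - y - C * t\<^sup>2"
      "ennreal (lam 2 + t * - y - C * t\<^sup>2) \<le> 1 / poincare_const \<mu> (perturb D t)"
      using low[of t] t by auto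
    have "admissible W (perturb D t)" using l(1) t by (intro perturb_admissible[OF D]) simp
    then have sup: "enn2ereal (1 / poincare_const \<mu> (perturb D t))
        \<le> enn2ereal (1 / poincare_const \<mu> W) + ereal (pairing \<mu> (\<lambda>x. perturb D t x - W x) G)"
      using Gs unfolding superdiff_def by blast
    have "pairing \<mu> (\<lambda>x. perturb D t x - W x) G = (\<integral>x. t * trace (D x ** G x) \<partial>\<mu>)"
      unfolding pairing_def perturb_def
      by (intro Bochner_Integration.integral_cong refl) (simp add: trace_scale_left)
    also have "\<dots> = t * - x0" unfolding tr x0_def field_inner_def by simp
    finally have pr: "pairing \<mu> (\<lambda>x. perturb D t x - W x) G = t * - x0" .
    have "ereal (lam 2 + t * - y - C * t\<^sup>2) = enn2ereal (ennreal (lam 2 + t * - y - C * t\<^sup>2))"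
      using l(2) by (simp add: enn2ereal_ennreal)
    also have "\<dots> \<le> enn2ereal (1 / poincare_const \<mu> (perturb D t))"
      using l(3) unfolding less_eq_ennreal.rep_eq .
    also have "\<dots> \<le> ereal (lam 2 + t * - x0)"
      using sup gap unfolding pr poincare_eq by (simp add: enn2ereal_ennreal)
    finally have "t * - y - C * t\<^sup>2 \<le> t * - x0" by simp
    then have "t * (- y - C * t) \<le> t * - x0" by (simp add: power2_eq_square algebra_simps)
    then show ?thesis using t(1) by (rule mult_left_le_imp_le)
  qed
  have "x0 \<le> y"
  proof (rule field_le_epsilon)
    fix e :: real assume e: "e > 0"
    define t where "t = min t0 (e / (C + 1))"
    have t: "0 < t" "t \<le> t0" "t \<le> e / (C + 1)" unfolding t_def using t0 e C by auto
    have "t * (C + 1) \<le> e" using t(3) C by (simp add: pos_le_divide_eq)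
    then have "C * t \<le> e" using t(1) by (simp add: algebra_simps)
    then show "x0 \<le> y + e" using key[OF t(1,2)] by simp
  qed
  then have "field_inner \<mu> (residual G a) (residual G a) \<le> 0"
    unfolding residual_quad[OF G] x0_def y_def Y_def R_def by simp
  from residual_null[OF G this] show ?thesis using a by blast
qed

end

lemma weak_gradient_of_sum:
  assumes "finite J" "\<And>i. i \<in> J \<Longrightarrow> weak_gradient_of \<mu> (v i) (h i)"
  shows "weak_gradient_of \<mu> (\<lambda>x. \<Sum>i\<in>J. d i * v i x) (\<lambda>x. \<Sum>i\<in>J. d i *\<^sub>R h i x)"
  using assms
proof (induction J rule: finite_induct)
  case empty
  show ?case unfolding sum.empty by (rule weak_gradient_of_has[OF has_weak_gradient_const])
next
  case (insert j J)
  have "weak_gradient_of \<mu> (\<lambda>x. (\<Sum>i\<in>J. d i * v i x) + d j * v j x) (\<lambda>x. (\<Sum>i\<in>J. d i *\<^sub>R h i x) + d j *\<^sub>R h j x)"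
    using insert by (intro weak_gradient_of_linear) auto
  then show ?case using insert.hyps by (simp add: add.commute)
qed

lemma density_coeffs_sum:
  assumes t: "\<And>k. k < N \<Longrightarrow> 0 \<le> t k" "(\<Sum>k<N. t k) = 1" and e: "\<And>k. k < N \<Longrightarrow> e k \<in> density_coeffs I"
  shows "(\<lambda>p. \<Sum>k<N::nat. t k * e k p) \<in> density_coeffs I"
proof -
  have "0 \<le> (\<Sum>i\<in>I. \<Sum>j\<in>I. c i * c j * (\<Sum>k<N. t k * e k (i, j)))" for c
  proof -
    have "(\<Sum>i\<in>I. \<Sum>j\<in>I. c i * c j * (\<Sum>k<N. t k * e k (i, j)))
        = (\<Sum>i\<in>I. \<Sum>j\<in>I. \<Sum>k<N. t k * (c i * c j * e k (i, j)))"
      unfolding sum_distrib_left by (intro sum.cong refl) (simp only: mult_ac)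
    also have "\<dots> = (\<Sum>i\<in>I. \<Sum>k<N. \<Sum>j\<in>I. t k * (c i * c j * e k (i, j)))"
      by (intro sum.cong[OF refl] sum.swap)
    also have "\<dots> = (\<Sum>k<N. \<Sum>i\<in>I. \<Sum>j\<in>I. t k * (c i * c j * e k (i, j)))"
      by (rule sum.swap)
    also have "\<dots> = (\<Sum>k<N. t k * (\<Sum>i\<in>I. \<Sum>j\<in>I. c i * c j * e k (i, j)))"
      unfolding sum_distrib_left ..
    also have "0 \<le> \<dots>"
    proof (rule sum_nonneg)
      fix k assume k: "k \<in> {..<N}"
      then have "0 \<le> (\<Sum>i\<in>I. \<Sum>j\<in>I. c i * c j * e k (i, j))"
        using e[of k] unfolding density_coeffs_def by simp
      then show "0 \<le> t k * (\<Sum>i\<in>I. \<Sum>j\<in>I. c i * c j * e k (i, j))"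
        using t(1)[of k] k by (intro mult_nonneg_nonneg) simp_all
    qed
    finally show ?thesis .
  qed
  moreover have "(\<Sum>i\<in>I. \<Sum>k<N. t k * e k (i, i)) = 1"
  proof -
    have "(\<Sum>i\<in>I. \<Sum>k<N. t k * e k (i, i)) = (\<Sum>k<N. t k * (\<Sum>i\<in>I. e k (i, i)))"
      unfolding sum_distrib_left by (rule sum.swap)
    also have "\<dots> = (\<Sum>k<N. t k * 1)"
      using e unfolding density_coeffs_def by (intro sum.cong refl) simp
    finally show ?thesis using t by simp
  qed
  moreover have "(\<Sum>k<N. t k * e k (i, j)) = (\<Sum>k<N. t k * e k (j, i))" for i j
    using e unfolding density_coeffs_def by (intro sum.cong refl) simp
  moreover have "(\<Sum>k<N. t k * e k p) = 0" if "p \<notin> I \<times> I" for p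
  proof (rule sum.neutral, rule ballI)
    fix k assume "k \<in> {..<N}"
    then have "e k p = 0" using e[of k] that unfolding density_coeffs_def by blast
    then show "t k * e k p = 0" by simp
  qed
  ultimately show ?thesis unfolding density_coeffs_def by blast
qed

text \<open>A positive definite \<open>W\<close> is injective, which cancels it on the left;
  transposition turns the right factor into a left one.\<close>

lemma posdef_sandwich_cancel:
  fixes W G H :: "real^'n^'n"
  assumes W: "transpose W = W" and pos: "\<forall>v. v \<noteq> 0 \<longrightarrow> 0 < v \<bullet> (W *v v)" and eq: "W ** G ** W = W ** H ** W"
  shows "G = H"
proof -
  have inj: "w = 0" if "W *v w = 0" for w
    using pos[rule_format, of w] that by (cases "w = 0") auto
  have cancel: "E = 0" if "W ** E = 0" for E :: "real^'n^'n"
  proof -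
    have z: "E *v v = 0" for v
      by (rule inj) (simp add: matrix_vector_mul_assoc that)
    show ?thesis unfolding matrix_eq by (simp add: z)
  qed
  have "W ** ((G - H) ** W) = 0"
    using eq linear_diff[OF sandwich_linear, of W G H] by (simp add: matrix_mul_assoc)
  then have "(G - H) ** W = 0" by (rule cancel)
  then have "transpose ((G - H) ** W) = transpose (0 :: real^'n^'n)" by simp
  then have "W ** transpose (G - H) = 0"
    unfolding matrix_transpose_mul W linear_0[OF transpose_linear] .
  then have "transpose (G - H) = 0" by (rule cancel)
  then have "transpose (transpose (G - H)) = 0" by (simp add: linear_0[OF transpose_linear])
  then show ?thesis by simp
qed

section \<open>The convex hull of the generators and its closure\<close>

context spectral_space
begin

definition generators :: "(real^'n \<Rightarrow> real^'n^'n) set" where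
  "generators = {normalized_grad_outer \<mu> v | v. v \<in> span_ae \<mu> u I \<and> \<not> null_fun \<mu> v}"

lemma comb_borel: "comb d \<in> borel_measurable borel"
  using H1D(1)[OF comb_H1] unfolding L2_def by auto

lemma span_ae_iff: "v \<in> span_ae \<mu> u I \<longleftrightarrow> v \<in> borel_measurable borel \<and> (\<exists>d. AE x in \<mu>. v x = comb d x)"
  unfolding span_ae_def comb_apply by simp

lemma comb_cong_norm:
  assumes v: "v \<in> borel_measurable borel" and ae: "AE x in \<mu>. v x = comb d x"
  shows "(\<integral>x. (v x)\<^sup>2 \<partial>\<mu>) = (\<Sum>i\<in>I. (d i)\<^sup>2)" "null_fun \<mu> v \<longleftrightarrow> (\<Sum>i\<in>I. (d i)\<^sup>2) = 0"
proof -
  have [measurable]: "v \<in> borel_measurable borel" "comb d \<in> borel_measurable borel" using v comb_borel by auto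
  have "(\<integral>x. (v x)\<^sup>2 \<partial>\<mu>) = (\<integral>x. (comb d x)\<^sup>2 \<partial>\<mu>)"
  proof (rule integral_cong_AE)
    show "(\<lambda>x. (v x)\<^sup>2) \<in> borel_measurable \<mu>" "(\<lambda>x. (comb d x)\<^sup>2) \<in> borel_measurable \<mu>"
      unfolding measurable_mu by measurable
    show "AE x in \<mu>. (v x)\<^sup>2 = (comb d x)\<^sup>2" using ae by eventually_elim simp
  qed
  then show "(\<integral>x. (v x)\<^sup>2 \<partial>\<mu>) = (\<Sum>i\<in>I. (d i)\<^sup>2)"
    unfolding L2_inner_quad[symmetric] comb_norm .
  have "null_fun \<mu> v \<longleftrightarrow> null_fun \<mu> (comb d)"
  proof
    assume "null_fun \<mu> v"
    with ae show "null_fun \<mu> (comb d)" unfolding null_fun_def by eventually_elim simp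
  next
    assume "null_fun \<mu> (comb d)"
    with ae show "null_fun \<mu> v" unfolding null_fun_def by eventually_elim simp
  qed
  then show "null_fun \<mu> v \<longleftrightarrow> (\<Sum>i\<in>I. (d i)\<^sup>2) = 0"
    unfolding L2_null_iff[OF H1D(1)[OF comb_H1], symmetric] comb_norm .
qed

lemma span_weak_gradient:
  assumes v: "v \<in> borel_measurable borel" and ae: "AE x in \<mu>. v x = comb d x"
  shows "weak_gradient_of \<mu> v (\<lambda>x. \<Sum>i\<in>I. d i *\<^sub>R wgrad \<mu> (u i) x)"
proof -
  have "weak_gradient_of \<mu> (\<lambda>x. \<Sum>i\<in>I. d i * u i x) (\<lambda>x. \<Sum>i\<in>I. d i *\<^sub>R wgrad \<mu> (u i) x)"
    by (rule weak_gradient_of_sum[OF _ H1D(2)[OF u_H1]]) simp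
  moreover have "AE x in \<mu>. (\<Sum>i\<in>I. d i * u i x) = v x"
    using ae by eventually_elim (simp only: comb_apply)
  ultimately show ?thesis using v by (rule weak_gradient_of_cong)
qed

lemma mix_rank_one:
  "mix (rank_one d) x = (1 / (\<Sum>i\<in>I. (d i)\<^sup>2)) *\<^sub>R
     outer2 (\<Sum>i\<in>I. d i *\<^sub>R wgrad \<mu> (u i) x) (\<Sum>i\<in>I. d i *\<^sub>R wgrad \<mu> (u i) x)"
proof -
  define n where "n = (\<Sum>i\<in>I. (d i)\<^sup>2)"
  let ?g = "\<lambda>i. wgrad \<mu> (u i) x"
  have "mix (rank_one d) x = (\<Sum>i\<in>I. \<Sum>j\<in>I. (d i * d j / n) *\<^sub>R outer2 (?g i) (?g j))"
    unfolding mix_def grad_outer_def sum.cartesian_product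
    by (intro sum.cong refl) (auto simp: rank_one_def n_def)
  also have "\<dots> = (1 / n) *\<^sub>R (\<Sum>i\<in>I. \<Sum>j\<in>I. outer2 (d i *\<^sub>R ?g i) (d j *\<^sub>R ?g j))"
    unfolding scaleR_right.sum
    by (intro sum.cong refl) (simp add: outer2_def vec_eq_iff)
  also have "(\<Sum>i\<in>I. \<Sum>j\<in>I. outer2 (d i *\<^sub>R ?g i) (d j *\<^sub>R ?g j)) = outer2 (\<Sum>i\<in>I. d i *\<^sub>R ?g i) (\<Sum>i\<in>I. d i *\<^sub>R ?g i)"
    unfolding vec_eq_iff outer2_def by (simp only: sum_component vec_lambda_beta sum_product) simp
  finally show ?thesis unfolding n_def .
qed

text \<open>The chosen gradient of \<open>v\<close> and the combination of the chosen gradients of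
  the \<open>u i\<close> agree after applying \<open>W\<close>, and that determines the
  sandwich.\<close>

lemma normalized_rep:
  assumes v: "v \<in> borel_measurable borel" and ae: "AE x in \<mu>. v x = comb d x"
  shows "AE x in \<mu>. W x ** normalized_grad_outer \<mu> v x ** W x = W x ** mix (rank_one d) x ** W x"
  using dominated_wgrad[OF dominated_field_W span_weak_gradient[OF v ae]]
proof eventually_elim
  case (elim x)
  have sW: "transpose (W x) = W x" by (rule psdD(1)[OF W_psd])
  show ?case
    unfolding normalized_grad_outer_def outer_eq mix_rank_one comb_cong_norm(1)[OF v ae]
      linear_scale[OF sandwich_linear] outer2_sandwich[OF sW] elim ..
qed

lemma normalized_sym_field:
  assumes v: "v \<in> borel_measurable borel" and ae: "AE x in \<mu>. v x = comb d x"
  shows "sym_field (normalized_grad_outer \<mu> v)"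
proof -
  have [measurable]: "wgrad \<mu> v \<in> borel_measurable borel"
    by (rule weak_gradient_of_measurable(2)[OF weak_gradient_of_wgrad[OF span_weak_gradient[OF v ae]]])
  have "normalized_grad_outer \<mu> v \<in> borel_measurable borel" unfolding normalized_grad_outer_def by measurable
  then show ?thesis
    unfolding sym_field_def normalized_grad_outer_def outer_eq
      linear_scale[OF transpose_linear] transpose_outer2 by simp
qed

lemma mix_sum: "mix (\<lambda>p. \<Sum>k<N::nat. t k * e k p) x = (\<Sum>k<N. t k *\<^sub>R mix (e k) x)"
proof -
  have "(\<Sum>k<N. t k *\<^sub>R mix (e k) x) = (\<Sum>k<N. \<Sum>p\<in>I \<times> I. (t k * e k p) *\<^sub>R grad_outer p x)"
    unfolding mix_def scaleR_right.sum scaleR_scaleR ..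
  also have "\<dots> = (\<Sum>p\<in>I \<times> I. \<Sum>k<N. (t k * e k p) *\<^sub>R grad_outer p x)" by (rule sum.swap)
  finally show ?thesis unfolding mix_def scaleR_sum_left ..
qed

lemma sandwich_sum_AE:
  fixes N :: nat
  assumes "\<And>k. k < N \<Longrightarrow> AE x in \<mu>. W x ** A k x ** W x = W x ** mix (e k) x ** W x"
  shows "AE x in \<mu>. W x ** (\<Sum>k<N. t k *\<^sub>R A k x) ** W x = W x ** mix (\<lambda>p. \<Sum>k<N. t k * e k p) x ** W x"
proof -
  have "AE x in \<mu>. \<forall>k\<in>{..<N}. W x ** A k x ** W x = W x ** mix (e k) x ** W x"
    using assms by (intro eventually_ball_finite) auto
  then show ?thesis
  proof eventually_elim
    case (elim x)
    then show ?case
      unfolding mix_sum linear_sum[OF sandwich_linear] linear_scale[OF sandwich_linear]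
      by (intro sum.cong refl) simp
  qed
qed

lemma conv_rep:
  assumes "H \<in> field_conv generators"
  shows "\<exists>c\<in>density_coeffs I. AE x in \<mu>. W x ** H x ** W x = W x ** mix c x ** W x"
    and "sym_field H"
proof -
  obtain N :: nat and t A where t: "\<And>k. k < N \<Longrightarrow> 0 \<le> t k" "(\<Sum>k<N. t k) = 1"
    and A: "\<And>k. k < N \<Longrightarrow> A k \<in> generators" and H: "H = (\<lambda>x. \<Sum>k<N. t k *\<^sub>R A k x)"
    using assms unfolding field_conv_def by auto
  define Q where "Q k d v \<longleftrightarrow> v \<in> borel_measurable borel \<and> (AE x in \<mu>. v x = comb d x) \<and>
    (\<Sum>i\<in>I. (d i)\<^sup>2) > 0 \<and> A k = normalized_grad_outer \<mu> v" for k d v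
  have ex: "\<exists>d v. Q k d v" if k: "k < N" for k
  proof -
    obtain v where v: "A k = normalized_grad_outer \<mu> v" "v \<in> span_ae \<mu> u I" "\<not> null_fun \<mu> v"
      using A[OF k] unfolding generators_def by auto
    obtain d where d: "v \<in> borel_measurable borel" "AE x in \<mu>. v x = comb d x"
      using v(2) unfolding span_ae_iff by auto
    have "(\<Sum>i\<in>I. (d i)\<^sup>2) \<noteq> 0" using v(3) comb_cong_norm(2)[OF d] by blast
    moreover have "(\<Sum>i\<in>I. (d i)\<^sup>2) \<ge> 0" by (rule sum_nonneg) simp
    ultimately have "(\<Sum>i\<in>I. (d i)\<^sup>2) > 0" by linarith
    then show ?thesis unfolding Q_def using d v(1) by blast
  qed
  have "\<forall>k. \<exists>d. \<exists>v. k < N \<longrightarrow> Q k d v" using ex by blast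
  from choice[OF this] obtain d where "\<forall>k. \<exists>v. k < N \<longrightarrow> Q k (d k) v" ..
  from choice[OF this] obtain v where "\<forall>k. k < N \<longrightarrow> Q k (d k) (v k)" ..
  then have dv: "\<And>k. k < N \<Longrightarrow> v k \<in> borel_measurable borel"
      "\<And>k. k < N \<Longrightarrow> AE x in \<mu>. v k x = comb (d k) x"
      "\<And>k. k < N \<Longrightarrow> (\<Sum>i\<in>I. (d k i)\<^sup>2) > 0" "\<And>k. k < N \<Longrightarrow> A k = normalized_grad_outer \<mu> (v k)"
    unfolding Q_def by simp_all
  have ae: "AE x in \<mu>. W x ** H x ** W x = W x ** mix (\<lambda>p. \<Sum>k<N. t k * rank_one (d k) p) x ** W x"
    unfolding H
  proof (rule sandwich_sum_AE)
    show "AE x in \<mu>. W x ** A k x ** W x = W x ** mix (rank_one (d k)) x ** W x" if "k < N" for k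
      unfolding dv(4)[OF that] by (rule normalized_rep[OF dv(1,2)[OF that]])
  qed
  have "(\<lambda>p. \<Sum>k<N. t k * rank_one (d k) p) \<in> density_coeffs I"
    by (rule density_coeffs_sum[OF t rank_one_density[OF dv(3)]])
  with ae show "\<exists>c\<in>density_coeffs I. AE x in \<mu>. W x ** H x ** W x = W x ** mix c x ** W x" by blast
  have sA: "sym_field (A k)" if "k < N" for k
    unfolding dv(4)[OF that] by (rule normalized_sym_field[OF dv(1,2)[OF that]])
  have "H \<in> borel_measurable borel"
    unfolding H using sA unfolding sym_field_def by (intro borel_measurable_sum borel_measurable_scaleR) auto
  moreover have "transpose (H x) = H x" for x
    unfolding H linear_sum[OF transpose_linear] linear_scale[OF transpose_linear]
    using sA unfolding sym_field_def by (intro sum.cong refl) simp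
  ultimately show "sym_field H" unfolding sym_field_def by simp
qed

lemma conv_in_closure: "H \<in> field_conv generators \<Longrightarrow> H \<in> L2_field_closure \<mu> (field_conv generators)"
  using conv_rep(2)[of H] unfolding L2_field_closure_def by (auto intro!: bexI[of _ H])

text \<open>The Gram vectors of \<open>a\<close> give the eigenfunctions, and their squared norms
  are the convex weights.\<close>

lemma hull_rep:
  assumes a: "a \<in> density_coeffs I"
  shows "\<exists>H\<in>field_conv generators. AE x in \<mu>. W x ** H x ** W x = W x ** mix a x ** W x"
proof -
  obtain N :: nat and z where z: "\<And>i j. i \<in> I \<Longrightarrow> j \<in> I \<Longrightarrow> a (i, j) = (\<Sum>k<N. z k i * z k j)"
    and z1: "(\<Sum>k<N. \<Sum>i\<in>I. (z k i)\<^sup>2) = 1"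
    by (rule gram_comb[OF a]) (rule that)
  define n where "n k = (\<Sum>i\<in>I. (z k i)\<^sup>2)" for k
  have n0: "n k \<ge> 0" for k unfolding n_def by (rule sum_nonneg) simp
  \<comment> \<open>Generators must come from nonzero functions, so a Gram vector of norm 0 is
    replaced by the coefficients of \<open>u 2\<close>, with weight 0.\<close>
  define d where "d k = (if n k = 0 then (\<lambda>i. if i = 2 then 1 else 0) else z k)" for k
  have dpos: "(\<Sum>i\<in>I. (d k i)\<^sup>2) > 0" for k
  proof (cases "n k = 0")
    case True
    have "(d k 2)\<^sup>2 \<le> (\<Sum>i\<in>I. (d k i)\<^sup>2)" using m by (intro member_le_sum) auto
    then show ?thesis using True unfolding d_def by simp
  next
    case False
    then have "d k = z k" unfolding d_def by simp
    moreover have "0 < n k" using False n0[of k] by simp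
    ultimately show ?thesis unfolding n_def by (simp only:)
  qed
  have gen: "normalized_grad_outer \<mu> (comb (d k)) \<in> generators" for k
  proof -
    have "comb (d k) \<in> span_ae \<mu> u I" unfolding span_ae_iff using comb_borel by auto
    moreover have "\<not> null_fun \<mu> (comb (d k))"
      using comb_cong_norm(2)[OF comb_borel, of "d k" "d k"] dpos[of k] by simp
    ultimately show ?thesis unfolding generators_def by blast
  qed
  define H where "H = (\<lambda>x. \<Sum>k<N. n k *\<^sub>R normalized_grad_outer \<mu> (comb (d k)) x)"
  have "H \<in> field_conv generators"
    unfolding field_conv_def H_def using n0 gen z1 unfolding n_def[symmetric]
    by (intro CollectI exI[of _ N] exI[of _ n] exI[of _ "\<lambda>k. normalized_grad_outer \<mu> (comb (d k))"]) simp
  moreover have "AE x in \<mu>. W x ** H x ** W x = W x ** mix (\<lambda>p. \<Sum>k<N. n k * rank_one (d k) p) x ** W x"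
    unfolding H_def by (rule sandwich_sum_AE) (rule normalized_rep[OF comb_borel], simp)
  moreover have "(\<Sum>k<N. n k * rank_one (d k) p) = a p" for p
  proof -
    obtain i j where p: "p = (i, j)" by (cases p)
    show ?thesis
    proof (cases "i \<in> I \<and> j \<in> I")
      case True
      have "n k * rank_one (d k) (i, j) = z k i * z k j" for k
      proof (cases "n k = 0")
        case True
        then have "z k i = 0" if "i \<in> I" for i
          using that sum_nonneg_eq_0_iff[of I "\<lambda>i. (z k i)\<^sup>2"] unfolding n_def by simp
        then show ?thesis using True \<open>i \<in> I \<and> j \<in> I\<close> by simp
      next
        case False
        have "rank_one (d k) (i, j) = z k i * z k j / n k"
          unfolding rank_one_def d_def n_def[symmetric] using False \<open>i \<in> I \<and> j \<in> I\<close> by (simp only: n_def if_False case_prod_conv if_True simp_thms)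
        then show ?thesis using False by simp
      qed
      then show ?thesis unfolding p using z True by (simp only:)
    next
      case False
      then have "p \<notin> I \<times> I" unfolding p by auto
      then have "a p = 0" using a unfolding density_coeffs_def by blast
      moreover have "rank_one (d k) p = 0" for k unfolding rank_one_def p using False by (simp only: case_prod_conv if_False)
      ultimately show ?thesis by simp
    qed
  qed
  ultimately show ?thesis by (auto intro!: bexI[of _ H])
qed

text \<open>The weighted distance from \<open>G\<close> to the fields \<open>mix c\<close> has
  infimum 0, since the weighted sandwich is a contraction, and by compactness the infimum is
  attained. Up to agreement on the range of \<open>W\<close> the closure thus adds nothing to the
  hull.\<close>

lemma closure_rep:
  assumes "G \<in> L2_field_closure \<mu> (field_conv generators)"
  shows "\<exists>a\<in>density_coeffs I. AE x in \<mu>. W x ** G x ** W x = W x ** mix a x ** W x"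
proof -
  have G: "sym_field G" using assms unfolding L2_field_closure_def by simp
  obtain a where a: "a \<in> density_coeffs I"
    and min: "\<And>c. c \<in> density_coeffs I \<Longrightarrow>
      field_inner \<mu> (residual G a) (residual G a) \<le> field_inner \<mu> (residual G c) (residual G c)"
    by (rule best_mix[OF G]) (rule that)
  have small: "field_inner \<mu> (residual G a) (residual G a) \<le> e" if e: "e > 0" for e
  proof -
    obtain H where H: "H \<in> field_conv generators"
      and d: "(\<integral>\<^sup>+x. ennreal ((norm (G x - H x))\<^sup>2) \<partial>\<mu>) < ennreal ((sqrt e)\<^sup>2)"
      using assms e unfolding L2_field_closure_def by (auto dest!: spec[of _ "sqrt e"])
    obtain c where c: "c \<in> density_coeffs I" and ae: "AE x in \<mu>. W x ** H x ** W x = W x ** mix c x ** W x"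
      using conv_rep(1)[OF H] by blast
    have le: "AE x in \<mu>. residual G c x \<bullet> residual G c x \<le> (norm (G x - H x))\<^sup>2"
      using ae
    proof eventually_elim
      case (elim x)
      have "residual G c x = weighted G (\<lambda>x. G x - H x) x"
        unfolding residual_apply weighted_def linear_diff[OF sandwich_linear] elim ..
      then have "norm (residual G c x) \<le> norm (G x - H x)"
        using weighted_le[of G "\<lambda>x. G x - H x" x] by simp
      then show ?case unfolding power2_norm_eq_inner[symmetric] by (intro power_mono) auto
    qed
    have "ennreal (field_inner \<mu> (residual G c) (residual G c)) = (\<integral>\<^sup>+x. ennreal (residual G c x \<bullet> residual G c x) \<partial>\<mu>)"
      unfolding field_inner_def
      by (intro nn_integral_eq_integral[symmetric] bounded_fields_integrable residual_mem[OF G]) simp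
    also have "\<dots> \<le> (\<integral>\<^sup>+x. ennreal ((norm (G x - H x))\<^sup>2) \<partial>\<mu>)"
      using le by (intro nn_integral_mono_AE) (auto intro: ennreal_leI elim: eventually_mono)
    also have "\<dots> < ennreal ((sqrt e)\<^sup>2)" by (rule d)
    finally have "field_inner \<mu> (residual G c) (residual G c) < e"
      using e psd_form.nonneg[OF bounded_fields_psd_form residual_mem[OF G, of c]] by (simp add: ennreal_less_iff)
    then show ?thesis using min[OF c] by linarith
  qed
  have "field_inner \<mu> (residual G a) (residual G a) \<le> 0"
    using field_le_epsilon[of "field_inner \<mu> (residual G a) (residual G a)" 0] small by simp
  from residual_null[OF G this] show ?thesis using a by blast
qed

lemma superdiff_eq:
  "superdiff \<mu> W = {G. sym_field G \<and> (\<exists>H\<in>L2_field_closure \<mu> (field_conv generators). agree_on_range \<mu> W G H)}"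
proof (intro set_eqI iffI)
  fix G assume G: "G \<in> superdiff \<mu> W"
  obtain a where a: "a \<in> density_coeffs I" "AE x in \<mu>. W x ** G x ** W x = W x ** mix a x ** W x"
    using superdiff_rep[OF G] by blast
  obtain H where H: "H \<in> field_conv generators" "AE x in \<mu>. W x ** H x ** W x = W x ** mix a x ** W x"
    using hull_rep[OF a(1)] by blast
  have "agree_on_range \<mu> W G H" unfolding agree_on_range_def using a(2) H(2) by eventually_elim simp
  moreover have "sym_field G" using G unfolding superdiff_def by simp
  ultimately show "G \<in> {G. sym_field G \<and> (\<exists>H\<in>L2_field_closure \<mu> (field_conv generators). agree_on_range \<mu> W G H)}"
    using conv_in_closure[OF H(1)] by blast
next
  fix G assume "G \<in> {G. sym_field G \<and> (\<exists>H\<in>L2_field_closure \<mu> (field_conv generators). agree_on_range \<mu> W G H)}"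
  then obtain H where G: "sym_field G" and H: "H \<in> L2_field_closure \<mu> (field_conv generators)"
    and agree: "AE x in \<mu>. W x ** G x ** W x = W x ** H x ** W x"
    unfolding agree_on_range_def by blast
  obtain a where a: "a \<in> density_coeffs I" "AE x in \<mu>. W x ** H x ** W x = W x ** mix a x ** W x"
    using closure_rep[OF H] by blast
  have "AE x in \<mu>. W x ** G x ** W x = W x ** mix a x ** W x" using agree a(2) by eventually_elim simp
  then show "G \<in> superdiff \<mu> W" by (rule superdiff_mem[OF G a(1)])
qed

lemma superdiff_eq_posdef:
  assumes pos: "AE x in \<mu>. \<forall>v. v \<noteq> 0 \<longrightarrow> 0 < v \<bullet> (W x *v v)"
  shows "superdiff \<mu> W = L2_field_closure \<mu> (field_conv generators)"
proof (intro set_eqI iffI)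
  fix G assume G: "G \<in> superdiff \<mu> W"
  obtain a where a: "a \<in> density_coeffs I" "AE x in \<mu>. W x ** G x ** W x = W x ** mix a x ** W x"
    using superdiff_rep[OF G] by blast
  obtain H where H: "H \<in> field_conv generators" "AE x in \<mu>. W x ** H x ** W x = W x ** mix a x ** W x"
    using hull_rep[OF a(1)] by blast
  have "AE x in \<mu>. G x = H x"
    using pos a(2) H(2)
  proof eventually_elim
    case (elim x)
    show ?case
      by (rule posdef_sandwich_cancel[OF psdD(1)[OF W_psd] elim(1)]) (simp only: elim(2,3))
  qed
  \<comment> \<open>\<open>G\<close> may differ from \<open>H\<close> on a null set, so it is placed
    in the closure, at distance 0 from \<open>H\<close>, and not in the hull itself.\<close>
  then have "AE x in \<mu>. ennreal ((norm (G x - H x))\<^sup>2) = 0" by eventually_elim simp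
  then have "(\<integral>\<^sup>+x. ennreal ((norm (G x - H x))\<^sup>2) \<partial>\<mu>) = (\<integral>\<^sup>+x. 0 \<partial>\<mu>)" by (rule nn_integral_cong_AE)
  moreover have "sym_field G" using G unfolding superdiff_def by simp
  ultimately show "G \<in> L2_field_closure \<mu> (field_conv generators)"
    unfolding L2_field_closure_def using H(1) by (auto intro!: bexI[of _ H])
next
  fix G assume G: "G \<in> L2_field_closure \<mu> (field_conv generators)"
  obtain a where a: "a \<in> density_coeffs I" "AE x in \<mu>. W x ** G x ** W x = W x ** mix a x ** W x"
    using closure_rep[OF G] by blast
  have "sym_field G" using G unfolding L2_field_closure_def by simp
  then show "G \<in> superdiff \<mu> W" by (rule superdiff_mem[OF _ a])
qed

end

section \<open>The simple eigenvalue and the remaining spectral claims\<close>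

context spectral_space
begin

text \<open>On a one-dimensional eigenspace the form of \<open>D\<close> is a multiple
  \<open>L\<close> of the squared norm, so the lower estimate has slope exactly \<open>L\<close>;
  applied to \<open>D\<close> and to \<open>- D\<close> it covers both signs of \<open>t\<close>.
  The test function \<open>u 2\<close> gives the upper bound, and the value is squeezed within order
  t^2 of \<open>lam 2 + t * L\<close>.\<close>

lemma simple_has_gradient:
  assumes m1: "m = 1"
  shows "has_gradient \<mu> W (normalized_grad_outer \<mu> (u 2))"
proof -
  have I2: "I = {2}" using m1 by auto
  let ?G = "normalized_grad_outer \<mu> (u 2)"
  have u2: "u 2 \<in> H1 \<mu> W" "L2_inner \<mu> (u 2) (\<lambda>_. 1) = 0" "L2_inner \<mu> (u 2) (u 2) = 1" "dirichlet \<mu> W (u 2) (u 2) = lam 2"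
    using eb.u_H[of 2] eb.u_ip[of 2 1, unfolded eb.u_1] eb.u_ip[of 2 2] eb.u_energy[of 2 2] by auto
  have Geq: "?G = (\<lambda>x. outer2 (wgrad \<mu> (u 2) x) (wgrad \<mu> (u 2) x))"
    unfolding normalized_grad_outer_def outer_eq L2_inner_quad[symmetric] u2(3) by simp
  have [measurable]: "wgrad \<mu> (u 2) \<in> borel_measurable borel" by (rule H1D(3)[OF u2(1)])
  have Gs: "sym_field ?G" unfolding sym_field_def Geq transpose_outer2 by simp
  have "pairable \<mu> (\<lambda>x. W' x - W x) ?G \<and>
      ((\<lambda>t. enn2real (1 / poincare_const \<mu> (\<lambda>x. W x + t *\<^sub>R (W' x - W x))))
         has_real_derivative pairing \<mu> (\<lambda>x. W' x - W x) ?G) (at 0)"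
    if adm: "admissible W W'" for W'
  proof -
    define D where "D = (\<lambda>x. W' x - W x)"
    obtain c where c: "c > 0" and D': "dominated_field c (\<lambda>x. W' x - W x)"
      by (rule admissible_dominated[OF adm]) (rule that)
    note D = D'[folded D_def]
    define L where "L = dirichlet \<mu> D (u 2) (u 2)"
    have p: "pairable \<mu> D ?G" "pairing \<mu> D ?G = L"
      using H1_dominated_integrable[OF D u2(1) u2(1)]
      unfolding pairable_def pairing_def Geq trace_outer2 L_def dirichlet_def by auto
    have Dm: "dominated_field c (\<lambda>x. - D x)"
    proof -
      have "form_dominated c (- D x) (W x)" for x
        unfolding form_dominated_def linear_neg[OF transpose_linear] linear_neg[OF quad_form_linear] abs_minus_cancel
        using dominated_fieldD(2,3)[OF D] by simp
      moreover have "(\<lambda>x. - D x) \<in> borel_measurable borel" using dominated_fieldD(1)[OF D] by measurable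
      ultimately show ?thesis unfolding dominated_field_def by blast
    qed
    have Lm: "dirichlet \<mu> (\<lambda>x. - D x) f f = - dirichlet \<mu> D f f" for f
      unfolding dirichlet_def linear_neg[OF quad_form_linear] by simp
    have cD: "dirichlet \<mu> D (comb a) (comb a) = L * (\<Sum>i\<in>I. (a i)\<^sup>2)" for a
    proof -
      interpret B: sym_form "H1 \<mu> W" "dirichlet \<mu> D" by (rule dirichlet_sym_form[OF D])
      show ?thesis unfolding comb_def I2 L_def using B.quad_scale[OF u2(1), of "a 2"] by (simp add: mult.commute)
    qed
    have pm: "perturb (\<lambda>x. - D x) t = perturb D (- t)" for t unfolding perturb_def by simp
    obtain C1 t1 where C1: "C1 \<ge> 0" "t1 > 0" and low1:
      "\<And>t. 0 \<le> t \<Longrightarrow> t \<le> t1 \<Longrightarrow> t * c < 1 \<and> 0 < lam 2 + t * L - C1 * t\<^sup>2 \<and>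
        ennreal (lam 2 + t * L - C1 * t\<^sup>2) \<le> 1 / poincare_const \<mu> (perturb D t)"
      by (rule perturb_poincare_lower[OF D c, of L]) (simp only: cD order_refl, rule that)
    obtain C2 t2 where C2: "C2 \<ge> 0" "t2 > 0" and low2:
      "\<And>t. 0 \<le> t \<Longrightarrow> t \<le> t2 \<Longrightarrow> t * c < 1 \<and> 0 < lam 2 + t * - L - C2 * t\<^sup>2 \<and>
        ennreal (lam 2 + t * - L - C2 * t\<^sup>2) \<le> 1 / poincare_const \<mu> (perturb (\<lambda>x. - D x) t)"
      by (rule perturb_poincare_lower[OF Dm c, of "- L"]) (simp only: Lm cD mult_minus_left order_refl, rule that)
    define C where "C = max C1 C2"
    define t0 where "t0 = min t1 t2"
    have t0: "t0 > 0" unfolding t0_def using C1 C2 by simp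
    define \<phi> where "\<phi> t = enn2real (1 / poincare_const \<mu> (perturb D t))" for t
    have bounds: "lam 2 + t * L - C * t\<^sup>2 \<le> \<phi> t \<and> \<phi> t \<le> lam 2 + t * L" if t: "\<bar>t\<bar> \<le> t0" for t
    proof -
      \<comment> \<open>\<open>K\<close> is \<open>C1\<close> or \<open>C2\<close> according to the
        sign of \<open>t\<close>; a negative \<open>t\<close> is the perturbation along
        \<open>- D\<close> with parameter \<open>- t\<close>.\<close>
      have "\<exists>K\<le>C. \<bar>t\<bar> * c < 1 \<and> 0 < lam 2 + t * L - K * t\<^sup>2 \<and>
          ennreal (lam 2 + t * L - K * t\<^sup>2) \<le> 1 / poincare_const \<mu> (perturb D t)"
      proof (cases "t \<ge> 0")
        case True
        then show ?thesis using low1[of t] t unfolding t0_def C_def by (intro exI[of _ C1]) auto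
      next
        case False
        then show ?thesis using low2[of "- t"] t unfolding t0_def C_def pm by (intro exI[of _ C2]) auto
      qed
      then obtain K where K: "K \<le> C" "\<bar>t\<bar> * c < 1" "0 < lam 2 + t * L - K * t\<^sup>2"
          "ennreal (lam 2 + t * L - K * t\<^sup>2) \<le> 1 / poincare_const \<mu> (perturb D t)" by blast
      have up: "1 / poincare_const \<mu> (perturb D t) \<le> ennreal (lam 2 + t * L)"
        using perturb_poincare_upper[OF D perturb_psd[OF D less_imp_le[OF K(2)]] u2(1,2,3)] u2(4)
        unfolding L_def by simp
      then have fin: "1 / poincare_const \<mu> (perturb D t) < top" by (rule le_less_trans) simp
      then have eq: "1 / poincare_const \<mu> (perturb D t) = ennreal (\<phi> t)" unfolding \<phi>_def by simp
      have \<phi>0: "\<phi> t \<ge> 0" unfolding \<phi>_def by simp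
      have lo: "lam 2 + t * L - K * t\<^sup>2 \<le> \<phi> t" using K(4) \<phi>0 unfolding eq by (simp add: ennreal_le_iff)
      then have "0 < \<phi> t" using K(3) by linarith
      then have "\<phi> t \<le> lam 2 + t * L" using up unfolding eq by (simp add: ennreal_le_iff2)
      moreover have "K * t\<^sup>2 \<le> C * t\<^sup>2" using K(1) by (rule mult_right_mono) simp
      ultimately show ?thesis using lo by linarith
    qed
    have \<phi>0: "\<phi> 0 = lam 2" using bounds[of 0] t0 by simp
    have "((\<lambda>h. (\<phi> (0 + h) - \<phi> 0) / h) \<longlongrightarrow> L) (at 0)"
    proof (rule LIM_I)
      fix e :: real assume e: "e > 0"
      have C0: "C \<ge> 0" unfolding C_def using C1 by simp
      define s where "s = min t0 (e / (C + 1))"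
      have s: "s > 0" unfolding s_def using t0 e C0 by simp
      have "norm ((\<phi> (0 + h) - \<phi> 0) / h - L) < e" if h: "h \<noteq> 0" "norm (h - 0) < s" for h
      proof -
        have hs: "\<bar>h\<bar> \<le> t0" "\<bar>h\<bar> < e / (C + 1)" using h unfolding s_def by auto
        have "\<bar>\<phi> h - \<phi> 0 - h * L\<bar> \<le> C * h\<^sup>2" using bounds[OF hs(1)] unfolding \<phi>0 by (simp add: abs_le_iff C0)
        then have "\<bar>\<phi> h - \<phi> 0 - h * L\<bar> \<le> (C * \<bar>h\<bar>) * \<bar>h\<bar>" by (simp add: power2_eq_square mult.assoc)
        then have "\<bar>\<phi> h - \<phi> 0 - h * L\<bar> / \<bar>h\<bar> \<le> C * \<bar>h\<bar>" using h(1) by (simp add: pos_divide_le_eq)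
        moreover have "(\<phi> (0 + h) - \<phi> 0) / h - L = (\<phi> h - \<phi> 0 - h * L) / h" using h(1) by (simp add: field_simps)
        moreover have "C * \<bar>h\<bar> < e"
        proof -
          have "\<bar>h\<bar> * (C + 1) < e" using hs(2) C0 by (simp add: pos_less_divide_eq)
          then show ?thesis using h(1) by (simp add: algebra_simps)
        qed
        ultimately show ?thesis by (simp add: abs_divide)
      qed
      then show "\<exists>s>0. \<forall>h. h \<noteq> 0 \<and> norm (h - 0) < s \<longrightarrow> norm ((\<phi> (0 + h) - \<phi> 0) / h - L) < e"
        using s by blast
    qed
    then have "(\<phi> has_real_derivative L) (at 0)" unfolding has_field_derivative_iff by simp
    then show ?thesis using p unfolding D_def[symmetric] \<phi>_def[abs_def] perturb_def
      unfolding D_def by simp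
  qed
  then show ?thesis unfolding has_gradient_def using Gs by blast
qed

text \<open>A member of the span differs from a true combination by a function that vanishes almost
  everywhere, and such functions belong to \<open>H1\<close>; the abstract criterion up to null
  vectors then reads as equality almost everywhere.\<close>

lemma eigenspace_span: "eigenspace \<mu> W l = span_ae \<mu> u {i. 1 \<le> i \<and> lam i = l}"
proof (intro set_eqI iffI)
  define J where "J = {i. 1 \<le> i \<and> lam i = l}"
  have lev: "eb.level l = J" unfolding eb.level_def J_def ..
  have J: "u i \<in> H1 \<mu> W" if "i \<in> J" for i using that eb.u_H unfolding J_def by auto
  have SH: "(\<Sum>i\<in>J. c i *\<^sub>R u i) \<in> H1 \<mu> W" for c using J by (intro eb.en.mem(4,5))
  have ap: "(\<Sum>i\<in>J. c i *\<^sub>R u i) x = (\<Sum>i\<in>J. c i * u i x)" for c x by (simp add: sum_fun_apply)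
  have eig: "f \<in> eigenspace \<mu> W l \<longleftrightarrow> f \<in> H1 \<mu> W \<and> (\<forall>g\<in>H1 \<mu> W. dirichlet \<mu> W g f = l * L2_inner \<mu> g f)" for f
    unfolding eigenspace_def Lop_def by simp
  have ae: "L2_inner \<mu> (f - (\<Sum>i\<in>J. c i *\<^sub>R u i)) (f - (\<Sum>i\<in>J. c i *\<^sub>R u i)) = 0
      \<longleftrightarrow> (AE x in \<mu>. f x = (\<Sum>i\<in>J. c i * u i x))" if "f \<in> H1 \<mu> W" for f c
  proof -
    have "f - (\<Sum>i\<in>J. c i *\<^sub>R u i) \<in> H1 \<mu> W" using that SH by (rule eb.en.mem(3))
    from L2_null_iff[OF H1D(1)[OF this]] show ?thesis unfolding null_fun_def by (simp add: ap)
  qed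
  show "f \<in> span_ae \<mu> u {i. 1 \<le> i \<and> lam i = l}" if "f \<in> eigenspace \<mu> W l" for f
  proof -
    have f: "f \<in> H1 \<mu> W" "\<forall>g\<in>H1 \<mu> W. dirichlet \<mu> W g f = l * L2_inner \<mu> g f" using that unfolding eig by auto
    then have "\<exists>c. AE x in \<mu>. f x = (\<Sum>i\<in>J. c i * u i x)"
      using eb.eigenvector_iff[OF f(1), of l] ae[OF f(1)] unfolding lev by auto
    then show ?thesis using H1D(1)[OF f(1)] unfolding span_ae_def J_def[symmetric] L2_def by auto
  qed
  show "f \<in> eigenspace \<mu> W l" if fs: "f \<in> span_ae \<mu> u {i. 1 \<le> i \<and> lam i = l}" for f
  proof -
    obtain c where fb: "f \<in> borel_measurable borel" and c: "AE x in \<mu>. f x = (\<Sum>i\<in>J. c i * u i x)"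
      using fs unfolding span_ae_def J_def[symmetric] by auto
    have "(\<Sum>i\<in>J. c i *\<^sub>R u i) \<in> borel_measurable borel" using H1D(1)[OF SH] unfolding L2_def by auto
    then have "f - (\<Sum>i\<in>J. c i *\<^sub>R u i) \<in> borel_measurable borel" using fb unfolding fun_diff_def by simp
    moreover have "AE x in \<mu>. (f - (\<Sum>i\<in>J. c i *\<^sub>R u i)) x = 0" using c by eventually_elim (simp add: ap)
    ultimately have "f - (\<Sum>i\<in>J. c i *\<^sub>R u i) \<in> H1 \<mu> W" by (rule H1_null(1))
    from eb.en.mem(2)[OF this SH[of c]] have f: "f \<in> H1 \<mu> W" by simp
    then show ?thesis using eb.eigenvector_iff[OF f, of l] ae[OF f] c unfolding eig lev by auto
  qed
qed

lemma rayleigh_minimizers_span: "rayleigh_minimizers \<mu> W = {f \<in> span_ae \<mu> u I. \<not> null_fun \<mu> f}"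
proof (rule set_eqI)
  fix f
  have mean: "(\<integral>x. f x \<partial>\<mu>) = L2_inner \<mu> f (\<lambda>_. 1)" for f unfolding L2_inner_def by simp
  have span: "span_ae \<mu> u I = eigenspace \<mu> W (lam 2)" unfolding eigenspace_span level_two ..
  have E: "f \<in> eigenspace \<mu> W (lam 2) \<longleftrightarrow> f \<in> H1 \<mu> W \<and> (\<forall>g\<in>H1 \<mu> W. dirichlet \<mu> W g f = lam 2 * L2_inner \<mu> g f)"
    unfolding eigenspace_def Lop_def by simp
  show "f \<in> rayleigh_minimizers \<mu> W \<longleftrightarrow> f \<in> {f \<in> span_ae \<mu> u I. \<not> null_fun \<mu> f}"
  proof (cases "f \<in> H1 \<mu> W \<and> \<not> null_fun \<mu> f")
    case True
    then have f: "f \<in> H1 \<mu> W" "L2_inner \<mu> f f > 0" using L2_null_pos[OF H1D(1)] by auto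
    have "f \<in> rayleigh_minimizers \<mu> W \<longleftrightarrow> L2_inner \<mu> f (\<lambda>_. 1) = 0 \<and>
        (\<forall>h\<in>H1 \<mu> W. L2_inner \<mu> h (\<lambda>_. 1) = 0 \<longrightarrow> L2_inner \<mu> h h > 0 \<longrightarrow>
          dirichlet \<mu> W f f / L2_inner \<mu> f f \<le> dirichlet \<mu> W h h / L2_inner \<mu> h h)"
      using True L2_null_pos[OF H1D(1)]
      unfolding rayleigh_minimizers_def Let_def rayleigh_def L2_inner_quad[symmetric] unfolding mean by auto
    then show ?thesis using eb.rayleigh_minimizer_iff[OF gap f] True unfolding span E mem_Collect_eq by blast
  next
    case False
    then show ?thesis unfolding rayleigh_minimizers_def Let_def span E mem_Collect_eq by blast
  qed
qed

lemma basis: "orthonormal_basis \<mu> u"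
proof -
  have "(\<lambda>N. L2_norm \<mu> (\<lambda>x. f x - (\<Sum>i=1..N. L2_inner \<mu> f (u i) * u i x))) \<longlonglongrightarrow> 0" if f: "f \<in> L2 \<mu>" for f
  proof -
    have eq: "(\<lambda>x. f x - (\<Sum>i=1..N. L2_inner \<mu> f (u i) * u i x)) = f - eb.ip.proj {1..N} u f" for N
      unfolding eb.ip.proj_def by (rule ext) (simp add: sum_fun_apply)
    have "(\<lambda>N. sqrt (L2_inner \<mu> (f - eb.ip.proj {1..N} u f) (f - eb.ip.proj {1..N} u f))) \<longlonglongrightarrow> sqrt 0"
      by (intro tendsto_real_sqrt eb.basis_complete f)
    then show ?thesis unfolding eq L2_norm_eq by simp
  qed
  then show ?thesis unfolding orthonormal_basis_def using eb.u_L eb.u_ip by blast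
qed

end

context compact_energy_space
begin

text \<open>The Poincare inequality at the normalised mean-zero \<open>u 2\<close> reads
  \<open>1 \<le> C * lam 2\<close>, so \<open>lam 2\<close> is positive.\<close>

lemma spectral_space_exists: "\<exists>u lam m. spectral_space \<mu> W u lam m"
proof -
  obtain u lam where eb: "eigen_basis (L2 \<mu>) (H1 \<mu> W) (L2_inner \<mu>) (dirichlet \<mu> W) (\<lambda>_. 1) u lam"
    using form_space.eigen_basis_exists[OF form_space] by blast
  interpret eb: eigen_basis "L2 \<mu>" "H1 \<mu> W" "L2_inner \<mu>" "dirichlet \<mu> W" "\<lambda>_. 1" u lam by (rule eb)
  have u2: "u 2 \<in> H1 \<mu> W" "L2_inner \<mu> (u 2) (\<lambda>_. 1) = 0" "L2_inner \<mu> (u 2) (u 2) = 1" "dirichlet \<mu> W (u 2) (u 2) = lam 2"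
    using eb.u_H[of 2] eb.u_ip[of 2 1, unfolded eb.u_1] eb.u_ip[of 2 2] eb.u_energy[of 2 2] by auto
  obtain C where C: "C \<ge> 0" "\<And>f. f \<in> H1 \<mu> W \<Longrightarrow> variance f \<le> C * dirichlet \<mu> W f f"
    by (rule poincare_inequality) (rule that)
  have "1 \<le> C * lam 2" using C(2)[OF u2(1)] variance_L2[OF H1D(1)[OF u2(1)]] u2 by simp
  then have gap: "lam 2 > 0" using C(1) by (smt (verit) mult_nonneg_nonpos)
  obtain m where "m \<ge> 1" "eb.level (lam 2) = {2..m + 1}" by (rule eb.level_two[OF gap]) (rule that)
  then have "spectral_space \<mu> W u lam m" unfolding eb.level_def using eb gap by unfold_locales auto
  then show ?thesis by blast
qed

end

theorem proposition4:
  fixes \<mu> :: "(real^'n) measure" and W :: "real^'n \<Rightarrow> real^'n^'n"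
  assumes "prob_space \<mu>" and "sets \<mu> = sets borel"
    and "\<forall>x. measure \<mu> {x} \<noteq> 1"
    and "psd_field W"
    and "H1_hilbert \<mu> W"
    and "H1_compact_in_L2 \<mu> W"
    and "H1_dense_in_L2 \<mu> W"
    and "poincare_const \<mu> W < \<infinity>"
  shows "\<exists>u lam.
    orthonormal_basis \<mu> u \<and>
    (\<forall>i\<ge>1. u i \<in> eigenspace \<mu> W (lam i) \<and> 0 \<le> lam i) \<and>
    ordered_spectrum \<mu> W u lam \<and>
    filterlim lam at_top sequentially \<and>
    lam 1 = 0 \<and> u 1 = (\<lambda>_. 1) \<and>
    0 < lam 2 \<and> ennreal (lam 2) = 1 / poincare_const \<mu> W \<and>
    (\<exists>m\<ge>1.
      {i. 1 \<le> i \<and> lam i = lam 2} = {2..m+1} \<and>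
      eigenspace \<mu> W (lam 2) = span_ae \<mu> u {2..m+1} \<and>
      rayleigh_minimizers \<mu> W = {f \<in> span_ae \<mu> u {2..m+1}. \<not> null_fun \<mu> f} \<and>
      (let K = L2_field_closure \<mu> (field_conv
                 {normalized_grad_outer \<mu> v | v. v \<in> span_ae \<mu> u {2..m+1} \<and> \<not> null_fun \<mu> v})
       in superdiff \<mu> W = {G. sym_field G \<and> (\<exists>H\<in>K. agree_on_range \<mu> W G H)} \<and>
          ((AE x in \<mu>. \<forall>v. v \<noteq> 0 \<longrightarrow> 0 < v \<bullet> (W x *v v)) \<longrightarrow> superdiff \<mu> W = K)) \<and>
      (m = 1 \<longrightarrow> has_gradient \<mu> W (normalized_grad_outer \<mu> (u 2))))"
proof -
  interpret prob_space \<mu> by fact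
  have "energy_space \<mu> W"
  proof
    show "AE x in \<mu>. (g x - h x) \<bullet> (W x *v (g x - h x)) = 0"
      if "weak_gradient_of \<mu> f g" "weak_gradient_of \<mu> f h" for f g h
      using conjunct1[OF assms(5)[unfolded H1_hilbert_def]] that by blast
  qed fact+
  then have "compact_energy_space \<mu> W"
    using assms unfolding compact_energy_space_def compact_energy_space_axioms_def by blast
  then obtain u lam m where "spectral_space \<mu> W u lam m"
    using compact_energy_space.spectral_space_exists by blast
  then interpret s: spectral_space \<mu> W u lam m .
  have eig: "u i \<in> eigenspace \<mu> W (lam i)" if "i \<ge> 1" for i
    unfolding eigenspace_def Lop_def using s.eb.u_H[OF that] s.eb.u_eig[OF that] by simp
  have spec: "ordered_spectrum \<mu> W u lam"
    unfolding ordered_spectrum_def s.eigenspace_span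
    using s.eb.lam_mono s.eb.level_finite[unfolded s.eb.level_def] by simp
  have span: "eigenspace \<mu> W (lam 2) = span_ae \<mu> u {2..m + 1}"
    unfolding s.eigenspace_span s.level_two ..
  show ?thesis
    unfolding Let_def
    by (intro exI[of _ u] exI[of _ lam] exI[of _ m] conjI allI impI s.basis eig s.eb.lam_nonneg spec
        s.eb.lam_at_top s.eb.lam_1 s.eb.u_1 s.gap s.poincare_eq[symmetric] s.m s.level_two span
        s.rayleigh_minimizers_span s.superdiff_eq[unfolded s.generators_def]
        s.superdiff_eq_posdef[unfolded s.generators_def] s.simple_has_gradient)
qed

end
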